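(* Let $p,q \in [1,\infty]$ be such that either $2 \leq p < q \leq \infty$ or $1 \leq q < p \leq 2$. Then $\mathcal{M}_q \subsetneq \mathcal{M}_p$ and $\mathcal{M}^{cb}_q \subsetneq \mathcal{M}^{cb}_p$ (strict inclusions of sets of symbols $\mathbb{Z}\times\mathbb{Z}\to\mathbb{C}$).
   Context: Let $H=\ell_2(\mathbb{Z})$ with its standard orthonormal basis $(f_j)_{j\in\mathbb{Z}}$; operators $x$ on $H$ are identified with matrices $(x_{i,j})_{i,j\in\mathbb{Z}}$. For $1\le p<\infty$, $\mathcal{S}_p=\mathcal{S}_p(H)$ is the Schatten class of operators $x\in\mathcal{B}(H)$ with $\|x\|_p:=\mathrm{Tr}(|x|^p)^{1/p}<\infty$; $\mathcal{S}_\infty$ is the space of compact operators with the operator norm $\|\cdot\|_\infty$. Write $\mathcal{S}_p^s=\mathcal{S}_p(\mathbb{C}^s)$, and let $\mathcal{S}_p^s\otimes\mathcal{S}_p$ denote the $L_p$-tensor product, i.e. the $p$-norm closure of the algebraic tensor product inside $\mathcal{S}_p(\mathbb{C}^s\otimes H)$. A symbol is a function $m:\mathbb{Z}\times\mathbb{Z}\to\mathbb{C}$. It is an $L_p$-Schur multiplier if the map $(x_{i,j})_{i,j}\mapsto (m(i,j)x_{i,j})_{i,j}$ on finitely supported matrices extends to a bounded linear map $M_m:\mathcal{S}_p\to\mathcal{S}_p$. The set of all such symbols is $\mathcal{M}_p$, with norm $\|m\|_{\mathcal{M}_p}=\|M_m\|_{\mathcal{B}(\mathcal{S}_p)}$.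 The set $\mathcal{M}_p^{cb}\subseteq\mathcal{M}_p$ consists of those $m\in\mathcal{M}_p$ for which $M_m$ is completely bounded, i.e. $\|m\|_{\mathcal{M}_p^{cb}}:=\sup_{s\in\mathbb{N}_{\ge1}}\|\mathrm{id}_s\otimes M_m:\mathcal{S}_p^s\otimes\mathcal{S}_p\to\mathcal{S}_p^s\otimes\mathcal{S}_p\|<\infty$. *)

theory Defs
  imports "HOL-Analysis.Analysis" "HOL-Computational_Algebra.Polynomial"
begin

typedef 'i ell2 = "{v :: 'i \<Rightarrow> complex. (\<lambda>i. (cmod (v i))\<^sup>2) summable_on UNIV}"
  morphisms coord Abs_ell2
  by (rule exI[of _ "\<lambda>_. 0"]) simp

setup_lifting type_definition_ell2

lemma square_summable_add:
  fixes v w :: "'i \<Rightarrow> complex"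
  assumes "(\<lambda>i. (cmod (v i))\<^sup>2) summable_on A" "(\<lambda>i. (cmod (w i))\<^sup>2) summable_on A"
  shows "(\<lambda>i. (cmod (v i + w i))\<^sup>2) summable_on A"
proof (rule summable_on_comparison_test)
  show "(\<lambda>i. 2 * (cmod (v i))\<^sup>2 + 2 * (cmod (w i))\<^sup>2) summable_on A"
    using assms by (auto intro: summable_on_add summable_on_cmult_right)
  fix i
  have "(cmod (v i + w i))\<^sup>2 \<le> (cmod (v i) + cmod (w i))\<^sup>2"
    by (intro power_mono norm_triangle_ineq) auto
  also have "\<dots> \<le> 2 * (cmod (v i))\<^sup>2 + 2 * (cmod (w i))\<^sup>2"
    using sum_squares_bound[of "cmod (v i)" "cmod (w i)"] by (simp add: power2_sum)
  finally show "(cmod (v i + w i))\<^sup>2 \<le> 2 * (cmod (v i))\<^sup>2 + 2 * (cmod (w i))\<^sup>2" .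
qed auto

lemma square_summable_scale:
  fixes v :: "'i \<Rightarrow> complex"
  assumes "(\<lambda>i. (cmod (v i))\<^sup>2) summable_on A"
  shows "(\<lambda>i. (cmod (c * v i))\<^sup>2) summable_on A"
  unfolding norm_mult power_mult_distrib by (intro summable_on_cmult_right assms)

lemma square_summable_inner:
  fixes v w :: "'i \<Rightarrow> complex"
  assumes "(\<lambda>i. (cmod (v i))\<^sup>2) summable_on A" "(\<lambda>i. (cmod (w i))\<^sup>2) summable_on A"
  shows "(\<lambda>i. v i \<bullet> w i) summable_on A"
proof -
  have "(\<lambda>i. norm (v i \<bullet> w i)) summable_on A"
  proof (rule summable_on_comparison_test)
    show "(\<lambda>i. (cmod (v i))\<^sup>2 + (cmod (w i))\<^sup>2) summable_on A"
      by (intro summable_on_add assms)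
    fix i
    have "norm (v i \<bullet> w i) \<le> cmod (v i) * cmod (w i)"
      by (simp add: Cauchy_Schwarz_ineq2)
    also have "\<dots> \<le> (cmod (v i))\<^sup>2 + (cmod (w i))\<^sup>2"
      using sum_squares_bound[of "cmod (v i)" "cmod (w i)"]
        mult_nonneg_nonneg[OF norm_ge_zero norm_ge_zero, of "v i" "w i"] by linarith
    finally show "norm (v i \<bullet> w i) \<le> (cmod (v i))\<^sup>2 + (cmod (w i))\<^sup>2" .
  qed auto
  then show ?thesis by (rule abs_summable_summable)
qed

instantiation ell2 :: (type) real_inner
begin

lift_definition zero_ell2 :: "'a ell2" is "\<lambda>_. 0" by simp
lift_definition plus_ell2 :: "'a ell2 \<Rightarrow> 'a ell2 \<Rightarrow> 'a ell2" is "\<lambda>v w i. v i + w i"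
  by (rule square_summable_add)
lift_definition uminus_ell2 :: "'a ell2 \<Rightarrow> 'a ell2" is "\<lambda>v i. - v i" by simp
lift_definition minus_ell2 :: "'a ell2 \<Rightarrow> 'a ell2 \<Rightarrow> 'a ell2" is "\<lambda>v w i. v i - w i"
  subgoal for v w using square_summable_add[of v UNIV "\<lambda>i. - w i"] by simp
  done
lift_definition scaleR_ell2 :: "real \<Rightarrow> 'a ell2 \<Rightarrow> 'a ell2" is "\<lambda>r v i. of_real r * v i"
  by (rule square_summable_scale)

text \<open>The real inner product is the real part of the complex one, \<open>cinner\<close> below; both induce
  the same norm.\<close>

lift_definition inner_ell2 :: "'a ell2 \<Rightarrow> 'a ell2 \<Rightarrow> real" is "\<lambda>v w. \<Sum>\<^sub>\<infinity>i. v i \<bullet> w i" .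

definition norm_ell2 :: "'a ell2 \<Rightarrow> real" where "norm_ell2 v = sqrt (v \<bullet> v)"
definition sgn_ell2 :: "'a ell2 \<Rightarrow> 'a ell2" where "sgn_ell2 v = scaleR (inverse (norm v)) v"
definition dist_ell2 :: "'a ell2 \<Rightarrow> 'a ell2 \<Rightarrow> real" where "dist_ell2 v w = norm (v - w)"
definition uniformity_ell2 :: "('a ell2 \<times> 'a ell2) filter" where
  "uniformity_ell2 = (INF e\<in>{0<..}. principal {(v, w). dist v w < e})"
definition open_ell2 :: "'a ell2 set \<Rightarrow> bool" where
  "open_ell2 U \<longleftrightarrow> (\<forall>v\<in>U. \<forall>\<^sub>F (v', w) in uniformity. v' = v \<longrightarrow> w \<in> U)"

instance
proof
  fix u v w :: "'a ell2" and a b r :: real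
  show "u + v + w = u + (v + w)" by transfer (simp add: add.assoc)
  show "u + v = v + u" by transfer (simp add: add.commute)
  show "0 + u = u" by transfer simp
  show "- u + u = 0" by transfer simp
  show "u - v = u + - v" by transfer simp
  show "r *\<^sub>R (u + v) = r *\<^sub>R u + r *\<^sub>R v" by transfer (simp add: distrib_left)
  show "(a + b) *\<^sub>R u = a *\<^sub>R u + b *\<^sub>R u" by transfer (simp add: distrib_right)
  show "a *\<^sub>R b *\<^sub>R u = (a * b) *\<^sub>R u" by transfer (simp add: mult.assoc)
  show "1 *\<^sub>R u = u" by transfer simp
  show "u \<bullet> v = v \<bullet> u" by transfer (simp add: inner_commute)
  show "(u + v) \<bullet> w = u \<bullet> w + v \<bullet> w"
    by transfer (simp add: inner_add_left infsum_add square_summable_inner)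
  show "(r *\<^sub>R u) \<bullet> v = r * (u \<bullet> v)"
    by transfer (simp flip: scaleR_conv_of_real add: infsum_cmult_right')
  show "0 \<le> u \<bullet> u" by transfer (simp add: infsum_nonneg)
  show "u \<bullet> u = 0 \<longleftrightarrow> u = 0"
  proof transfer
    fix u :: "'a \<Rightarrow> complex"
    assume "(\<lambda>i. (cmod (u i))\<^sup>2) summable_on UNIV"
    then have s: "(\<lambda>i. u i \<bullet> u i) summable_on UNIV" by (simp add: power2_norm_eq_inner)
    show "(\<Sum>\<^sub>\<infinity>i. u i \<bullet> u i) = 0 \<longleftrightarrow> u = (\<lambda>_. 0)"
    proof
      assume "(\<Sum>\<^sub>\<infinity>i. u i \<bullet> u i) = 0"
      then have "u i \<bullet> u i = 0" for i
        using nonneg_infsum_le_0D[OF _ s, of i] by simp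
      then show "u = (\<lambda>_. 0)" by auto
    qed simp
  qed
qed (rule norm_ell2_def sgn_ell2_def dist_ell2_def uniformity_ell2_def open_ell2_def)+

end

lift_definition cscale :: "complex \<Rightarrow> 'i ell2 \<Rightarrow> 'i ell2" is "\<lambda>c v i. c * v i"
  by (rule square_summable_scale)

definition cinner :: "'i ell2 \<Rightarrow> 'i ell2 \<Rightarrow> complex" where
  "cinner v w = (\<Sum>\<^sub>\<infinity>i. cnj (coord v i) * coord w i)"

lift_definition ket :: "'i \<Rightarrow> 'i ell2" is "\<lambda>j i. if i = j then 1 else 0"
proof -
  fix j :: 'i
  have "(\<lambda>i. (cmod (if i = j then 1 else 0))\<^sup>2) summable_on {j}" by simp
  also have "?this \<longleftrightarrow> (\<lambda>i. (cmod (if i = j then 1 else 0))\<^sup>2) summable_on UNIV"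
    by (rule summable_on_cong_neutral) auto
  finally show "(\<lambda>i. (cmod (if i = j then 1 else 0))\<^sup>2) summable_on UNIV" .
qed

lemma norm_ell2_square: "(norm v)\<^sup>2 = (\<Sum>\<^sub>\<infinity>i. (cmod (coord v i))\<^sup>2)"
  by (simp add: power2_norm_eq_inner inner_ell2.rep_eq)

type_synonym 'i oper = "'i ell2 \<Rightarrow>\<^sub>L 'i ell2"

text \<open>Elements of \<open>'i oper\<close> are only real-linear; \<open>bounded_ops\<close> is the algebra of bounded
  complex-linear operators on \<open>\<ell>\<^sub>2\<close>.\<close>

definition bounded_ops :: "'i oper set" where
  "bounded_ops = {x. \<forall>c v. blinfun_apply x (cscale c v) = cscale c (blinfun_apply x v)}"

definition entry :: "'i oper \<Rightarrow> 'i \<Rightarrow> 'i \<Rightarrow> complex" where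
  "entry x i j = coord (blinfun_apply x (ket j)) i"

lemma bounded_linear_cscale: "bounded_linear (cscale c)"
proof (rule bounded_linear_intro[of _ "cmod c"])
  fix v w :: "'i ell2" and r :: real
  show "cscale c (v + w) = cscale c v + cscale c w" by transfer (simp add: distrib_left)
  show "cscale c (r *\<^sub>R v) = r *\<^sub>R cscale c v" by transfer (simp add: mult.left_commute)
  have "(norm (cscale c v))\<^sup>2 = (norm v * cmod c)\<^sup>2"
    by (simp add: norm_ell2_square cscale.rep_eq norm_mult power_mult_distrib
        infsum_cmult_right' mult.commute)
  then show "norm (cscale c v) \<le> norm v * cmod c"
    by (simp add: power2_eq_iff_nonneg)
qed

definition op_scale :: "complex \<Rightarrow> 'i oper \<Rightarrow> 'i oper" where
  "op_scale c x = Blinfun (cscale c) o\<^sub>L x"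

definition op_adj :: "'i oper \<Rightarrow> 'i oper" where
  "op_adj x = (THE y. \<forall>v w. cinner (blinfun_apply x v) w = cinner v (blinfun_apply y w))"

definition op_poly :: "real poly \<Rightarrow> 'i oper \<Rightarrow> 'i oper" where
  "op_poly f a = (\<Sum>k\<le>degree f. coeff f k *\<^sub>R (((o\<^sub>L) a) ^^ k) id_blinfun)"

text \<open>Continuous functional calculus of a positive operator \<open>a\<close>, whose spectrum lies in
  \<open>[0, \<parallel>a\<parallel>]\<close>: \<open>f(a)\<close> is the norm limit of \<open>f\<^sub>n(a)\<close> for polynomials \<open>f\<^sub>n\<close> converging to \<open>f\<close>
  uniformly on that interval.\<close>

definition fun_calc :: "(real \<Rightarrow> real) \<Rightarrow> 'i oper \<Rightarrow> 'i oper" where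
  "fun_calc f a = (THE b. \<forall>F. uniform_limit {0..norm a} (\<lambda>n. poly (F n)) f sequentially \<longrightarrow>
      (\<lambda>n. op_poly (F n) a) \<longlonglongrightarrow> b)"

definition op_abs :: "'i oper \<Rightarrow> 'i oper" where
  "op_abs x = fun_calc sqrt (op_adj x o\<^sub>L x)"

text \<open>Only meant for positive operators, so that \<open>ennreal\<close> truncates nothing.\<close>

definition op_trace :: "'i oper \<Rightarrow> ennreal" where
  "op_trace a = (\<Sum>\<^sub>\<infinity>j. ennreal (Re (cinner (ket j) (blinfun_apply a (ket j)))))"

definition compact_oper :: "'i oper \<Rightarrow> bool" where
  "compact_oper x \<longleftrightarrow> compact (closure (blinfun_apply x ` cball 0 1))"

definition trace_abs_powr :: "ennreal \<Rightarrow> 'i oper \<Rightarrow> ennreal" where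
  "trace_abs_powr p x = op_trace (fun_calc (\<lambda>t. t powr enn2real p) (op_abs x))"

definition schatten_class :: "ennreal \<Rightarrow> 'i oper set" where
  "schatten_class p =
    {x \<in> bounded_ops. if p = \<infinity> then compact_oper x else trace_abs_powr p x < \<infinity>}"

definition schatten_norm :: "ennreal \<Rightarrow> 'i oper \<Rightarrow> real" where
  "schatten_norm p x =
    (if p = \<infinity> then norm x else enn2real (trace_abs_powr p x) powr (1 / enn2real p))"

definition map_norm :: "ennreal \<Rightarrow> 'i oper set \<Rightarrow> ('i oper \<Rightarrow> 'i oper) \<Rightarrow> ennreal" where
  "map_norm p X T = (SUP x\<in>{x \<in> X. schatten_norm p x \<le> 1}. ennreal (schatten_norm p (T x)))"

definition finite_ops :: "'i oper set" where
  "finite_ops = {x \<in> bounded_ops. finite {(i, j). entry x i j \<noteq> 0}}"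

text \<open>\<open>T\<close>, restricted to the Schatten class, is the (unique) bounded linear extension \<open>M\<^sub>m\<close>.\<close>

definition schur_map :: "ennreal \<Rightarrow> (int \<times> int \<Rightarrow> complex) \<Rightarrow> (int oper \<Rightarrow> int oper) \<Rightarrow> bool" where
  "schur_map p m T \<longleftrightarrow>
    T \<in> schatten_class p \<rightarrow> schatten_class p \<and>
    (\<forall>x\<in>schatten_class p. \<forall>y\<in>schatten_class p. T (x + y) = T x + T y) \<and>
    (\<forall>c. \<forall>x\<in>schatten_class p. T (op_scale c x) = op_scale c (T x)) \<and>
    map_norm p (schatten_class p) T < \<infinity> \<and>
    (\<forall>x\<in>finite_ops. \<forall>i j. entry (T x) i j = m (i, j) * entry x i j)"

definition schur_multipliers :: "ennreal \<Rightarrow> (int \<times> int \<Rightarrow> complex) set" where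
  "schur_multipliers p = {m. \<exists>T. schur_map p m T}"

text \<open>\<open>\<complex>\<^sup>s \<otimes> \<ell>\<^sub>2(\<int>)\<close> is realised as the subspace of \<open>\<ell>\<^sub>2(\<nat> \<times> \<int>)\<close> of vectors supported on
  \<open>{..<s} \<times> \<int>\<close>, and operators on it as operators on \<open>\<ell>\<^sub>2(\<nat> \<times> \<int>)\<close> that vanish on its orthogonal
  complement and map into it. This changes neither \<open>Tr(|x|\<^sup>p)\<close>, nor the operator norm, nor
  compactness. The isometry \<open>slot k\<close> sends \<open>v\<close> to \<open>e\<^sub>k \<otimes> v\<close>, and \<open>unslot k\<close> is its adjoint.\<close>

lift_definition slot_fun :: "nat \<Rightarrow> int ell2 \<Rightarrow> (nat \<times> int) ell2"
  is "\<lambda>k v z. if fst z = k then v (snd z) else 0"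
proof -
  fix k and v :: "int \<Rightarrow> complex"
  assume "(\<lambda>i. (cmod (v i))\<^sup>2) summable_on UNIV"
  then have "(\<lambda>z. (cmod (v (snd z)))\<^sup>2) summable_on (Pair k ` UNIV)"
    by (subst summable_on_reindex) (auto simp: inj_on_def o_def)
  also have "?this \<longleftrightarrow> (\<lambda>z. (cmod (if fst z = k then v (snd z) else 0))\<^sup>2) summable_on UNIV"
    by (rule summable_on_cong_neutral) (auto simp: image_iff)
  finally show "(\<lambda>z. (cmod (if fst z = k then v (snd z) else 0))\<^sup>2) summable_on UNIV" .
qed

lift_definition unslot_fun :: "nat \<Rightarrow> (nat \<times> int) ell2 \<Rightarrow> int ell2" is "\<lambda>k w i. w (k, i)"
  subgoal for k w
  proof -
    assume "(\<lambda>z. (cmod (w z))\<^sup>2) summable_on UNIV"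
    then have "(\<lambda>z. (cmod (w z))\<^sup>2) summable_on (Pair k ` UNIV)"
      by (rule summable_on_subset_banach) simp
    then show ?thesis
      by (subst (asm) summable_on_reindex) (auto simp: inj_on_def o_def)
  qed
  done

lemma norm_slot_fun: "norm (slot_fun k v) = norm v"
proof -
  have "(\<Sum>\<^sub>\<infinity>z. (cmod (coord (slot_fun k v) z))\<^sup>2)
      = (\<Sum>\<^sub>\<infinity>z\<in>Pair k ` UNIV. (cmod (coord (slot_fun k v) z))\<^sup>2)"
    by (rule infsum_cong_neutral) (auto simp: slot_fun.rep_eq)
  also have "\<dots> = (\<Sum>\<^sub>\<infinity>i. (cmod (coord v i))\<^sup>2)"
    by (subst infsum_reindex) (auto simp: inj_on_def o_def slot_fun.rep_eq)
  finally have "(norm (slot_fun k v))\<^sup>2 = (norm v)\<^sup>2" by (simp add: norm_ell2_square)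
  then show ?thesis by simp
qed

lemma norm_unslot_fun: "norm (unslot_fun k w) \<le> norm w"
proof -
  have s: "(\<lambda>z. (cmod (coord w z))\<^sup>2) summable_on UNIV" using coord[of w] by simp
  have "(\<Sum>\<^sub>\<infinity>i. (cmod (coord (unslot_fun k w) i))\<^sup>2)
      = (\<Sum>\<^sub>\<infinity>z\<in>Pair k ` UNIV. (cmod (coord w z))\<^sup>2)"
    by (subst infsum_reindex) (auto simp: inj_on_def o_def unslot_fun.rep_eq)
  also have "\<dots> \<le> (\<Sum>\<^sub>\<infinity>z. (cmod (coord w z))\<^sup>2)"
    by (rule infsum_mono_neutral) (auto intro: s summable_on_subset_banach[OF s])
  finally have "(norm (unslot_fun k w))\<^sup>2 \<le> (norm w)\<^sup>2" by (simp add: norm_ell2_square)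
  then show ?thesis by (simp add: power2_le_iff_abs_le)
qed

lemma bounded_linear_slot_fun: "bounded_linear (slot_fun k)"
proof (rule bounded_linear_intro[of _ 1])
  fix v w :: "int ell2" and r :: real
  show "slot_fun k (v + w) = slot_fun k v + slot_fun k w" by transfer (simp add: fun_eq_iff)
  show "slot_fun k (r *\<^sub>R v) = r *\<^sub>R slot_fun k v" by transfer (simp add: fun_eq_iff)
  show "norm (slot_fun k v) \<le> norm v * 1" by (simp add: norm_slot_fun)
qed

lemma bounded_linear_unslot_fun: "bounded_linear (unslot_fun k)"
proof (rule bounded_linear_intro[of _ 1])
  fix v w :: "(nat \<times> int) ell2" and r :: real
  show "unslot_fun k (v + w) = unslot_fun k v + unslot_fun k w" by transfer simp
  show "unslot_fun k (r *\<^sub>R v) = r *\<^sub>R unslot_fun k v" by transfer simp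
  show "norm (unslot_fun k w) \<le> norm w * 1" by (simp add: norm_unslot_fun)
qed

lift_definition slot :: "nat \<Rightarrow> int ell2 \<Rightarrow>\<^sub>L (nat \<times> int) ell2" is slot_fun
  by (rule bounded_linear_slot_fun)

lift_definition unslot :: "nat \<Rightarrow> (nat \<times> int) ell2 \<Rightarrow>\<^sub>L int ell2" is unslot_fun
  by (rule bounded_linear_unslot_fun)

text \<open>\<open>a \<otimes> x\<close> for an \<open>s \<times> s\<close> matrix \<open>a\<close>; entries of \<open>a\<close> outside that range are ignored.\<close>

definition tensor :: "nat \<Rightarrow> (nat \<Rightarrow> nat \<Rightarrow> complex) \<Rightarrow> int oper \<Rightarrow> (nat \<times> int) oper" where
  "tensor s a x = (\<Sum>k<s. \<Sum>l<s. op_scale (a k l) (slot k o\<^sub>L x o\<^sub>L unslot l))"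

definition schatten_class_amp :: "nat \<Rightarrow> ennreal \<Rightarrow> (nat \<times> int) oper set" where
  "schatten_class_amp s p =
    {z \<in> schatten_class p. (\<Sum>k<s. slot k o\<^sub>L unslot k) o\<^sub>L z = z \<and>
                           z o\<^sub>L (\<Sum>k<s. slot k o\<^sub>L unslot k) = z}"

text \<open>The real span below is also the complex span, since scalars can be absorbed into \<open>a\<close>.\<close>

definition schatten_tensor :: "nat \<Rightarrow> ennreal \<Rightarrow> (nat \<times> int) oper set" where
  "schatten_tensor s p =
    {z \<in> schatten_class_amp s p. \<forall>\<epsilon>>0.
      \<exists>w\<in>span {tensor s a x |a x. x \<in> schatten_class p}. schatten_norm p (z - w) < \<epsilon>}"

text \<open>\<open>id\<^sub>s \<otimes> T\<close>: apply \<open>T\<close> to each of the \<open>s \<times> s\<close> blocks of \<open>z\<close>, so that \<open>a \<otimes> x\<close> is sent to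
  \<open>a \<otimes> T x\<close>.\<close>

definition amplify :: "nat \<Rightarrow> (int oper \<Rightarrow> int oper) \<Rightarrow> (nat \<times> int) oper \<Rightarrow> (nat \<times> int) oper" where
  "amplify s T z = (\<Sum>k<s. \<Sum>l<s. slot k o\<^sub>L T (unslot k o\<^sub>L z o\<^sub>L slot l) o\<^sub>L unslot l)"

definition cb_norm :: "ennreal \<Rightarrow> (int oper \<Rightarrow> int oper) \<Rightarrow> ennreal" where
  "cb_norm p T = (SUP s\<in>{1..}. map_norm p (schatten_tensor s p) (amplify s T))"

definition cb_schur_multipliers :: "ennreal \<Rightarrow> (int \<times> int \<Rightarrow> complex) set" where
  "cb_schur_multipliers p = {m. \<exists>T. schur_map p m T \<and> cb_norm p T < \<infinity>}"

end

theory Submission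
  imports Defs "HOL-Complex_Analysis.Conformal_Mappings"
begin

text \<open>
  For \<open>1 \<le> p < \<infinity>\<close> the number \<open>Tr(|x|\<^sup>p)\<close> is the supremum of \<open>\<Sum>\<^sub>k |\<langle>u\<^sub>k, x v\<^sub>k\<rangle>|\<^sup>p\<close> over all finite orthonormal systems
  \<open>u, v\<close>. Hence multipliers may be tested on finite matrices, and after fixing orthonormal systems
  \<open>u, v\<close> for the output and \<open>f, g\<close> for the singular value decomposition of the input, a Schur multiplier becomes a
  scalar matrix acting between finite-dimensional \<open>\<ell>\<^sub>p\<close> spaces. Interpolating between \<open>\<S>\<^sub>q\<close> and \<open>\<S>\<^sub>2\<close>, where the norm is
  the supremum norm of the symbol and thus at most the one on \<open>\<S>\<^sub>q\<close>, reduces to the three lines theorem and gives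
  both inclusions; the amplified symbol \<open>((k, i), (l, j)) \<mapsto> m(i, j)\<close> is covered by the same argument.

  They are strict because of the Fourier matrix \<open>F\<^sub>r\<close> of order \<open>r\<close>. As a completely bounded multiplier it has norm
  \<open>1\<close> on \<open>\<S>\<^sub>2\<close> and at most \<open>\<surd>r\<close> on \<open>\<S>\<^sub>1\<close> and \<open>\<S>\<^sub>\<infinity>\<close>, hence at most \<open>r\<close> to the power \<open>|1/2 - 1/p|\<close> on \<open>\<S>\<^sub>p\<close>; this is attained,
  as one sees by applying it to its entrywise conjugate (\<open>p \<ge> 2\<close>) or to the all-ones matrix (\<open>p \<le> 2\<close>). Placing suitable multiples of
  all \<open>F\<^sub>r\<close> along the diagonal yields a symbol which is completely bounded on \<open>\<S>\<^sub>p\<close> and unbounded on \<open>\<S>\<^sub>q\<close>.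
\<close>

section \<open>The Hilbert space structure of \<open>\<ell>\<^sub>2\<close>\<close>

text \<open>The obstacle is the definition of the Schatten norm: the trace of a power of a square
  root, each stage a limit of polynomials in an operator. Spectral theory is replaced by finite
  truncations, which have a singular value decomposition and converge strongly; identities for
  functions of \<open>gram x\<close> are read off from diagonal forms and survive the limit. The
  supremum over orthonormal systems is lower semicontinuous under strong limits, so bounds on finite
  matrices pass to the whole class. With \<open>a = 1/p\<close> and \<open>b = 1/q\<close>, both
  alternatives of the hypothesis say that \<open>a\<close> lies between \<open>1/2\<close> and
  \<open>b\<close> and differs from \<open>b\<close>; one argument serves both. At \<open>q\<close>,
  possibly \<open>\<infinity>\<close>, multipliers enter only through finite matrices, while
  \<open>p\<close> is always finite. The Fourier block of order \<open>r\<close> is multiplied by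
  \<open>r\<close> to the power \<open>-|1/2 - a|\<close>. This keeps its norm at \<open>p\<close>
  bounded by 1, and leaves growth of order \<open>|1/2 - b| - |1/2 - a|\<close> at \<open>q\<close>.
  Letting the factor depend on the complex parameter makes all blocks together an analytic family,
  so that no separate estimate for block diagonal symbols enters.\<close>

lemmas coord_simps [simp] = zero_ell2.rep_eq plus_ell2.rep_eq uminus_ell2.rep_eq
  minus_ell2.rep_eq scaleR_ell2.rep_eq cscale.rep_eq ket.rep_eq

lemma ell2_eqI: "(\<And>i. coord v i = coord w i) \<Longrightarrow> v = w"
  by (simp add: coord_inject[symmetric] fun_eq_iff)

lemma coord_sum [simp]: "coord (\<Sum>k\<in>K. f k) i = (\<Sum>k\<in>K. coord (f k) i)"
  by (induction K rule: infinite_finite_induct) auto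

lemma summable_coord: "(\<lambda>i. (cmod (coord v i))\<^sup>2) summable_on A"
  using coord[of v] summable_on_subset_banach by blast

lemma ell2_of_bounded:
  assumes "\<And>F. finite F \<Longrightarrow> (\<Sum>i\<in>F. (cmod (f i))\<^sup>2) \<le> B"
  obtains v where "coord v = f" "(norm v)\<^sup>2 \<le> B"
proof -
  have s: "(\<lambda>i. (cmod (f i))\<^sup>2) summable_on UNIV"
    by (rule nonneg_bdd_above_summable_on) (auto intro!: bdd_aboveI2[where M = B] assms)
  then have e: "coord (Abs_ell2 f) = f" by (simp add: Abs_ell2_inverse)
  have "(norm (Abs_ell2 f))\<^sup>2 \<le> B"
    unfolding norm_ell2_square e by (rule infsum_le_finite_sums[OF s]) (auto intro: assms)
  with e that show ?thesis by blast
qed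

lemma sum_coord_le_norm: "finite F \<Longrightarrow> (\<Sum>i\<in>F. (cmod (coord v i))\<^sup>2) \<le> (norm v)\<^sup>2"
  unfolding norm_ell2_square by (rule finite_sum_le_infsum) (auto intro: summable_coord)

lemma norm_coord_le: "cmod (coord v i) \<le> norm v"
  using sum_coord_le_norm[of "{i}" v] by (simp add: power2_le_iff_abs_le)

lemma norm_ell2_leI:
  assumes "\<And>F. finite F \<Longrightarrow> (\<Sum>i\<in>F. (cmod (coord v i))\<^sup>2) \<le> B\<^sup>2" "0 \<le> B"
  shows "norm v \<le> B"
proof -
  have "(norm v)\<^sup>2 \<le> B\<^sup>2"
    unfolding norm_ell2_square by (rule infsum_le_finite_sums[OF summable_coord]) (auto intro: assms)
  then show ?thesis using assms(2) by (simp add: power2_le_iff_abs_le)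
qed

text \<open>Completeness passes to the operators, where it provides the limits of polynomials behind
  \<open>fun_calc\<close>.\<close>

instance ell2 :: (type) banach
proof
  fix X :: "nat \<Rightarrow> 'a ell2"
  assume X: "Cauchy X"
  have "Cauchy (\<lambda>n. coord (X n) i)" for i
  proof (rule metric_CauchyI)
    fix e :: real assume "0 < e"
    then obtain N where "\<forall>m\<ge>N. \<forall>n\<ge>N. dist (X m) (X n) < e"
      using X by (meson metric_CauchyD)
    moreover have "dist (coord (X m) i) (coord (X n) i) \<le> dist (X m) (X n)" for m n
      using norm_coord_le[of "X m - X n" i] by (simp add: dist_norm)
    ultimately show "\<exists>M. \<forall>m\<ge>M. \<forall>n\<ge>M. dist (coord (X m) i) (coord (X n) i) < e"
      by (meson order_le_less_trans)
  qed
  then have "\<forall>i. \<exists>l. (\<lambda>n. coord (X n) i) \<longlonglongrightarrow> l"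
    by (simp add: Cauchy_convergent_iff convergent_def)
  then obtain L where L: "\<And>i. (\<lambda>n. coord (X n) i) \<longlonglongrightarrow> L i" by metis
  have tail: "(\<Sum>i\<in>F. (cmod (coord (X n) i - L i))\<^sup>2) \<le> e\<^sup>2"
    if "finite F" "\<forall>m\<ge>N. \<forall>n\<ge>N. dist (X m) (X n) < e" "n \<ge> N" for F n N e
  proof (rule LIMSEQ_le_const2)
    show "(\<lambda>m. \<Sum>i\<in>F. (cmod (coord (X n) i - coord (X m) i))\<^sup>2)
        \<longlonglongrightarrow> (\<Sum>i\<in>F. (cmod (coord (X n) i - L i))\<^sup>2)"
      by (intro tendsto_intros L)
    have "(\<Sum>i\<in>F. (cmod (coord (X n) i - coord (X m) i))\<^sup>2) \<le> e\<^sup>2" if "m \<ge> N" for m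
    proof -
      have "(\<Sum>i\<in>F. (cmod (coord (X n) i - coord (X m) i))\<^sup>2) \<le> (norm (X n - X m))\<^sup>2"
        using sum_coord_le_norm[OF \<open>finite F\<close>, of "X n - X m"] by simp
      also have "\<dots> \<le> e\<^sup>2"
        using \<open>\<forall>m\<ge>N. \<forall>n\<ge>N. dist (X m) (X n) < e\<close> \<open>n \<ge> N\<close> \<open>m \<ge> N\<close>
        by (intro power_mono) (auto simp: dist_norm intro: less_imp_le)
      finally show ?thesis .
    qed
    then show "\<exists>N. \<forall>m\<ge>N. (\<Sum>i\<in>F. (cmod (coord (X n) i - coord (X m) i))\<^sup>2) \<le> e\<^sup>2" by blast
  qed
  obtain N where N: "\<forall>m\<ge>N. \<forall>n\<ge>N. dist (X m) (X n) < 1"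
    using metric_CauchyD[OF X, of 1] by auto
  \<comment> \<open>The coordinatewise limit \<open>L\<close> lies in the space because its
    difference from \<open>X N\<close> does, by \<open>tail\<close> with the arbitrary tolerance
    1.\<close>
  obtain d where d: "coord d = (\<lambda>i. coord (X N) i - L i)"
    by (rule ell2_of_bounded[of "\<lambda>i. coord (X N) i - L i", OF tail[OF _ N order_refl]])
  have "X \<longlonglongrightarrow> X N - d"
  proof (rule metric_LIMSEQ_I)
    fix r :: real assume "0 < r"
    then obtain M where M: "\<forall>m\<ge>M. \<forall>n\<ge>M. dist (X m) (X n) < r / 2"
      using metric_CauchyD[OF X, of "r / 2"] by auto
    have "dist (X n) (X N - d) < r" if "n \<ge> M" for n
    proof -
      have "norm (X n - (X N - d)) \<le> r / 2"
      proof (rule norm_ell2_leI)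
        fix F :: "'a set" assume "finite F"
        then show "(\<Sum>i\<in>F. (cmod (coord (X n - (X N - d)) i))\<^sup>2) \<le> (r / 2)\<^sup>2"
          using tail[OF _ M that, of F] by (simp add: d)
      qed (use \<open>0 < r\<close> in simp)
      then show ?thesis using \<open>0 < r\<close> by (simp add: dist_norm)
    qed
    then show "\<exists>no. \<forall>n\<ge>no. dist (X n) (X N - d) < r" by blast
  qed
  then show "convergent X" by (auto simp: convergent_def)
qed

section \<open>The complex inner product\<close>

lemma abs_summable_cinner: "(\<lambda>i. norm (cnj (coord v i) * coord w i)) summable_on A"
proof (rule summable_on_comparison_test)
  show "(\<lambda>i. (cmod (coord v i))\<^sup>2 + (cmod (coord w i))\<^sup>2) summable_on A"
    by (intro summable_on_add summable_coord)
  fix i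
  show "norm (cnj (coord v i) * coord w i) \<le> (cmod (coord v i))\<^sup>2 + (cmod (coord w i))\<^sup>2"
    using sum_squares_bound[of "cmod (coord v i)" "cmod (coord w i)"]
      mult_nonneg_nonneg[OF norm_ge_zero norm_ge_zero, of "coord v i" "coord w i"]
    unfolding norm_mult complex_mod_cnj by linarith
qed auto

lemma summable_cinner: "(\<lambda>i. cnj (coord v i) * coord w i) summable_on A"
  using abs_summable_cinner by (rule abs_summable_summable)

lemma cinner_add_right [simp]: "cinner u (v + w) = cinner u v + cinner u w"
  by (simp add: cinner_def distrib_left infsum_add summable_cinner)

lemma cinner_add_left [simp]: "cinner (u + v) w = cinner u w + cinner v w"
  by (simp add: cinner_def distrib_right infsum_add summable_cinner)

lemma cinner_cscale_right [simp]: "cinner u (cscale c v) = c * cinner u v"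
  by (simp add: cinner_def mult.left_commute[of _ c] infsum_cmult_right')

lemma cinner_cscale_left [simp]: "cinner (cscale c u) v = cnj c * cinner u v"
  by (simp add: cinner_def mult.assoc infsum_cmult_right')

lemma cnj_cinner: "cnj (cinner u v) = cinner v u"
  by (simp add: cinner_def infsum_cnj[symmetric] mult.commute)

lemma scaleR_eq_cscale: "r *\<^sub>R v = cscale (of_real r) v"
  by (rule ell2_eqI) simp

lemma uminus_eq_cscale: "- v = cscale (-1) v"
  by (rule ell2_eqI) simp

lemma cinner_scaleR_right [simp]: "cinner u (r *\<^sub>R v) = of_real r * cinner u v"
  by (simp add: scaleR_eq_cscale)

lemma cinner_scaleR_left [simp]: "cinner (r *\<^sub>R u) v = of_real r * cinner u v"
  by (simp add: scaleR_eq_cscale)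

lemma cinner_minus_right [simp]: "cinner u (- v) = - cinner u v"
  by (simp add: uminus_eq_cscale)

lemma cinner_minus_left [simp]: "cinner (- u) v = - cinner u v"
  by (simp add: uminus_eq_cscale)

lemma cinner_diff_right [simp]: "cinner u (v - w) = cinner u v - cinner u w"
  using cinner_add_right[of u v "- w"] by simp

lemma cinner_diff_left [simp]: "cinner (u - v) w = cinner u w - cinner v w"
  using cinner_add_left[of u "- v" w] by simp

lemma cinner_zero_right [simp]: "cinner u 0 = 0"
  by (simp add: cinner_def)

lemma cinner_zero_left [simp]: "cinner 0 u = 0"
  by (simp add: cinner_def)

lemma cinner_sum_right: "cinner u (\<Sum>k\<in>K. f k) = (\<Sum>k\<in>K. cinner u (f k))"
  by (induction K rule: infinite_finite_induct) auto

lemma cinner_sum_left: "cinner (\<Sum>k\<in>K. f k) u = (\<Sum>k\<in>K. cinner (f k) u)"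
  by (induction K rule: infinite_finite_induct) auto

lemma cinner_ket_left [simp]: "cinner (ket i) v = coord v i"
proof -
  have "cinner (ket i) v = (\<Sum>\<^sub>\<infinity>j\<in>{i}. cnj (coord (ket i) j) * coord v j)"
    unfolding cinner_def by (rule infsum_cong_neutral) auto
  then show ?thesis by simp
qed

lemma cinner_ket_right [simp]: "cinner v (ket i) = cnj (coord v i)"
  using cnj_cinner[of "ket i" v] by simp

lemma cinner_self: "cinner v v = of_real ((norm v)\<^sup>2)"
proof -
  have "cinner v v = (\<Sum>\<^sub>\<infinity>i. complex_of_real ((cmod (coord v i))\<^sup>2))"
    unfolding cinner_def by (intro infsum_cong) (metis complex_norm_square mult.commute)
  also have "\<dots> = of_real (\<Sum>\<^sub>\<infinity>i. (cmod (coord v i))\<^sup>2)"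
    by (rule infsumI has_sum_of_real has_sum_infsum summable_coord)+
  finally show ?thesis by (simp add: norm_ell2_square)
qed

lemma Re_cinner: "Re (cinner v w) = v \<bullet> w"
proof -
  have s: "(\<Sum>\<^sub>\<infinity>i. Re (cnj (coord v i) * coord w i)) = Re (cinner v w)"
    unfolding cinner_def by (rule infsum_Re[OF summable_cinner])
  have "(\<Sum>\<^sub>\<infinity>i. coord v i \<bullet> coord w i) = (\<Sum>\<^sub>\<infinity>i. Re (cnj (coord v i) * coord w i))"
    by (rule infsum_cong) (simp add: inner_complex_def)
  with s show ?thesis by (simp add: inner_ell2.rep_eq)
qed

lemma norm_cscale [simp]: "norm (cscale c v) = cmod c * norm v"
proof -
  have "cinner (cscale c v) (cscale c v) = (c * cnj c) * cinner v v"
    by (simp add: mult_ac)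
  also have "\<dots> = of_real ((cmod c * norm v)\<^sup>2)"
    unfolding complex_norm_square[symmetric] cinner_self power_mult_distrib of_real_mult ..
  finally have "complex_of_real ((norm (cscale c v))\<^sup>2) = of_real ((cmod c * norm v)\<^sup>2)"
    unfolding cinner_self .
  then have "(norm (cscale c v))\<^sup>2 = (cmod c * norm v)\<^sup>2"
    using of_real_eq_iff by blast
  then show ?thesis by (simp add: power2_eq_iff_nonneg)
qed

lemma norm_ket [simp]: "norm (ket i) = 1"
proof -
  have "complex_of_real ((norm (ket i))\<^sup>2) = 1"
    using cinner_self[of "ket i"] by simp
  then have "(norm (ket i :: 'a ell2))\<^sup>2 = 1" by (metis of_real_eq_1_iff)
  then show ?thesis by (simp add: power2_eq_iff_nonneg[of _ 1, simplified])
qed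

lemma cscale_0 [simp]: "cscale 0 v = 0" by (rule ell2_eqI) simp
lemma cscale_1 [simp]: "cscale 1 v = v" by (rule ell2_eqI) simp
lemma cscale_zero [simp]: "cscale c 0 = 0" by (rule ell2_eqI) simp
lemma cscale_cscale [simp]: "cscale a (cscale b v) = cscale (a * b) v" by (rule ell2_eqI) simp
lemma cscale_add: "cscale a (v + w) = cscale a v + cscale a w"
  by (rule ell2_eqI) (simp add: distrib_left)
lemma cscale_add_left: "cscale (a + b) v = cscale a v + cscale b v"
  by (rule ell2_eqI) (simp add: distrib_right)
lemma cscale_diff: "cscale a (v - w) = cscale a v - cscale a w"
  by (rule ell2_eqI) (simp add: right_diff_distrib)
lemma cscale_scaleR: "cscale a (r *\<^sub>R v) = r *\<^sub>R cscale a v"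
  by (rule ell2_eqI) simp
lemma cscale_sum: "cscale a (\<Sum>k\<in>K. f k) = (\<Sum>k\<in>K. cscale a (f k))"
  by (rule ell2_eqI) (simp add: sum_distrib_left)

text \<open>Multiplying \<open>w\<close> by the unimodular \<open>c\<close> rotates the product onto
  the nonnegative reals, where the real Cauchy-Schwarz inequality applies.\<close>

lemma cmod_cinner_le: "cmod (cinner v w) \<le> norm v * norm w"
proof (cases "cinner v w = 0")
  case False
  define z where "z = cinner v w"
  define c where "c = cnj z / of_real (cmod z)"
  have "complex_of_real (cmod (cinner v w)) = c * cinner v w"
    using False complex_norm_square[of z] unfolding c_def z_def[symmetric]
    by (simp add: field_simps power2_eq_square)
  then have "cmod (cinner v w) = Re (cinner v (cscale c w))"
    by (metis Re_complex_of_real cinner_cscale_right)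
  also have "\<dots> \<le> norm v * norm (cscale c w)"
    unfolding Re_cinner by (rule norm_cauchy_schwarz)
  also have "\<dots> = norm v * norm w"
    using False by (simp add: c_def z_def norm_divide)
  finally show ?thesis .
qed simp

lemma bounded_linear_cinner_right: "bounded_linear (cinner u)"
  by (rule bounded_linear_intro[of _ "norm u"])
    (auto simp: scaleR_conv_of_real cmod_cinner_le mult.commute[of _ "norm u"])

lemmas tendsto_cinner_right = bounded_linear.tendsto[OF bounded_linear_cinner_right]

lemmas tendsto_cscale = bounded_linear.tendsto[OF bounded_linear_cscale]

lemma cinner_ext: "(\<And>u. cinner u v = cinner u w) \<Longrightarrow> v = w"
  by (rule ell2_eqI) (metis cinner_ket_left)

section \<open>Finitely supported vectors and coordinate cuts\<close>

definition supported :: "'i set \<Rightarrow> 'i ell2 \<Rightarrow> bool" where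
  "supported F v \<longleftrightarrow> (\<forall>i. i \<notin> F \<longrightarrow> coord v i = 0)"

text \<open>Written as a combination of basis vectors so that a linear operator can be pulled
  through it and its matrix entries appear.\<close>

definition cut :: "'i set \<Rightarrow> 'i ell2 \<Rightarrow> 'i ell2" where
  "cut F v = (\<Sum>i\<in>F. cscale (coord v i) (ket i))"

lemma coord_cut: "finite F \<Longrightarrow> coord (cut F v) i = (if i \<in> F then coord v i else 0)"
proof -
  assume "finite F"
  have "coord (cut F v) i = (\<Sum>k\<in>F. if i = k then coord v k else 0)"
    unfolding cut_def coord_sum by (rule sum.cong) auto
  then show ?thesis using \<open>finite F\<close> by simp
qed

lemma supported_cut: "finite F \<Longrightarrow> supported F (cut F v)"
  by (simp add: supported_def coord_cut)

lemma cut_supported: "finite F \<Longrightarrow> supported F v \<Longrightarrow> cut F v = v"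
  by (rule ell2_eqI) (auto simp: coord_cut supported_def)

lemma supported_0 [simp]: "supported F 0"
  and supported_add: "supported F v \<Longrightarrow> supported F w \<Longrightarrow> supported F (v + w)"
  and supported_diff: "supported F v \<Longrightarrow> supported F w \<Longrightarrow> supported F (v - w)"
  and supported_cscale: "supported F v \<Longrightarrow> supported F (cscale c v)"
  and supported_scaleR: "supported F v \<Longrightarrow> supported F (r *\<^sub>R v)"
  by (auto simp: supported_def)

lemma supported_sum: "(\<And>k. k \<in> K \<Longrightarrow> supported F (f k)) \<Longrightarrow> supported F (\<Sum>k\<in>K. f k)"
  by (auto simp: supported_def)

lemma supported_ket: "i \<in> F \<Longrightarrow> supported F (ket i)"
  by (auto simp: supported_def)

lemma cinner_finite:
  assumes "finite F" "supported F v"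
  shows "cinner v w = (\<Sum>i\<in>F. cnj (coord v i) * coord w i)"
proof -
  have "cinner v w = (\<Sum>\<^sub>\<infinity>i\<in>F. cnj (coord v i) * coord w i)"
    unfolding cinner_def using assms(2) by (intro infsum_cong_neutral) (auto simp: supported_def)
  then show ?thesis using assms(1) by simp
qed

lemma norm_finite: "finite F \<Longrightarrow> supported F v \<Longrightarrow> (norm v)\<^sup>2 = (\<Sum>i\<in>F. (cmod (coord v i))\<^sup>2)"
proof -
  assume *: "finite F" "supported F v"
  have "(norm v)\<^sup>2 = (\<Sum>\<^sub>\<infinity>i\<in>F. (cmod (coord v i))\<^sup>2)"
    unfolding norm_ell2_square using *(2) by (intro infsum_cong_neutral) (auto simp: supported_def)
  then show ?thesis using *(1) by simp
qed

lemma norm_cut_le: "finite F \<Longrightarrow> norm (cut F v) \<le> norm v"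
proof -
  assume F: "finite F"
  have "(norm (cut F v))\<^sup>2 = (\<Sum>i\<in>F. (cmod (coord v i))\<^sup>2)"
    unfolding norm_finite[OF F supported_cut[OF F]] by (auto simp: coord_cut F)
  also have "\<dots> \<le> (norm v)\<^sup>2" using F by (rule sum_coord_le_norm)
  finally show ?thesis by (simp add: power2_le_iff_abs_le)
qed

lemma cinner_cut: "finite F \<Longrightarrow> cinner (cut F v) w = cinner v (cut F w)"
proof -
  assume F: "finite F"
  have "cinner (cut F v) w = (\<Sum>i\<in>F. cnj (coord (cut F v) i) * coord w i)"
    using F by (simp add: cinner_finite[OF F supported_cut])
  also have "\<dots> = cnj (\<Sum>i\<in>F. cnj (coord (cut F w) i) * coord v i)"
    using F by (simp add: coord_cut mult.commute)
  also have "\<dots> = cinner v (cut F w)"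
    using F by (simp add: cinner_finite[OF F supported_cut, symmetric] cnj_cinner)
  finally show ?thesis .
qed

text \<open>The index type is arbitrary (\<open>int\<close> and \<open>nat \<times> int\<close> in
  the end), so limits run over the directed set of finite index sets instead of a sequence.\<close>

abbreviation finsub :: "'i set filter" where "finsub \<equiv> finite_subsets_at_top UNIV"

lemma eventually_finsubI: "(\<And>F. finite F \<Longrightarrow> P F) \<Longrightarrow> eventually P finsub"
  by (auto simp: eventually_finite_subsets_at_top)

lemma eventually_finsub: "finite G \<Longrightarrow> eventually (\<lambda>F. finite F \<and> G \<subseteq> F) finsub"
  by (auto simp: eventually_finite_subsets_at_top)

text \<open>By Pythagoras the squared error is the total square sum minus its finite partial
  sum.\<close>

lemma tendsto_cut: "((\<lambda>F. cut F v) \<longlongrightarrow> v) finsub"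
proof -
  have lim: "((\<lambda>F. \<Sum>i\<in>F. (cmod (coord v i))\<^sup>2) \<longlongrightarrow> (norm v)\<^sup>2) finsub"
    using has_sum_infsum[OF summable_coord[of v UNIV]]
    unfolding has_sum_def norm_ell2_square .
  have "((\<lambda>F. (norm v)\<^sup>2 - (\<Sum>i\<in>F. (cmod (coord v i))\<^sup>2)) \<longlongrightarrow> 0) finsub"
    using tendsto_diff[OF tendsto_const lim, of "(norm v)\<^sup>2"] by simp
  moreover have "\<forall>\<^sub>F F in finsub. (norm v)\<^sup>2 - (\<Sum>i\<in>F. (cmod (coord v i))\<^sup>2) = (norm (cut F v - v))\<^sup>2"
  proof (rule eventually_finsubI)
    fix F :: "'a set" assume F: "finite F"
    have c: "cinner v (cut F v) = cinner (cut F v) (cut F v)"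
      using F by (metis cinner_cut cut_supported supported_cut)
    then have "cinner (cut F v) v = cinner (cut F v) (cut F v)"
      using F by (simp add: cinner_cut)
    then have "cinner (cut F v - v) (cut F v - v) = cinner v v - cinner (cut F v) (cut F v)"
      by (simp add: c)
    then have "complex_of_real ((norm (cut F v - v))\<^sup>2) = of_real ((norm v)\<^sup>2 - (norm (cut F v))\<^sup>2)"
      by (simp only: cinner_self of_real_diff)
    then have "(norm (cut F v - v))\<^sup>2 = (norm v)\<^sup>2 - (norm (cut F v))\<^sup>2"
      using of_real_eq_iff by blast
    moreover have "(norm (cut F v))\<^sup>2 = (\<Sum>i\<in>F. (cmod (coord v i))\<^sup>2)"
      unfolding norm_finite[OF F supported_cut[OF F]] by (auto simp: coord_cut F)
    ultimately show "(norm v)\<^sup>2 - (\<Sum>i\<in>F. (cmod (coord v i))\<^sup>2) = (norm (cut F v - v))\<^sup>2" by simp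
  qed
  ultimately have "((\<lambda>F. (norm (cut F v - v))\<^sup>2) \<longlongrightarrow> 0) finsub"
    by (rule Lim_transform_eventually)
  then have "((\<lambda>F. sqrt ((norm (cut F v - v))\<^sup>2)) \<longlongrightarrow> sqrt 0) finsub"
    by (rule tendsto_real_sqrt)
  then show ?thesis by (simp add: LIM_zero_iff tendsto_norm_zero_iff)
qed

section \<open>Orthonormal systems and the Bessel inequality\<close>

definition ons :: "'k set \<Rightarrow> ('k \<Rightarrow> 'i ell2) \<Rightarrow> bool" where
  "ons K u \<longleftrightarrow> (\<forall>k\<in>K. \<forall>l\<in>K. cinner (u k) (u l) = (if k = l then 1 else 0))"

lemma onsD: "ons K u \<Longrightarrow> k \<in> K \<Longrightarrow> l \<in> K \<Longrightarrow> cinner (u k) (u l) = (if k = l then 1 else 0)"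
  by (simp add: ons_def)

lemma norm_eq_1_iff: "norm v = 1 \<longleftrightarrow> cinner v v = 1"
proof
  assume "cinner v v = 1"
  then have "(norm v)\<^sup>2 = 1" by (metis cinner_self of_real_eq_1_iff)
  then show "norm v = 1" by (simp add: power2_eq_iff_nonneg[of _ 1, simplified])
qed (simp add: cinner_self)

lemma ons_norm: "ons K u \<Longrightarrow> k \<in> K \<Longrightarrow> norm (u k) = 1"
  by (simp add: norm_eq_1_iff onsD)

lemma ons_ket: "ons K ket"
  by (auto simp: ons_def)

lemma ons_reindex: "ons (f ` K) u \<Longrightarrow> inj_on f K \<Longrightarrow> ons K (\<lambda>k. u (f k))"
  by (auto simp: ons_def inj_on_def)

lemma cinner_ons_sum:
  assumes "ons K u" "finite K" "k \<in> K"
  shows "cinner (u k) (\<Sum>l\<in>K. cscale (c l) (u l)) = c k"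
proof -
  have "cinner (u k) (\<Sum>l\<in>K. cscale (c l) (u l)) = (\<Sum>l\<in>K. if k = l then c l else 0)"
    unfolding cinner_sum_right using assms by (intro sum.cong) (auto simp: onsD)
  then show ?thesis using assms by simp
qed

lemma pythagoras:
  assumes "ons K u" "finite K"
  shows "(norm (\<Sum>k\<in>K. cscale (c k) (u k)))\<^sup>2 = (\<Sum>k\<in>K. (cmod (c k))\<^sup>2)"
proof -
  let ?s = "\<Sum>k\<in>K. cscale (c k) (u k)"
  have "cinner ?s ?s = (\<Sum>k\<in>K. cnj (c k) * c k)"
    by (subst cinner_sum_left) (auto intro!: sum.cong simp: cinner_ons_sum assms)
  also have "\<dots> = of_real (\<Sum>k\<in>K. (cmod (c k))\<^sup>2)"
    by (simp add: complex_norm_square mult.commute del: of_real_power)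
  finally show ?thesis using cinner_self of_real_eq_iff by metis
qed

text \<open>The exact residual is kept because \<open>diag_calc\<close> acts on it as the scalar
  \<open>f 0\<close>, so its norm enters \<open>norm_diag_calc_le\<close>.\<close>

lemma bessel_residual:
  assumes "ons K u" "finite K"
  shows "(norm (v - (\<Sum>k\<in>K. cscale (cinner (u k) v) (u k))))\<^sup>2
    = (norm v)\<^sup>2 - (\<Sum>k\<in>K. (cmod (cinner (u k) v))\<^sup>2)"
proof -
  let ?s = "\<Sum>k\<in>K. cscale (cinner (u k) v) (u k)"
  have n: "cinner ?s ?s = of_real (\<Sum>k\<in>K. (cmod (cinner (u k) v))\<^sup>2)"
    by (simp only: cinner_self pythagoras[OF assms])
  have a: "cinner ?s v = of_real (\<Sum>k\<in>K. (cmod (cinner (u k) v))\<^sup>2)"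
    by (simp add: cinner_sum_left complex_norm_square mult.commute del: of_real_power)
  have b: "cinner v ?s = of_real (\<Sum>k\<in>K. (cmod (cinner (u k) v))\<^sup>2)"
    using cnj_cinner[of ?s v] unfolding a by simp
  have "cinner (v - ?s) (v - ?s) = of_real ((norm v)\<^sup>2 - (\<Sum>k\<in>K. (cmod (cinner (u k) v))\<^sup>2))"
    by (simp only: cinner_diff_left cinner_diff_right n a b) (simp add: cinner_self)
  then show ?thesis unfolding cinner_self using of_real_eq_iff by blast
qed

lemma bessel:
  assumes "ons K u" "finite K"
  shows "(\<Sum>k\<in>K. (cmod (cinner (u k) v))\<^sup>2) \<le> (norm v)\<^sup>2"
  using bessel_residual[OF assms, of v] zero_le_power2[of "norm (v - (\<Sum>k\<in>K. cscale (cinner (u k) v) (u k)))"]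
  by linarith

lemma bessel':
  assumes "ons K u" "finite K"
  shows "(\<Sum>k\<in>K. (cmod (cinner v (u k)))\<^sup>2) \<le> (norm v)\<^sup>2"
proof -
  have "cmod (cinner v (u k)) = cmod (cinner (u k) v)" for k
    by (metis cnj_cinner complex_mod_cnj)
  then show ?thesis using bessel[OF assms, of v] by simp
qed

lemma sum_mult_le_sqrt:
  fixes f g :: "'k \<Rightarrow> real"
  assumes "(\<Sum>k\<in>K. (f k)\<^sup>2) \<le> a\<^sup>2" "(\<Sum>k\<in>K. (g k)\<^sup>2) \<le> b\<^sup>2" "0 \<le> a" "0 \<le> b"
  shows "(\<Sum>k\<in>K. f k * g k) \<le> a * b"
proof -
  have "(\<Sum>k\<in>K. f k * g k)\<^sup>2 \<le> (\<Sum>k\<in>K. (f k)\<^sup>2) * (\<Sum>k\<in>K. (g k)\<^sup>2)"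
    by (rule Cauchy_Schwarz_ineq_sum)
  also have "\<dots> \<le> a\<^sup>2 * b\<^sup>2" by (intro mult_mono assms) (auto intro: sum_nonneg)
  finally have "(\<Sum>k\<in>K. f k * g k)\<^sup>2 \<le> (a * b)\<^sup>2" by (simp add: power_mult_distrib)
  then show ?thesis using assms(3,4) by (simp add: power2_le_iff_abs_le)
qed

text \<open>For unit vectors this bounds the column sums of a matrix of products of coefficients,
  one half of the double substochasticity in \<open>sing_sum_diag_op_le\<close>.\<close>

lemma bessel_pair:
  assumes "ons K u" "ons K v" "finite K"
  shows "(\<Sum>k\<in>K. cmod (cinner (u k) f) * cmod (cinner g (v k))) \<le> norm f * norm g"
  by (rule sum_mult_le_sqrt) (use bessel bessel' assms in auto)

section \<open>Operators and finite singular value decompositions\<close>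

lemma bounded_opsD: "x \<in> bounded_ops \<Longrightarrow> blinfun_apply x (cscale c v) = cscale c (blinfun_apply x v)"
  by (simp add: bounded_ops_def)

lemma bounded_opsI: "(\<And>c v. blinfun_apply x (cscale c v) = cscale c (blinfun_apply x v)) \<Longrightarrow> x \<in> bounded_ops"
  by (simp add: bounded_ops_def)

lemma bounded_bilinear_cinner: "bounded_bilinear cinner"
proof
  show "\<exists>K. \<forall>a b. norm (cinner a b) \<le> norm a * norm b * K"
    by (rule exI[of _ 1]) (simp add: cmod_cinner_le)
qed (simp_all add: scaleR_conv_of_real)

lemmas tendsto_cinner = bounded_bilinear.tendsto[OF bounded_bilinear_cinner]

lemma tendsto_blinfun_apply: "(f \<longlongrightarrow> l) F \<Longrightarrow> ((\<lambda>n. blinfun_apply x (f n)) \<longlongrightarrow> blinfun_apply x l) F"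
  by (rule bounded_linear.tendsto[OF blinfun.bounded_linear_right])

lemma finite_form:
  assumes "x \<in> bounded_ops" "finite F"
  shows "cinner (cut F u) (blinfun_apply x (cut F v))
    = (\<Sum>i\<in>F. \<Sum>j\<in>F. cnj (coord u i) * entry x i j * coord v j)"
proof -
  have "coord (blinfun_apply x (cut F v)) i = (\<Sum>j\<in>F. entry x i j * coord v j)" for i
    unfolding cut_def by (simp add: blinfun.sum_right bounded_opsD[OF assms(1)] entry_def mult.commute)
  then have "cinner (cut F u) (blinfun_apply x (cut F v)) =
      (\<Sum>i\<in>F. cnj (coord u i) * (\<Sum>j\<in>F. entry x i j * coord v j))"
    by (simp add: cinner_finite[OF assms(2) supported_cut[OF assms(2)]] coord_cut assms(2))
  then show ?thesis by (simp add: sum_distrib_left mult.assoc)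
qed

text \<open>The bridge from matrices to operators: entries determine the operator, and estimates for
  finite forms pass to the limit.\<close>

lemma tendsto_finite_form:
  assumes "x \<in> bounded_ops"
  shows "((\<lambda>F. \<Sum>i\<in>F. \<Sum>j\<in>F. cnj (coord u i) * entry x i j * coord v j)
    \<longlongrightarrow> cinner u (blinfun_apply x v)) finsub"
proof (rule Lim_transform_eventually)
  show "((\<lambda>F. cinner (cut F u) (blinfun_apply x (cut F v))) \<longlongrightarrow> cinner u (blinfun_apply x v)) finsub"
    by (intro tendsto_cinner tendsto_blinfun_apply tendsto_cut)
  show "\<forall>\<^sub>F F in finsub. cinner (cut F u) (blinfun_apply x (cut F v))
      = (\<Sum>i\<in>F. \<Sum>j\<in>F. cnj (coord u i) * entry x i j * coord v j)"
    by (rule eventually_finsubI) (simp add: finite_form assms)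
qed

lemma finsub_neq_bot [simp]: "finsub \<noteq> bot"
  by simp

lemma bounded_ops_eqI:
  assumes "x \<in> bounded_ops" "y \<in> bounded_ops" "\<And>i j. entry x i j = entry y i j"
  shows "x = y"
proof (rule blinfun_eqI, rule cinner_ext)
  fix u v
  show "cinner u (blinfun_apply x v) = cinner u (blinfun_apply y v)"
    using tendsto_finite_form[OF assms(1), of u v] tendsto_finite_form[OF assms(2), of u v]
    unfolding assms(3) by (rule tendsto_unique[OF finsub_neq_bot])
qed

lemma finite_ops_iff:
  "x \<in> finite_ops \<longleftrightarrow> x \<in> bounded_ops \<and> (\<exists>F. finite F \<and> (\<forall>i j. entry x i j \<noteq> 0 \<longrightarrow> i \<in> F \<and> j \<in> F))"
proof safe
  assume x: "x \<in> finite_ops"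
  let ?S = "{(i, j). entry x i j \<noteq> 0}"
  have "finite (fst ` ?S \<union> snd ` ?S)" using x by (simp add: finite_ops_def)
  moreover have "\<forall>i j. entry x i j \<noteq> 0 \<longrightarrow> i \<in> fst ` ?S \<union> snd ` ?S \<and> j \<in> fst ` ?S \<union> snd ` ?S"
    by (auto simp: image_iff)
  ultimately show "\<exists>F. finite F \<and> (\<forall>i j. entry x i j \<noteq> 0 \<longrightarrow> i \<in> F \<and> j \<in> F)" by blast
next
  fix F assume "x \<in> bounded_ops" "finite F" and F: "\<forall>i j. entry x i j \<noteq> 0 \<longrightarrow> i \<in> F \<and> j \<in> F"
  then have "{(i, j). entry x i j \<noteq> 0} \<subseteq> F \<times> F" by auto
  then have "finite {(i, j). entry x i j \<noteq> 0}" by (rule finite_subset) (use \<open>finite F\<close> in simp)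
  with \<open>x \<in> bounded_ops\<close> show "x \<in> finite_ops" by (simp add: finite_ops_def)
qed (simp add: finite_ops_def)

text \<open>Testing the form on conjugated rows puts each row into the Hilbert space, so that the
  coordinates of the image can be defined as inner products with the rows; testing it on the image
  itself bounds the norm by \<open>C\<close>. Adjoints and Schur products are both produced in this
  way.\<close>

lemma op_of_matrix:
  fixes e :: "'i \<Rightarrow> 'i \<Rightarrow> complex"
  assumes B: "\<And>F u v. finite F \<Longrightarrow>
      cmod (\<Sum>i\<in>F. \<Sum>j\<in>F. cnj (coord u i) * e i j * coord v j) \<le> C * norm u * norm v"
    and "0 \<le> C"
  obtains y where "y \<in> bounded_ops" "\<And>i j. entry y i j = e i j" "norm y \<le> C"
proof -
  have row: "(\<Sum>j\<in>F. (cmod (e i j))\<^sup>2) \<le> C\<^sup>2" if F: "finite F" for F i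
  proof -
    \<comment> \<open>The conjugate of row \<open>i\<close>, cut to \<open>F\<close>: the form at
      \<open>ket i\<close> and \<open>v\<close> is then exactly the square of
      \<open>norm v\<close>.\<close>
    define v where "v = (\<Sum>j\<in>F. cscale (cnj (e i j)) (ket j))"
    define G where "G = insert i F"
    have G: "finite G" "F \<subseteq> G" "i \<in> G" using F by (auto simp: G_def)
    have cv: "coord v j = (if j \<in> F then cnj (e i j) else 0)" for j
    proof -
      have "coord v j = (\<Sum>k\<in>F. if j = k then cnj (e i k) else 0)"
        unfolding v_def coord_sum by (rule sum.cong) auto
      then show ?thesis using F by simp
    qed
    have "(norm v)\<^sup>2 = (\<Sum>j\<in>F. (cmod (e i j))\<^sup>2)"
      using norm_finite[OF F, of v] by (simp add: supported_def cv)
    moreover have "(\<Sum>i'\<in>G. \<Sum>j\<in>G. cnj (coord (ket i) i') * e i' j * coord v j)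
        = of_real (\<Sum>j\<in>F. (cmod (e i j))\<^sup>2)"
    proof -
      have "(\<Sum>i'\<in>G. \<Sum>j\<in>G. cnj (coord (ket i) i') * e i' j * coord v j)
          = (\<Sum>i'\<in>G. if i' = i then \<Sum>j\<in>G. e i j * coord v j else 0)"
        by (rule sum.cong) auto
      also have "\<dots> = (\<Sum>j\<in>G. e i j * coord v j)" using G by simp
      also have "\<dots> = (\<Sum>j\<in>F. e i j * coord v j)"
        using G by (intro sum.mono_neutral_right) (auto simp: cv)
      also have "\<dots> = of_real (\<Sum>j\<in>F. (cmod (e i j))\<^sup>2)"
        by (simp add: cv complex_norm_square del: of_real_power)
      finally show ?thesis .
    qed
    ultimately have "(norm v)\<^sup>2 \<le> C * norm v"
      using B[OF G(1), of "ket i" v] by (simp add: abs_of_nonneg sum_nonneg del: of_real_sum)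
    then have "norm v \<le> C" using \<open>0 \<le> C\<close>
      by (cases "v = 0") (auto simp: power2_eq_square)
    then show ?thesis using \<open>(norm v)\<^sup>2 = _\<close> by (metis norm_ge_zero power_mono)
  qed
  have "\<exists>r. coord r = (\<lambda>j. cnj (e i j))" for i
    by (rule ell2_of_bounded[of "\<lambda>j. cnj (e i j)" "C\<^sup>2"]) (use row in auto)
  then obtain r where r: "\<And>i. coord (r i) = (\<lambda>j. cnj (e i j))" by metis
  have col: "(\<Sum>i\<in>G. (cmod (cinner (r i) v))\<^sup>2) \<le> (C * norm v)\<^sup>2" if G: "finite G" for G v
  proof (rule tendsto_upperbound)
    show "((\<lambda>F. \<Sum>i\<in>G. (cmod (cinner (r i) (cut F v)))\<^sup>2) \<longlongrightarrow> (\<Sum>i\<in>G. (cmod (cinner (r i) v))\<^sup>2)) finsub"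
      by (intro tendsto_intros tendsto_cinner_right tendsto_cut)
    show "\<forall>\<^sub>F F in finsub. (\<Sum>i\<in>G. (cmod (cinner (r i) (cut F v)))\<^sup>2) \<le> (C * norm v)\<^sup>2"
      using eventually_finsub[OF G]
    proof (rule eventually_mono)
      fix F assume "finite F \<and> G \<subseteq> F"
      then have F: "finite F" "G \<subseteq> F" by auto
      define c where "c i = (\<Sum>j\<in>F. e i j * coord v j)" for i
      have ci: "cinner (r i) (cut F v) = c i" for i
      proof -
        have "cinner (cut F v) (r i) = (\<Sum>j\<in>F. cnj (coord v j) * cnj (e i j))"
          using F by (simp add: cinner_finite[OF F(1) supported_cut] r coord_cut)
        then have "cnj (cinner (cut F v) (r i)) = c i" by (simp add: c_def mult.commute)
        then show ?thesis by (simp add: cnj_cinner)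
      qed
      \<comment> \<open>The image of \<open>cut F v\<close>, restricted to \<open>G\<close>: the
        form at \<open>w\<close> and \<open>v\<close> is then exactly the square of
        \<open>norm w\<close>.\<close>
      define w where "w = (\<Sum>i\<in>G. cscale (c i) (ket i))"
      have cw: "coord w j = (if j \<in> G then c j else 0)" for j
      proof -
        have "coord w j = (\<Sum>k\<in>G. if j = k then c k else 0)"
          unfolding w_def coord_sum by (rule sum.cong) auto
        then show ?thesis using G by simp
      qed
      have nw: "(norm w)\<^sup>2 = (\<Sum>i\<in>G. (cmod (c i))\<^sup>2)"
        using norm_finite[OF G, of w] by (simp add: supported_def cw)
      have "(\<Sum>i\<in>F. \<Sum>j\<in>F. cnj (coord w i) * e i j * coord v j) = (\<Sum>i\<in>F. cnj (coord w i) * c i)"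
        by (simp add: c_def sum_distrib_left mult.assoc)
      also have "\<dots> = (\<Sum>i\<in>G. cnj (coord w i) * c i)"
        using F by (intro sum.mono_neutral_right) (auto simp: cw)
      also have "\<dots> = of_real ((norm w)\<^sup>2)"
        unfolding nw by (simp add: cw complex_norm_square mult.commute del: of_real_power)
      finally have "(norm w)\<^sup>2 \<le> C * norm w * norm v"
        using B[OF F(1), of w v] by (simp add: norm_power)
      then have "norm w \<le> C * norm v" using \<open>0 \<le> C\<close>
        by (cases "w = 0") (auto simp: power2_eq_square mult_ac)
      then have "(norm w)\<^sup>2 \<le> (C * norm v)\<^sup>2" by (intro power_mono) auto
      then show "(\<Sum>i\<in>G. (cmod (cinner (r i) (cut F v)))\<^sup>2) \<le> (C * norm v)\<^sup>2"
        by (simp add: ci nw)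
    qed
  qed simp
  have "\<exists>w. coord w = (\<lambda>i. cinner (r i) v)" for v
    using ell2_of_bounded[of "\<lambda>i. cinner (r i) v", OF col] by metis
  then obtain f where f: "\<And>v. coord (f v) = (\<lambda>i. cinner (r i) v)" by metis
  have nf: "norm (f v) \<le> C * norm v" for v
    by (rule norm_ell2_leI) (use col \<open>0 \<le> C\<close> in \<open>auto simp: f\<close>)
  have bl: "bounded_linear f"
    by (rule bounded_linear_intro[of _ C]) (auto intro!: ell2_eqI simp: f nf mult.commute[of _ C])
  define y where "y = Blinfun f"
  have ya: "blinfun_apply y v = f v" for v by (simp add: y_def bounded_linear_Blinfun_apply bl)
  show thesis
  proof (rule that[of y])
    show "y \<in> bounded_ops" by (rule bounded_opsI) (auto intro!: ell2_eqI simp: ya f)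
    show "entry y i j = e i j" for i j by (simp add: entry_def ya f r)
    show "norm y \<le> C" by (rule norm_blinfun_bound) (use nf \<open>0 \<le> C\<close> in \<open>auto simp: ya\<close>)
  qed
qed

lemma entry_add [simp]: "entry (x + y) i j = entry x i j + entry y i j"
  by (simp add: entry_def blinfun.add_left)

lemma entry_diff [simp]: "entry (x - y) i j = entry x i j - entry y i j"
  by (simp add: entry_def blinfun.diff_left)

lemma entry_0 [simp]: "entry 0 i j = 0"
  by (simp add: entry_def)

lemma entry_sum [simp]: "entry (\<Sum>k\<in>K. f k) i j = (\<Sum>k\<in>K. entry (f k) i j)"
  by (induction K rule: infinite_finite_induct) auto

lemma op_scale_apply [simp]: "blinfun_apply (op_scale c x) v = cscale c (blinfun_apply x v)"
  by (simp add: op_scale_def bounded_linear_Blinfun_apply bounded_linear_cscale)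

lemma entry_op_scale [simp]: "entry (op_scale c x) i j = c * entry x i j"
  by (simp add: entry_def)

lemma bounded_ops_0: "0 \<in> bounded_ops"
  and bounded_ops_id: "id_blinfun \<in> bounded_ops"
  and bounded_ops_add: "x \<in> bounded_ops \<Longrightarrow> y \<in> bounded_ops \<Longrightarrow> x + y \<in> bounded_ops"
  and bounded_ops_scaleR: "x \<in> bounded_ops \<Longrightarrow> r *\<^sub>R x \<in> bounded_ops"
  and bounded_ops_compose: "x \<in> bounded_ops \<Longrightarrow> y \<in> bounded_ops \<Longrightarrow> x o\<^sub>L y \<in> bounded_ops"
  and bounded_ops_op_scale: "x \<in> bounded_ops \<Longrightarrow> op_scale c x \<in> bounded_ops"
  by (auto simp: bounded_ops_def blinfun.add_left blinfun.diff_left blinfun.scaleR_left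
      cscale_add cscale_diff cscale_scaleR mult.commute)

lemma bounded_ops_sum: "(\<And>k. k \<in> K \<Longrightarrow> f k \<in> bounded_ops) \<Longrightarrow> (\<Sum>k\<in>K. f k) \<in> bounded_ops"
  by (induction K rule: infinite_finite_induct) (auto intro: bounded_ops_0 bounded_ops_add)

lemma bounded_ops_lim: 
  assumes "X \<longlonglongrightarrow> x" "\<And>n. X n \<in> bounded_ops"
  shows "x \<in> bounded_ops"
proof (rule bounded_opsI)
  fix c v
  have "(\<lambda>n. blinfun_apply (X n) (cscale c v)) \<longlonglongrightarrow> blinfun_apply x (cscale c v)"
    by (intro blinfun.tendsto assms tendsto_const)
  moreover have "(\<lambda>n. blinfun_apply (X n) (cscale c v)) \<longlonglongrightarrow> cscale c (blinfun_apply x v)"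
    unfolding bounded_opsD[OF assms(2)] by (intro tendsto_cscale blinfun.tendsto assms tendsto_const)
  ultimately show "blinfun_apply x (cscale c v) = cscale c (blinfun_apply x v)"
    by (rule LIMSEQ_unique)
qed

section \<open>Adjoints\<close>

lemma op_adj_eqI:
  assumes "\<And>v w. cinner (blinfun_apply x v) w = cinner v (blinfun_apply y w)"
  shows "op_adj x = y"
  unfolding op_adj_def
proof (rule the_equality)
  fix z assume "\<forall>v w. cinner (blinfun_apply x v) w = cinner v (blinfun_apply z w)"
  with assms have "cinner v (blinfun_apply z w) = cinner v (blinfun_apply y w)" for v w by metis
  then show "z = y" by (intro blinfun_eqI cinner_ext)
qed (use assms in blast)

text \<open>The conjugate transpose satisfies the same form bound as \<open>x\<close>, so
  \<open>op_of_matrix\<close> turns it into an operator; the adjoint relation holds on cut vectors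
  and passes to the limit.\<close>

lemma
  assumes x: "x \<in> bounded_ops"
  shows op_adj_bounded_ops: "op_adj x \<in> bounded_ops"
    and cinner_op_adj: "cinner (blinfun_apply x v) w = cinner v (blinfun_apply (op_adj x) w)"
    and norm_op_adj_le: "norm (op_adj x) \<le> norm x"
proof -
  have form: "(\<Sum>i\<in>F. \<Sum>j\<in>F. cnj (coord u i) * cnj (entry x j i) * coord v j)
      = cinner (blinfun_apply x (cut F u)) (cut F v)" if "finite F" for F u v
  proof -
    have "(\<Sum>i\<in>F. \<Sum>j\<in>F. cnj (coord u i) * cnj (entry x j i) * coord v j)
        = cnj (\<Sum>j\<in>F. \<Sum>i\<in>F. cnj (coord v j) * entry x j i * coord u i)"
      by (subst sum.swap) (simp add: mult_ac)
    also have "\<dots> = cinner (blinfun_apply x (cut F u)) (cut F v)"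
      by (simp only: finite_form[OF x that, symmetric] cnj_cinner)
    finally show ?thesis .
  qed
  obtain y where y: "y \<in> bounded_ops" "\<And>i j. entry y i j = cnj (entry x j i)" "norm y \<le> norm x"
  proof (rule op_of_matrix)
    fix F :: "'a set" and u v :: "'a ell2"
    assume F: "finite F"
    have "cmod (cinner (blinfun_apply x (cut F u)) (cut F v)) \<le> norm (blinfun_apply x (cut F u)) * norm (cut F v)"
      by (rule cmod_cinner_le)
    also have "\<dots> \<le> (norm x * norm (cut F u)) * norm (cut F v)"
      by (intro mult_right_mono norm_blinfun norm_ge_zero)
    also have "\<dots> \<le> (norm x * norm u) * norm v"
      using F by (intro mult_mono mult_left_mono norm_cut_le) auto
    finally show "cmod (\<Sum>i\<in>F. \<Sum>j\<in>F. cnj (coord u i) * cnj (entry x j i) * coord v j)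
        \<le> norm x * norm u * norm v"
      by (simp add: form F)
  qed auto
  have adj: "cinner (blinfun_apply x v) w = cinner v (blinfun_apply y w)" for v w
  proof (rule tendsto_unique[OF finsub_neq_bot])
    show "((\<lambda>F. cinner (blinfun_apply x (cut F v)) (cut F w)) \<longlongrightarrow> cinner (blinfun_apply x v) w) finsub"
      by (intro tendsto_cinner tendsto_blinfun_apply tendsto_cut)
    show "((\<lambda>F. cinner (blinfun_apply x (cut F v)) (cut F w)) \<longlongrightarrow> cinner v (blinfun_apply y w)) finsub"
      using tendsto_finite_form[OF y(1), of v w] unfolding y(2)
      by (rule Lim_transform_eventually)
        (rule eventually_finsubI, simp add: form)
  qed
  then have e: "op_adj x = y" by (rule op_adj_eqI)
  show "op_adj x \<in> bounded_ops" "norm (op_adj x) \<le> norm x"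
    "cinner (blinfun_apply x v) w = cinner v (blinfun_apply (op_adj x) w)"
    using y adj by (auto simp: e)
qed

text \<open>In bra-ket notation this is the sum of \<open>s k |u k><v k|\<close>, a singular value
  decomposition when both systems are orthonormal. Complex \<open>s\<close> leaves room for
  phases.\<close>

definition diag_op :: "'k set \<Rightarrow> ('k \<Rightarrow> complex) \<Rightarrow> ('k \<Rightarrow> 'i ell2) \<Rightarrow> ('k \<Rightarrow> 'i ell2) \<Rightarrow> 'i oper" where
  "diag_op K s u v = Blinfun (\<lambda>w. \<Sum>k\<in>K. cscale (s k * cinner (v k) w) (u k))"

lemma bounded_linear_cscale_left: "bounded_linear (\<lambda>c. cscale c v)"
  by (rule bounded_linear_intro[of _ "norm v"])
    (auto simp: cscale_add_left scaleR_eq_cscale scaleR_conv_of_real)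

lemma diag_op_apply:
  "blinfun_apply (diag_op K s u v) w = (\<Sum>k\<in>K. cscale (s k * cinner (v k) w) (u k))"
proof -
  have "bounded_linear (\<lambda>w. \<Sum>k\<in>K. cscale (s k * cinner (v k) w) (u k))"
    by (intro bounded_linear_sum bounded_linear_compose[OF bounded_linear_cscale_left]
        bounded_linear_const_mult bounded_linear_cinner_right)
  then show ?thesis by (simp add: diag_op_def bounded_linear_Blinfun_apply)
qed

lemma diag_op_bounded_ops: "diag_op K s u v \<in> bounded_ops"
  by (rule bounded_opsI) (simp add: diag_op_apply cscale_sum mult_ac)

lemma cinner_diag_op:
  "cinner f (blinfun_apply (diag_op K s u v) g) = (\<Sum>k\<in>K. s k * cinner f (u k) * cinner (v k) g)"
  by (simp add: diag_op_apply cinner_sum_right mult_ac)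

lemma entry_diag_op: "entry (diag_op K s u v) i j = (\<Sum>k\<in>K. s k * coord (u k) i * cnj (coord (v k) j))"
  by (simp add: entry_def diag_op_apply mult_ac)

lemma diag_op_finite_ops:
  assumes "finite F" "\<And>k. k \<in> K \<Longrightarrow> supported F (u k)" "\<And>k. k \<in> K \<Longrightarrow> supported F (v k)"
  shows "diag_op K s u v \<in> finite_ops"
  unfolding finite_ops_iff
proof (intro conjI exI[of _ F] allI impI)
  fix i j assume "entry (diag_op K s u v) i j \<noteq> 0"
  then obtain k where "k \<in> K" "s k * coord (u k) i * cnj (coord (v k) j) \<noteq> 0"
    unfolding entry_diag_op by (meson sum.neutral)
  with assms show "i \<in> F" "j \<in> F" by (auto simp: supported_def)
qed (use assms diag_op_bounded_ops in auto)

lemma op_adj_diag_op: "op_adj (diag_op K s u v) = diag_op K (\<lambda>k. cnj (s k)) v u"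
proof (rule op_adj_eqI)
  fix f g
  have "cinner (blinfun_apply (diag_op K s u v) f) g = cnj (cinner g (blinfun_apply (diag_op K s u v) f))"
    by (simp add: cnj_cinner)
  then show "cinner (blinfun_apply (diag_op K s u v) f) g
      = cinner f (blinfun_apply (diag_op K (\<lambda>k. cnj (s k)) v u) g)"
    by (simp add: cinner_diag_op cnj_cinner mult_ac)
qed

lemma diag_op_compose:
  assumes "ons K v" "finite K"
  shows "diag_op K s u v o\<^sub>L diag_op K t v w = diag_op K (\<lambda>k. s k * t k) u w"
proof (rule blinfun_eqI)
  fix f
  have "blinfun_apply (diag_op K s u v o\<^sub>L diag_op K t v w) f
      = (\<Sum>k\<in>K. cscale (s k * cinner (v k) (\<Sum>l\<in>K. cscale (t l * cinner (w l) f) (v l))) (u k))"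
    by (simp add: diag_op_apply)
  also have "\<dots> = (\<Sum>k\<in>K. cscale (s k * (t k * cinner (w k) f)) (u k))"
    by (intro sum.cong refl) (simp add: cinner_ons_sum[OF assms])
  finally show "blinfun_apply (diag_op K s u v o\<^sub>L diag_op K t v w) f
      = blinfun_apply (diag_op K (\<lambda>k. s k * t k) u w) f"
    by (simp add: diag_op_apply mult.assoc)
qed

text \<open>The compression of \<open>x\<close> to the coordinates in \<open>F\<close>. It still
  acts on the whole space, so norms and strong limits are compared within one type.\<close>

definition trunc :: "'i set \<Rightarrow> 'i oper \<Rightarrow> 'i oper" where
  "trunc F x = diag_op F (\<lambda>_. 1) ket ket o\<^sub>L x o\<^sub>L diag_op F (\<lambda>_. 1) ket ket"

lemma trunc_apply: "blinfun_apply (trunc F x) v = cut F (blinfun_apply x (cut F v))"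
  by (simp add: trunc_def diag_op_apply cut_def)

lemma trunc_bounded_ops: "x \<in> bounded_ops \<Longrightarrow> trunc F x \<in> bounded_ops"
  unfolding trunc_def by (intro bounded_ops_compose diag_op_bounded_ops)

lemma norm_trunc_le:
  assumes "finite F"
  shows "norm (trunc F x) \<le> norm x"
proof (rule norm_blinfun_bound)
  fix v
  have "norm (blinfun_apply (trunc F x) v) \<le> norm (blinfun_apply x (cut F v))"
    unfolding trunc_apply by (rule norm_cut_le[OF assms])
  also have "\<dots> \<le> norm x * norm (cut F v)" by (rule norm_blinfun)
  also have "\<dots> \<le> norm x * norm v" by (intro mult_left_mono norm_cut_le assms) auto
  finally show "norm (blinfun_apply (trunc F x) v) \<le> norm x * norm v" .
qed auto

lemma entry_trunc: "finite F \<Longrightarrow> entry (trunc F x) i j = (if i \<in> F \<and> j \<in> F then entry x i j else 0)"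
proof -
  assume F: "finite F"
  have "cut F (ket j) = (if j \<in> F then ket j else 0)"
    by (rule ell2_eqI) (auto simp: coord_cut F)
  then show ?thesis by (simp add: entry_def trunc_apply coord_cut F)
qed

lemma trunc_eq:
  assumes "finite F" "x \<in> bounded_ops" "\<And>i j. entry x i j \<noteq> 0 \<Longrightarrow> i \<in> F \<and> j \<in> F"
  shows "trunc F x = x"
  by (rule bounded_ops_eqI) (use assms in \<open>auto simp: entry_trunc trunc_bounded_ops\<close>)

lemma tendsto_trunc: "((\<lambda>F. blinfun_apply (trunc F x) v) \<longlongrightarrow> blinfun_apply x v) finsub"
proof -
  have "((\<lambda>F. cut F (blinfun_apply x (cut F v) - blinfun_apply x v)) \<longlongrightarrow> 0) finsub"
  proof (rule Lim_null_comparison)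
    show "\<forall>\<^sub>F F in finsub. norm (cut F (blinfun_apply x (cut F v) - blinfun_apply x v))
        \<le> norm (blinfun_apply x (cut F v) - blinfun_apply x v)"
      by (rule eventually_finsubI) (simp add: norm_cut_le)
    show "((\<lambda>F. norm (blinfun_apply x (cut F v) - blinfun_apply x v)) \<longlongrightarrow> 0) finsub"
      by (intro tendsto_norm_zero LIM_zero tendsto_blinfun_apply tendsto_cut)
  qed
  from tendsto_add[OF this tendsto_cut[of "blinfun_apply x v"]]
  have "((\<lambda>F. cut F (blinfun_apply x (cut F v) - blinfun_apply x v) + cut F (blinfun_apply x v))
      \<longlongrightarrow> blinfun_apply x v) finsub" by simp
  moreover have "\<forall>\<^sub>F F in finsub. cut F (blinfun_apply x (cut F v) - blinfun_apply x v)
      + cut F (blinfun_apply x v) = blinfun_apply (trunc F x) v"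
    by (rule eventually_finsubI) (auto intro!: ell2_eqI simp: trunc_apply coord_cut)
  ultimately show ?thesis by (rule Lim_transform_eventually)
qed

text \<open>Adding a coordinate makes the box a continuous image of a disc times the smaller box;
  bounding coordinates instead of norms gives this product shape. Compactness is used twice: for the
  maximum in \<open>svd_trunc\<close> and for \<open>finite_ops_compact\<close>.\<close>

lemma compact_finite_box:
  assumes "finite F"
  shows "compact {v. supported F v \<and> (\<forall>i. cmod (coord v i) \<le> r)}"
  using assms
proof (induction F)
  case empty
  have "{v :: 'a ell2. supported {} v \<and> (\<forall>i. cmod (coord v i) \<le> r)} \<subseteq> {0}"
    by (auto simp: supported_def intro: ell2_eqI)
  then show ?case by (meson finite.emptyI finite_imp_compact finite_insert finite_subset)
next
  case (insert i F)
  let ?B = "\<lambda>F. {v. supported F v \<and> (\<forall>i. cmod (coord v i) \<le> r)}"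
  show ?case
  proof (cases "0 \<le> r")
    case True
    have cont: "continuous_on (cball 0 r \<times> ?B F) (\<lambda>(c, w). cscale c (ket i) + w)"
      unfolding case_prod_unfold
      by (intro continuous_intros bounded_linear.continuous_on[OF bounded_linear_cscale_left])
    have eq: "?B (insert i F) = (\<lambda>(c, w). cscale c (ket i) + w) ` (cball 0 r \<times> ?B F)"
    proof (intro equalityI subsetI)
      fix v assume v: "v \<in> ?B (insert i F)"
      have "v = cscale (coord v i) (ket i) + (v - cscale (coord v i) (ket i))" by simp
      moreover have "v - cscale (coord v i) (ket i) \<in> ?B F"
        using v \<open>0 \<le> r\<close> by (auto simp: supported_def)
      moreover have "coord v i \<in> cball 0 r" using v by simp
      ultimately show "v \<in> (\<lambda>(c, w). cscale c (ket i) + w) ` (cball 0 r \<times> ?B F)"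
        by (intro image_eqI[of _ _ "(coord v i, v - cscale (coord v i) (ket i))"]) auto
    next
      fix v assume "v \<in> (\<lambda>(c, w). cscale c (ket i) + w) ` (cball 0 r \<times> ?B F)"
      then obtain c w where "v = cscale c (ket i) + w" "cmod c \<le> r" "w \<in> ?B F" by auto
      then show "v \<in> ?B (insert i F)" using insert.hyps by (auto simp: supported_def)
    qed
    show ?thesis unfolding eq
      by (rule compact_continuous_image[OF cont compact_Times[OF compact_cball insert.IH]])
  next
    case False
    then have "\<not> cmod (coord v i) \<le> r" for v
      using norm_ge_zero[of "coord v i"] by linarith
    then have "?B (insert i F) = {}" by blast
    then show ?thesis by (simp only: compact_empty)
  qed
qed

lemma norm_add_cscale_square:
  "(norm (v + cscale c w))\<^sup>2 = (norm v)\<^sup>2 + 2 * Re (c * cinner v w) + (cmod c)\<^sup>2 * (norm w)\<^sup>2"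
proof -
  have "(norm (v + cscale c w))\<^sup>2 = (norm v)\<^sup>2 + 2 * (v \<bullet> cscale c w) + (norm (cscale c w))\<^sup>2"
    unfolding power2_norm_eq_inner by (simp add: inner_add_left inner_add_right inner_commute)
  then show ?thesis by (simp add: Re_cinner[symmetric] power_mult_distrib)
qed

text \<open>First variation at a maximum: moving \<open>v\<close> along an orthogonal
  \<open>w\<close> changes its norm only to second order, but would change the norm of its image to
  first order if the two images were not orthogonal.\<close>

lemma maximal_vector_orthogonal:
  assumes y: "y \<in> bounded_ops"
    and max: "\<And>c. norm (blinfun_apply y (v + cscale c w)) \<le> s * norm (v + cscale c w)"
    and "norm v = 1" "norm (blinfun_apply y v) = s" "cinner v w = 0"
  shows "cinner (blinfun_apply y v) (blinfun_apply y w) = 0"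
proof (rule ccontr)
  define g where "g = cinner (blinfun_apply y v) (blinfun_apply y w)"
  assume "cinner (blinfun_apply y v) (blinfun_apply y w) \<noteq> 0"
  then have g: "cmod g > 0" by (simp add: g_def)
  have s: "s \<ge> 0" using assms(4) by auto
  have key: "2 * e \<le> e\<^sup>2 * (s\<^sup>2 * (norm w)\<^sup>2)" for e :: real
  proof -
    \<comment> \<open>The factor \<open>cnj g\<close> makes the cross term \<open>c * g\<close> real
      and nonnegative for positive \<open>e\<close>.\<close>
    define c where "c = of_real e * cnj g"
    have cg: "c * g = of_real (e * (cmod g)\<^sup>2)"
      unfolding c_def of_real_mult complex_norm_square by (simp add: mult_ac)
    have c: "(cmod c)\<^sup>2 = e\<^sup>2 * (cmod g)\<^sup>2" by (simp add: c_def norm_mult power_mult_distrib)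
    have "(norm (blinfun_apply y (v + cscale c w)))\<^sup>2 \<le> (s * norm (v + cscale c w))\<^sup>2"
      by (intro power_mono max) auto
    also have "(s * norm (v + cscale c w))\<^sup>2 = s\<^sup>2 * (1 + (cmod c)\<^sup>2 * (norm w)\<^sup>2)"
      unfolding power_mult_distrib norm_add_cscale_square using assms(3,5) by simp
    also have "(norm (blinfun_apply y (v + cscale c w)))\<^sup>2
        = s\<^sup>2 + 2 * Re (c * g) + (cmod c)\<^sup>2 * (norm (blinfun_apply y w))\<^sup>2"
      unfolding blinfun.add_right bounded_opsD[OF y] norm_add_cscale_square
      by (simp add: assms(4) g_def)
    finally have "s\<^sup>2 + 2 * Re (c * g) + (cmod c)\<^sup>2 * (norm (blinfun_apply y w))\<^sup>2
        \<le> s\<^sup>2 + s\<^sup>2 * ((cmod c)\<^sup>2 * (norm w)\<^sup>2)"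
      by (simp only: distrib_left mult_1_right)
    moreover have "0 \<le> (cmod c)\<^sup>2 * (norm (blinfun_apply y w))\<^sup>2" by simp
    ultimately have "2 * Re (c * g) \<le> s\<^sup>2 * ((cmod c)\<^sup>2 * (norm w)\<^sup>2)" by linarith
    then have "(cmod g)\<^sup>2 * (2 * e) \<le> (cmod g)\<^sup>2 * (e\<^sup>2 * (s\<^sup>2 * (norm w)\<^sup>2))"
      unfolding cg c Re_complex_of_real by (simp add: mult_ac)
    then show ?thesis using g by simp
  qed
  define q where "q = s\<^sup>2 * (norm w)\<^sup>2"
  have q: "0 \<le> q" by (simp add: q_def)
  \<comment> \<open>Small enough that \<open>e * q\<close> is at most 1, whereas \<open>key\<close>
    would force it to be at least 2.\<close>
  define e where "e = 1 / (q + 1)"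
  have e: "e > 0" "e * q \<le> 1" using q by (auto simp: e_def field_simps)
  have "2 * e \<le> e * (e * q)" using key[of e] by (simp add: q_def power2_eq_square mult.assoc)
  also have "\<dots> \<le> e * 1" using e by (intro mult_left_mono) auto
  finally show False using e by simp
qed

lemma svd_trunc:
  assumes x: "x \<in> bounded_ops" and F: "finite F"
  obtains n :: nat and u v :: "nat \<Rightarrow> 'i ell2" and s :: "nat \<Rightarrow> real" where
    "ons {..<n} u" "ons {..<n} v" "\<And>k. k < n \<Longrightarrow> 0 < s k"
    "\<And>k. k < n \<Longrightarrow> supported F (u k)" "\<And>k. k < n \<Longrightarrow> supported F (v k)"
    "trunc F x = diag_op {..<n} (\<lambda>k. of_real (s k)) u v"
proof -
  define y where "y = trunc F x"
  have y: "y \<in> bounded_ops" unfolding y_def by (rule trunc_bounded_ops[OF x])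
  have ysupp: "supported F (blinfun_apply y w)" for w
    unfolding y_def trunc_apply by (rule supported_cut[OF F])
  \<comment> \<open>A partial decomposition of maximal length exhausts \<open>y\<close>: otherwise a vector maximising \<open>\<parallel>y w\<parallel>\<close>
    on the orthogonal complement \<open>W\<close> of the \<open>v\<^sub>k\<close> would prolong it.\<close>
  define W where "W n v = {w. supported F w \<and> (\<forall>k<n. cinner (v k) w = 0)}"
    for n :: nat and v :: "nat \<Rightarrow> 'i ell2"
  \<comment> \<open>The last clause is the invariant that makes the induction work: images of
    vectors in the remaining space are orthogonal to the earlier \<open>u k\<close>, so the next
    left singular vector is too. It is maintained by
    \<open>maximal_vector_orthogonal\<close>.\<close>
  define P where "P n u v s \<longleftrightarrow> ons {..<n} u \<and> ons {..<n} v \<and>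
      (\<forall>k<n. 0 < s k \<and> supported F (u k) \<and> supported F (v k) \<and>
        blinfun_apply y (v k) = cscale (of_real (s k)) (u k)) \<and>
      (\<forall>w\<in>W n v. \<forall>k<n. cinner (u k) (blinfun_apply y w) = 0)"
    for n :: nat and u v and s :: "nat \<Rightarrow> real"
  \<comment> \<open>A dimension count: expand each norm in the coordinates of \<open>F\<close>,
    exchange the sums and apply Bessel to every \<open>ket i\<close>.\<close>
  have bound: "n \<le> card F" if "P n u v s" for n u v s
  proof -
    have v: "ons {..<n} v" "\<And>k. k < n \<Longrightarrow> supported F (v k)" using that by (auto simp: P_def)
    have "real n = (\<Sum>k<n. (norm (v k))\<^sup>2)" using ons_norm[OF v(1)] by simp
    also have "\<dots> = (\<Sum>k<n. \<Sum>i\<in>F. (cmod (cinner (v k) (ket i)))\<^sup>2)"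
      by (intro sum.cong refl) (use v norm_finite[OF F] in simp)
    also have "\<dots> = (\<Sum>i\<in>F. \<Sum>k<n. (cmod (cinner (v k) (ket i)))\<^sup>2)" by (rule sum.swap)
    also have "\<dots> \<le> (\<Sum>i\<in>F. (norm (ket i))\<^sup>2)" by (intro sum_mono bessel v) auto
    finally show ?thesis by simp
  qed
  have "P 0 undefined undefined undefined" by (simp add: P_def ons_def)
  then have "\<exists>u v s. P 0 u v s" by blast
  then have "\<exists>n. (\<exists>u v s. P n u v s) \<and> (\<forall>m. (\<exists>u v s. P m u v s) \<longrightarrow> m \<le> n)"
    using ex_has_greatest_nat[of "\<lambda>n. \<exists>u v s. P n u v s" 0 "\<lambda>n. n" "Suc (card F)"] bound by (metis le_imp_less_Suc)
  then obtain n u v s where P: "P n u v s" and max: "\<And>m u v s. P m u v s \<Longrightarrow> m \<le> n" by blast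
  have ons: "ons {..<n} u" "ons {..<n} v"
    and s: "\<And>k. k < n \<Longrightarrow> 0 < s k" and su: "\<And>k. k < n \<Longrightarrow> supported F (u k)"
    and sv: "\<And>k. k < n \<Longrightarrow> supported F (v k)"
    and yv: "\<And>k. k < n \<Longrightarrow> blinfun_apply y (v k) = cscale (of_real (s k)) (u k)"
    and orth: "\<And>w k. w \<in> W n v \<Longrightarrow> k < n \<Longrightarrow> cinner (u k) (blinfun_apply y w) = 0"
    using P unfolding P_def by auto
  have zero: "blinfun_apply y w = 0" if w: "w \<in> W n v" for w
  proof (rule ccontr)
    assume yw: "blinfun_apply y w \<noteq> 0"
    then have "w \<noteq> 0" by auto
    define S where "S = W n v \<inter> {w. norm w = 1}"
    have "compact S"
    proof -
      have cl: "closed (W n v \<inter> {w. norm w = 1})"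
      proof -
        have eq: "W n v \<inter> {w. norm w = 1} = (\<Inter>i\<in>-F. {w. cinner (ket i) w = 0})
            \<inter> (\<Inter>k\<in>{..<n}. {w. cinner (v k) w = 0}) \<inter> {w. norm w = 1}"
          by (auto simp: W_def supported_def)
        show ?thesis unfolding eq
          by (intro closed_Int closed_INT ballI closed_Collect_eq continuous_intros
              bounded_linear.continuous_on[OF bounded_linear_cinner_right])
      qed
      have "W n v \<inter> {w. norm w = 1} \<subseteq> {w. supported F w \<and> (\<forall>i. cmod (coord w i) \<le> 1)}"
        unfolding W_def by (auto intro: order_trans[OF norm_coord_le])
      then have "S = {w. supported F w \<and> (\<forall>i. cmod (coord w i) \<le> 1)} \<inter> (W n v \<inter> {w. norm w = 1})"
        unfolding S_def by blast
      then show ?thesis using compact_Int_closed[OF compact_finite_box[OF F, of 1] cl] by simp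
    qed
    moreover have wS: "(1 / norm w) *\<^sub>R w \<in> S"
      using w \<open>w \<noteq> 0\<close> by (auto simp: S_def W_def intro: supported_scaleR)
    moreover have "continuous_on S (\<lambda>w. norm (blinfun_apply y w))"
      by (intro continuous_on_norm bounded_linear.continuous_on[OF blinfun.bounded_linear_right] continuous_on_id)
    ultimately obtain w0 where w0: "w0 \<in> S" "\<And>z. z \<in> S \<Longrightarrow> norm (blinfun_apply y z) \<le> norm (blinfun_apply y w0)"
      using continuous_attains_sup[of S "\<lambda>w. norm (blinfun_apply y w)"] by (metis empty_iff)
    define t where "t = norm (blinfun_apply y w0)"
    have "norm (blinfun_apply y ((1 / norm w) *\<^sub>R w)) > 0"
      using yw \<open>w \<noteq> 0\<close> by (simp add: blinfun.scaleR_right)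
    then have t: "t > 0" using w0(2)[OF wS] unfolding t_def by linarith
    have w0W: "w0 \<in> W n v" and nw0: "norm w0 = 1" using w0(1) by (auto simp: S_def)
    have ub: "norm (blinfun_apply y z) \<le> t * norm z" if z: "z \<in> W n v" for z
    proof (cases "z = 0")
      case False
      then have "(1 / norm z) *\<^sub>R z \<in> S"
        using z by (auto simp: S_def W_def intro: supported_scaleR)
      from w0(2)[OF this] show ?thesis
        using False by (simp add: blinfun.scaleR_right t_def field_simps)
    qed simp
    define u' where "u' = u(n := cscale (of_real (1 / t)) (blinfun_apply y w0))"
    define v' where "v' = v(n := w0)"
    define s' where "s' = s(n := t)"
    have "P (Suc n) u' v' s'"
      unfolding P_def
    proof (intro conjI allI impI ballI)
      have "cinner (u k) (blinfun_apply y w0) = 0" "cinner (blinfun_apply y w0) (u k) = 0" if "k < n" for k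
        using orth[OF w0W that] cnj_cinner[of "u k" "blinfun_apply y w0"] by auto
      moreover have "cinner (blinfun_apply y w0) (blinfun_apply y w0) = (of_real t)\<^sup>2"
        by (simp add: cinner_self t_def)
      ultimately show "ons {..<Suc n} u'"
        using ons(1) t unfolding ons_def u'_def
        by (auto simp: less_Suc_eq power2_eq_square)
      have "cinner (v k) w0 = 0" "cinner w0 (v k) = 0" if "k < n" for k
        using w0W that cnj_cinner[of "v k" w0] by (auto simp: W_def)
      moreover have "cinner w0 w0 = 1" using nw0 by (simp add: norm_eq_1_iff)
      ultimately show "ons {..<Suc n} v'"
        using ons(2) unfolding ons_def v'_def by (auto simp: less_Suc_eq)
    next
      fix k assume "k < Suc n"
      then show "0 < s' k" "supported F (u' k)" "supported F (v' k)"
          "blinfun_apply y (v' k) = cscale (of_real (s' k)) (u' k)"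
        using s su sv yv t w0W ysupp
        by (auto simp: s'_def u'_def v'_def W_def less_Suc_eq intro: supported_cscale)
    next
      fix z k assume z: "z \<in> W (Suc n) v'" and k: "k < Suc n"
      then have zW: "z \<in> W n v" and z0: "cinner w0 z = 0"
        by (auto simp: W_def v'_def less_Suc_eq split: if_splits)
      show "cinner (u' k) (blinfun_apply y z) = 0"
      proof (cases "k = n")
        case True
        have "cinner (blinfun_apply y w0) (blinfun_apply y z) = 0"
        proof (rule maximal_vector_orthogonal[OF y _ nw0 t_def[symmetric] z0])
          fix c
          have "w0 + cscale c z \<in> W n v"
            using w0W zW by (auto simp: W_def intro: supported_add supported_cscale)
          then show "norm (blinfun_apply y (w0 + cscale c z)) \<le> t * norm (w0 + cscale c z)" by (rule ub)
        qed
        then show ?thesis using True by (simp add: u'_def)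
      next
        case False
        then show ?thesis using k orth[OF zW] by (simp add: u'_def)
      qed
    qed
    then show False using max[of "Suc n"] by fastforce
  qed
  have "y = diag_op {..<n} (\<lambda>k. of_real (s k)) u v"
  proof (rule blinfun_eqI)
    fix w
    \<comment> \<open>The component of \<open>cut F w\<close> orthogonal to all \<open>v k\<close>,
      which \<open>zero\<close> shows to be annihilated by \<open>y\<close>.\<close>
    define w' where "w' = cut F w - (\<Sum>k<n. cscale (cinner (v k) (cut F w)) (v k))"
    have "w' \<in> W n v"
      unfolding W_def w'_def using cinner_ons_sum[OF ons(2)] sv
      by (auto intro!: supported_diff supported_cut F supported_sum supported_cscale)
    then have "blinfun_apply y w' = 0" by (rule zero)
    moreover have "cinner (v k) (cut F w) = cinner (v k) w" if "k < n" for k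
      using cinner_cut[OF F, of "v k" w] cut_supported[OF F sv[OF that]] by simp
    ultimately have "blinfun_apply y (cut F w) = (\<Sum>k<n. cscale (cinner (v k) w) (blinfun_apply y (v k)))"
      unfolding w'_def by (simp add: blinfun.diff_right blinfun.sum_right bounded_opsD[OF y])
    also have "\<dots> = blinfun_apply (diag_op {..<n} (\<lambda>k. of_real (s k)) u v) w"
      unfolding diag_op_apply by (intro sum.cong refl) (simp add: yv mult.commute)
    also have "blinfun_apply y (cut F w) = blinfun_apply y w"
      unfolding y_def trunc_apply using cut_supported[OF F supported_cut[OF F]] by simp
    finally show "blinfun_apply y w = blinfun_apply (diag_op {..<n} (\<lambda>k. of_real (s k)) u v) w" .
  qed
  then show thesis using that[OF ons s su sv] by (simp add: y_def)
qed

text \<open>Singular vectors supported in \<open>F\<close> do not see the truncation. Hence its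
  singular values are coefficients of \<open>x\<close> itself and compete in the supremum
  \<open>sing_sum\<close> of \<open>x\<close>.\<close>

lemma singular_value_eq:
  assumes F: "finite F" and "supported F (u k)" "supported F (v k)" "ons K u" "ons K v" "finite K" "k \<in> K"
    and svd: "trunc F x = diag_op K s u v"
  shows "cinner (u k) (blinfun_apply x (v k)) = s k"
proof -
  have "cinner (u k) (blinfun_apply x (v k)) = cinner (u k) (blinfun_apply (trunc F x) (v k))"
    unfolding trunc_apply cut_supported[OF F assms(3)]
    using cinner_cut[OF F, of "u k"] cut_supported[OF F assms(2)] by metis
  also have "\<dots> = cinner (u k) (\<Sum>l\<in>K. cscale (s l * cinner (v l) (v k)) (u l))"
    unfolding svd diag_op_apply ..
  also have "\<dots> = s k * cinner (v k) (v k)"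
    using cinner_ons_sum[OF assms(4,6,7), of "\<lambda>l. s l * cinner (v l) (v k)"] .
  finally show ?thesis using onsD[OF assms(5,7,7)] by simp
qed

section \<open>Functional calculus of \<open>x\<^sup>* x\<close>\<close>

text \<open>The functional calculus is developed for operators of this form: they are positive, and
  truncating \<open>x\<close> approximates them by diagonal operators of the same form.\<close>

definition gram :: "'i oper \<Rightarrow> 'i oper" where
  "gram x = op_adj x o\<^sub>L x"

lemma gram_bounded_ops: "x \<in> bounded_ops \<Longrightarrow> gram x \<in> bounded_ops"
  unfolding gram_def by (intro bounded_ops_compose op_adj_bounded_ops)

lemma cinner_gram: "x \<in> bounded_ops \<Longrightarrow> cinner v (blinfun_apply (gram x) w) = cinner (blinfun_apply x v) (blinfun_apply x w)"
  by (simp add: gram_def cinner_op_adj)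

text \<open>The C*-identity. It places the interval belonging to any truncation of \<open>x\<close>
  inside the one belonging to \<open>x\<close>, so one polynomial approximation serves them
  all.\<close>

lemma norm_gram:
  assumes "x \<in> bounded_ops"
  shows "norm (gram x) = (norm x)\<^sup>2"
proof (rule antisym)
  show "norm (gram x) \<le> (norm x)\<^sup>2"
    unfolding gram_def using norm_blinfun_compose[of "op_adj x" x] norm_op_adj_le[OF assms]
    by (smt (verit) mult_right_mono norm_ge_zero power2_eq_square)
  have "norm x \<le> sqrt (norm (gram x))"
  proof (rule norm_blinfun_bound)
    fix v
    have "(norm (blinfun_apply x v))\<^sup>2 = cmod (cinner v (blinfun_apply (gram x) v))"
      by (simp add: cinner_gram assms cinner_self norm_power)
    also have "\<dots> \<le> norm v * norm (blinfun_apply (gram x) v)" by (rule cmod_cinner_le)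
    also have "\<dots> \<le> norm v * (norm (gram x) * norm v)" by (intro mult_left_mono norm_blinfun) auto
    also have "\<dots> = (sqrt (norm (gram x)) * norm v)\<^sup>2" by (simp add: power_mult_distrib power2_eq_square)
    finally show "norm (blinfun_apply x v) \<le> sqrt (norm (gram x)) * norm v"
      by (rule power2_le_imp_le) auto
  qed auto
  then have "(norm x)\<^sup>2 \<le> (sqrt (norm (gram x)))\<^sup>2" by (rule power_mono) auto
  then show "(norm x)\<^sup>2 \<le> norm (gram x)" by simp
qed

lemma op_adj_trunc:
  assumes x: "x \<in> bounded_ops" and F: "finite F"
  shows "op_adj (trunc F x) = trunc F (op_adj x)"
  by (rule op_adj_eqI) (simp add: trunc_apply cinner_cut[OF F] cinner_op_adj[OF x])

section \<open>Polynomials of operators, and of diagonal operators in particular\<close>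

lemma blinfun_compose_id [simp]: "x o\<^sub>L id_blinfun = x"
  by (rule blinfun_eqI) simp

lemma op_poly_altdef:
  assumes "degree f \<le> n"
  shows "op_poly f a = (\<Sum>k\<le>n. coeff f k *\<^sub>R (((o\<^sub>L) a) ^^ k) id_blinfun)"
  unfolding op_poly_def using assms
  by (intro sum.mono_neutral_left) (auto simp: coeff_eq_0)

lemma op_poly_0 [simp]: "op_poly 0 a = 0"
  by (simp add: op_poly_def)

lemma op_poly_pCons: "op_poly (pCons c f) a = c *\<^sub>R id_blinfun + (a o\<^sub>L op_poly f a)"
proof -
  have "op_poly (pCons c f) a = (\<Sum>k\<le>Suc (degree f). coeff (pCons c f) k *\<^sub>R (((o\<^sub>L) a) ^^ k) id_blinfun)"
    by (rule op_poly_altdef) (rule degree_pCons_le)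
  also have "\<dots> = c *\<^sub>R id_blinfun + (\<Sum>k\<le>degree f. coeff f k *\<^sub>R (a o\<^sub>L (((o\<^sub>L) a) ^^ k) id_blinfun))"
    by (subst sum.atMost_Suc_shift) simp
  also have "(\<Sum>k\<le>degree f. coeff f k *\<^sub>R (a o\<^sub>L (((o\<^sub>L) a) ^^ k) id_blinfun)) = a o\<^sub>L op_poly f a"
    unfolding op_poly_def
    by (simp add: bounded_bilinear.sum_right[OF bounded_bilinear_blinfun_compose]
        bounded_bilinear.scaleR_right[OF bounded_bilinear_blinfun_compose])
  finally show ?thesis .
qed

lemma op_poly_diff: "op_poly (f - g) a = op_poly f a - op_poly g a"
proof -
  let ?n = "max (degree f) (degree g)"
  have "op_poly (f - g) a = (\<Sum>k\<le>?n. coeff (f - g) k *\<^sub>R (((o\<^sub>L) a) ^^ k) id_blinfun)"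
    by (rule op_poly_altdef) (rule degree_diff_le_max)
  also have "\<dots> = op_poly f a - op_poly g a"
    by (simp add: op_poly_altdef[of f ?n] op_poly_altdef[of g ?n] scaleR_diff_left sum_subtractf)
  finally show ?thesis .
qed

lemma op_poly_bounded_ops: "a \<in> bounded_ops \<Longrightarrow> op_poly f a \<in> bounded_ops"
  by (induction f)
    (auto simp: op_poly_pCons intro!: bounded_ops_0 bounded_ops_add bounded_ops_scaleR bounded_ops_id bounded_ops_compose)

text \<open>The value of \<open>f\<close> at the operator with eigenvectors \<open>v k\<close> and
  eigenvalues \<open>t k\<close>. On the orthogonal complement of the \<open>v k\<close> the
  eigenvalue is 0, whence the first summand; a polynomial with constant term acts there as
  well.\<close>

definition diag_calc :: "(real \<Rightarrow> real) \<Rightarrow> 'k set \<Rightarrow> ('k \<Rightarrow> real) \<Rightarrow> ('k \<Rightarrow> 'i ell2) \<Rightarrow> 'i oper" where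
  "diag_calc f K t v = f 0 *\<^sub>R (id_blinfun - diag_op K (\<lambda>_. 1) v v) + diag_op K (\<lambda>k. of_real (f (t k))) v v"

lemma diag_calc_apply:
  "blinfun_apply (diag_calc f K t v) w = f 0 *\<^sub>R (w - (\<Sum>k\<in>K. cscale (cinner (v k) w) (v k)))
    + (\<Sum>k\<in>K. cscale (of_real (f (t k)) * cinner (v k) w) (v k))"
  by (simp add: diag_calc_def diag_op_apply blinfun.add_left blinfun.scaleR_left blinfun.diff_left)

lemma cinner_diag_calc:
  "cinner u (blinfun_apply (diag_calc f K t v) w) = of_real (f 0) * (cinner u w - (\<Sum>k\<in>K. cinner u (v k) * cinner (v k) w))
    + (\<Sum>k\<in>K. of_real (f (t k)) * cinner u (v k) * cinner (v k) w)"
  by (simp add: diag_calc_apply cinner_sum_right mult_ac)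

lemma diag_calc_diff: "diag_calc (\<lambda>s. f s - g s) K t v = diag_calc f K t v - diag_calc g K t v"
  by (rule blinfun_eqI, rule cinner_ext)
    (simp add: cinner_diag_calc blinfun.diff_left algebra_simps sum_subtractf)

text \<open>The image splits into a part in the span of the \<open>v k\<close> and a multiple of the
  residual; these are orthogonal, and each is scaled by at most \<open>B\<close>.\<close>

lemma norm_diag_calc_le:
  assumes v: "ons K v" "finite K" and "\<bar>f 0\<bar> \<le> B" "\<And>k. k \<in> K \<Longrightarrow> \<bar>f (t k)\<bar> \<le> B"
  shows "norm (diag_calc f K t v) \<le> B"
proof (rule norm_blinfun_bound)
  show B: "0 \<le> B" using assms(3) by linarith
  fix w
  define r where "r = w - (\<Sum>k\<in>K. cscale (cinner (v k) w) (v k))"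
  define z where "z = (\<Sum>k\<in>K. cscale (of_real (f (t k)) * cinner (v k) w) (v k))"
  have "cinner (v k) r = 0" if "k \<in> K" for k
    using cinner_ons_sum[OF v that, of "\<lambda>k. cinner (v k) w"] by (simp add: r_def)
  then have "cinner z r = 0" by (simp add: z_def cinner_sum_left)
  then have "cinner r z = 0" using cnj_cinner[of z r] by simp
  have "(norm (blinfun_apply (diag_calc f K t v) w))\<^sup>2 = (norm z)\<^sup>2 + \<bar>f 0\<bar>\<^sup>2 * (norm r)\<^sup>2"
    using norm_add_cscale_square[of z "of_real (f 0)" r] \<open>cinner z r = 0\<close>
    by (simp add: diag_calc_apply r_def[symmetric] z_def[symmetric] scaleR_eq_cscale add.commute)
  also have "\<dots> \<le> (\<Sum>k\<in>K. B\<^sup>2 * (cmod (cinner (v k) w))\<^sup>2) + B\<^sup>2 * (norm r)\<^sup>2"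
    unfolding z_def pythagoras[OF v] norm_mult power_mult_distrib norm_of_real
    by (intro add_mono sum_mono mult_right_mono power_mono assms) auto
  also have "\<dots> = (B * norm w)\<^sup>2"
    unfolding r_def bessel_residual[OF v] by (simp add: sum_distrib_left[symmetric] power_mult_distrib algebra_simps)
  finally show "norm (blinfun_apply (diag_calc f K t v) w) \<le> B * norm w"
    by (rule power2_le_imp_le) (use B in auto)
qed

lemma op_poly_diag:
  assumes v: "ons K v" "finite K"
  shows "op_poly f (diag_op K (\<lambda>k. of_real (t k)) v v) = diag_calc (poly f) K t v"
proof (induction f)
  case 0
  show ?case by (rule blinfun_eqI) (simp add: diag_calc_apply)
next
  case (pCons c f)
  have "diag_op K (\<lambda>k. of_real (t k)) v v o\<^sub>L diag_calc (poly f) K t v = diag_op K (\<lambda>k. of_real (t k * poly f (t k))) v v"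
    unfolding diag_calc_def
      bounded_bilinear.add_right[OF bounded_bilinear_blinfun_compose]
      bounded_bilinear.diff_right[OF bounded_bilinear_blinfun_compose]
      bounded_bilinear.scaleR_right[OF bounded_bilinear_blinfun_compose] diag_op_compose[OF v]
    by simp
  then show ?case
    unfolding op_poly_pCons pCons.IH
    by (intro blinfun_eqI cinner_ext)
      (simp add: blinfun.add_left blinfun.scaleR_left cinner_diag_op cinner_diag_calc algebra_simps sum.distrib
        sum_distrib_left)
qed

text \<open>Strong convergence with a uniform bound on all finite truncations. The bound is part of
  the notion because it makes strong limits compatible with composition.\<close>

definition slim :: "('i set \<Rightarrow> 'i oper) \<Rightarrow> 'i oper \<Rightarrow> bool" where
  "slim X x \<longleftrightarrow> (\<exists>C. \<forall>F. finite F \<longrightarrow> norm (X F) \<le> C) \<and>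
    (\<forall>v. ((\<lambda>F. blinfun_apply (X F) v) \<longlongrightarrow> blinfun_apply x v) finsub)"

lemma slim_apply:
  assumes "slim X x" "(w \<longlongrightarrow> v) finsub"
  shows "((\<lambda>F. blinfun_apply (X F) (w F)) \<longlongrightarrow> blinfun_apply x v) finsub"
proof -
  obtain C where C: "\<And>F. finite F \<Longrightarrow> norm (X F) \<le> C" using assms(1) by (auto simp: slim_def)
  have "((\<lambda>F. blinfun_apply (X F) (w F - v)) \<longlongrightarrow> 0) finsub"
  proof (rule Lim_null_comparison)
    show "\<forall>\<^sub>F F in finsub. norm (blinfun_apply (X F) (w F - v)) \<le> C * norm (w F - v)"
      by (rule eventually_finsubI) (meson C mult_right_mono norm_blinfun norm_ge_zero order_trans)
    show "((\<lambda>F. C * norm (w F - v)) \<longlongrightarrow> 0) finsub"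
      using assms(2) by (intro tendsto_mult_right_zero tendsto_norm_zero LIM_zero)
  qed
  moreover have "((\<lambda>F. blinfun_apply (X F) v) \<longlongrightarrow> blinfun_apply x v) finsub"
    using assms(1) by (simp add: slim_def)
  ultimately show ?thesis
    using tendsto_add by (fastforce simp: blinfun.diff_right)
qed

lemma slim_bound: "slim X x \<Longrightarrow> \<exists>C. \<forall>F. finite F \<longrightarrow> norm (X F) \<le> C"
  by (simp add: slim_def)

lemma slim_compose: assumes "slim X x" "slim Y y" shows "slim (\<lambda>F. X F o\<^sub>L Y F) (x o\<^sub>L y)"
proof -
  obtain C D where C: "\<And>F. finite F \<Longrightarrow> norm (X F) \<le> C" and D: "\<And>F. finite F \<Longrightarrow> norm (Y F) \<le> D"
    using assms[THEN slim_bound] by blast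
  have "norm (X F o\<^sub>L Y F) \<le> C * D" if "finite F" for F
    using norm_blinfun_compose[of "X F" "Y F"]
      mult_mono[OF C[OF that] D[OF that] order_trans[OF norm_ge_zero C[OF that]] norm_ge_zero]
    by linarith
  moreover have "((\<lambda>F. blinfun_apply (X F) (blinfun_apply (Y F) v)) \<longlongrightarrow> blinfun_apply x (blinfun_apply y v)) finsub" for v
    using assms by (intro slim_apply) (auto simp: slim_def)
  ultimately show ?thesis by (auto simp: slim_def)
qed

lemma slim_trunc: "slim (\<lambda>F. trunc F x) x"
  unfolding slim_def using norm_trunc_le tendsto_trunc by blast

lemma slim_cong: "(\<And>F. finite F \<Longrightarrow> X F = Y F) \<Longrightarrow> slim X x \<longleftrightarrow> slim Y x"
proof -
  have *: "slim Y x" if "\<And>F. finite F \<Longrightarrow> X F = Y F" "slim X x" for X Y :: "'a set \<Rightarrow> 'a oper"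
    unfolding slim_def
  proof (intro conjI allI)
    show "\<exists>C. \<forall>F. finite F \<longrightarrow> norm (Y F) \<le> C"
      using that slim_bound by metis
    fix v
    show "((\<lambda>F. blinfun_apply (Y F) v) \<longlongrightarrow> blinfun_apply x v) finsub"
      by (rule Lim_transform_eventually[of "\<lambda>F. blinfun_apply (X F) v"])
        (use that(2) eventually_mono[OF eventually_finsub[OF finite.emptyI]] that(1) in \<open>auto simp: slim_def\<close>)
  qed
  assume "\<And>F. finite F \<Longrightarrow> X F = Y F"
  then show ?thesis using *[of X Y] *[of Y X] by metis
qed

lemma slim_op_adj_trunc: "x \<in> bounded_ops \<Longrightarrow> slim (\<lambda>F. op_adj (trunc F x)) (op_adj x)"
  using slim_trunc[of "op_adj x"] by (subst slim_cong[of _ "\<lambda>F. trunc F (op_adj x)"]) (auto simp: op_adj_trunc)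

lemma slim_gram_trunc: "x \<in> bounded_ops \<Longrightarrow> slim (\<lambda>F. gram (trunc F x)) (gram x)"
  unfolding gram_def by (intro slim_compose slim_op_adj_trunc slim_trunc)

lemma slim_unique: "slim X x \<Longrightarrow> slim X y \<Longrightarrow> x = y"
  unfolding slim_def by (meson blinfun_eqI finsub_neq_bot tendsto_unique)

lemma norm_gram_trunc_le: "x \<in> bounded_ops \<Longrightarrow> finite F \<Longrightarrow> norm (gram (trunc F x)) \<le> norm (gram x)"
  by (simp add: norm_gram trunc_bounded_ops power_mono norm_trunc_le)

lemma tendsto_op_poly:
  assumes "slim A a"
  shows "((\<lambda>F. blinfun_apply (op_poly f (A F)) v) \<longlongrightarrow> blinfun_apply (op_poly f a) v) finsub"
proof (induction f arbitrary: v)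
  case (pCons c f)
  show ?case unfolding op_poly_pCons blinfun.add_left blinfun.scaleR_left blinfun_apply_blinfun_compose
    by (intro tendsto_intros slim_apply[OF assms] pCons.IH)
qed simp

lemma gram_trunc_diag:
  assumes x: "x \<in> bounded_ops" and F: "finite F"
  obtains n :: nat and u v :: "nat \<Rightarrow> 'i ell2" and s :: "nat \<Rightarrow> real" where
    "ons {..<n} u" "ons {..<n} v" "\<And>k. k < n \<Longrightarrow> 0 < s k"
    "\<And>k. k < n \<Longrightarrow> cinner (u k) (blinfun_apply x (v k)) = of_real (s k)"
    "trunc F x = diag_op {..<n} (\<lambda>k. of_real (s k)) u v"
    "gram (trunc F x) = diag_op {..<n} (\<lambda>k. of_real ((s k)\<^sup>2)) v v"
    "\<And>k. k < n \<Longrightarrow> (s k)\<^sup>2 \<in> {0..norm (gram (trunc F x))}"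
proof -
  obtain n :: nat and u v :: "nat \<Rightarrow> 'i ell2" and s :: "nat \<Rightarrow> real" where svd: "ons {..<n} u" "ons {..<n} v" "\<And>k. k < n \<Longrightarrow> 0 < s k"
    "\<And>k. k < n \<Longrightarrow> supported F (u k)" "\<And>k. k < n \<Longrightarrow> supported F (v k)"
    "trunc F x = diag_op {..<n} (\<lambda>k. of_real (s k)) u v"
    by (rule svd_trunc[OF x F]) (rule that; simp)
  have g: "gram (trunc F x) = diag_op {..<n} (\<lambda>k. of_real ((s k)\<^sup>2)) v v"
    unfolding gram_def svd(6) op_adj_diag_op diag_op_compose[OF svd(1) finite_lessThan]
    by (simp add: power2_eq_square)
  have "(s k)\<^sup>2 \<le> norm (gram (trunc F x))" if k: "k < n" for k
  proof -
    have "cinner (v k) (blinfun_apply (gram (trunc F x)) (v k)) = of_real ((s k)\<^sup>2)"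
    proof -
      have "cinner (v k) (blinfun_apply (gram (trunc F x)) (v k))
          = (\<Sum>l<n. if l = k then of_real ((s k)\<^sup>2) else 0)"
        unfolding g cinner_diag_op using k by (intro sum.cong) (auto simp: onsD[OF svd(2)])
      then show ?thesis using k by simp
    qed
    then have "(s k)\<^sup>2 \<le> norm (v k) * norm (blinfun_apply (gram (trunc F x)) (v k))"
      using cmod_cinner_le[of "v k" "blinfun_apply (gram (trunc F x)) (v k)"] by (simp add: norm_power)
    also have "\<dots> \<le> norm (gram (trunc F x))"
      using norm_blinfun[of "gram (trunc F x)" "v k"] ons_norm[OF svd(2)] k by simp
    finally show ?thesis .
  qed
  moreover have "cinner (u k) (blinfun_apply x (v k)) = of_real (s k)" if "k < n" for k
    by (rule singular_value_eq[OF F svd(4,5)[OF that] svd(1,2) finite_lessThan _ svd(6)]) (use that in simp)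
  ultimately show thesis using svd g by (intro that[of n u v s]) auto
qed

lemma norm_op_poly_gram_trunc_le:
  assumes x: "x \<in> bounded_ops" and F: "finite F" and B: "\<And>t. t \<in> {0..norm (gram (trunc F x))} \<Longrightarrow> \<bar>poly f t\<bar> \<le> B"
  shows "norm (op_poly f (gram (trunc F x))) \<le> B"
proof -
  show ?thesis
  proof (rule gram_trunc_diag[OF x F])
    fix n :: nat and v :: "nat \<Rightarrow> 'a ell2" and s :: "nat \<Rightarrow> real"
    assume d: "ons {..<n} v" "gram (trunc F x) = diag_op {..<n} (\<lambda>k. of_real ((s k)\<^sup>2)) v v"
      "\<And>k. k < n \<Longrightarrow> (s k)\<^sup>2 \<in> {0..norm (gram (trunc F x))}"
    show "norm (op_poly f (gram (trunc F x))) \<le> B"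
      unfolding d(2) op_poly_diag[OF d(1) finite_lessThan]
      by (rule norm_diag_calc_le[OF d(1) finite_lessThan]) (use B d(3) in auto)
  qed
qed

text \<open>This replaces the spectral theorem: it holds for the truncations, where the operator is
  diagonal with eigenvalues in the interval, and bounds on norms survive strong limits.\<close>

lemma norm_op_poly_gram_le:
  assumes x: "x \<in> bounded_ops" and B: "\<And>t. t \<in> {0..norm (gram x)} \<Longrightarrow> \<bar>poly f t\<bar> \<le> B"
  shows "norm (op_poly f (gram x)) \<le> B"
proof (rule norm_blinfun_bound)
  show B0: "0 \<le> B" using B[of 0] by auto
  fix v
  show "norm (blinfun_apply (op_poly f (gram x)) v) \<le> B * norm v"
  proof (rule tendsto_upperbound)
    show "((\<lambda>F. norm (blinfun_apply (op_poly f (gram (trunc F x))) v)) \<longlongrightarrow> norm (blinfun_apply (op_poly f (gram x)) v)) finsub"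
      by (intro tendsto_norm tendsto_op_poly slim_gram_trunc x)
    show "\<forall>\<^sub>F F in finsub. norm (blinfun_apply (op_poly f (gram (trunc F x))) v) \<le> B * norm v"
      using eventually_finsub[OF finite.emptyI]
    proof (rule eventually_mono)
      fix F :: "'a set" assume "finite F \<and> {} \<subseteq> F"
      then have "norm (op_poly f (gram (trunc F x))) \<le> B"
        using norm_gram_trunc_le[OF x, of F] by (intro norm_op_poly_gram_trunc_le x B) auto
      then show "norm (blinfun_apply (op_poly f (gram (trunc F x))) v) \<le> B * norm v"
        by (meson mult_right_mono norm_blinfun norm_ge_zero order_trans)
    qed
  qed simp
qed

section \<open>Continuous functions of \<open>gram x\<close>\<close>

lemma poly_approx:
  fixes f :: "real \<Rightarrow> real"
  assumes "continuous_on {0..b} f" "0 < e"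
  obtains p where "\<And>t. t \<in> {0..b} \<Longrightarrow> \<bar>f t - poly p t\<bar> < e"
proof -
  obtain g where g: "real_polynomial_function g" "\<And>t. t \<in> {0..b} \<Longrightarrow> \<bar>f t - g t\<bar> < e"
    using Stone_Weierstrass_real_polynomial_function[OF compact_Icc assms] by metis
  then obtain a n where "g = (\<lambda>x. \<Sum>i\<le>n. a i * x^i)"
    by (auto simp: real_polynomial_function_iff_sum)
  then have "poly (\<Sum>i\<le>n. monom (a i) i) t = g t" for t
    by (simp add: poly_sum poly_monom)
  then show thesis using g that[of "\<Sum>i\<le>n. monom (a i) i"] by auto
qed

lemma poly_approx_seq:
  fixes f :: "real \<Rightarrow> real"
  assumes "continuous_on {0..b} f"
  obtains P where "uniform_limit {0..b} (\<lambda>n. poly (P n)) f sequentially"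
proof -
  have "\<exists>p. \<forall>t\<in>{0..b}. \<bar>f t - poly p t\<bar> < 1 / Suc n" for n
  proof -
    have "0 < 1 / real (Suc n)" by simp
    then obtain p where "\<And>t. t \<in> {0..b} \<Longrightarrow> \<bar>f t - poly p t\<bar> < 1 / Suc n"
      using poly_approx[OF assms] by metis
    then show ?thesis by (intro exI[of _ p] ballI)
  qed
  then have "\<exists>P. \<forall>n. \<forall>t\<in>{0..b}. \<bar>f t - poly (P n) t\<bar> < 1 / Suc n"
    by (intro choice allI)
  then obtain P where P: "\<forall>n. \<forall>t\<in>{0..b}. \<bar>f t - poly (P n) t\<bar> < 1 / Suc n" ..
  have "uniform_limit {0..b} (\<lambda>n. poly (P n)) f sequentially"
  proof (rule uniform_limitI)
    fix e :: real assume "0 < e"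
    then obtain N where N: "1 / Suc N < e" using nat_approx_posE by blast
    show "\<forall>\<^sub>F n in sequentially. \<forall>t\<in>{0..b}. dist (poly (P n) t) (f t) < e"
      using eventually_ge_at_top[of N]
    proof (rule eventually_mono, intro ballI)
      fix n t assume "N \<le> n" "t \<in> {0..b}"
      then have "\<bar>f t - poly (P n) t\<bar> < 1 / Suc n" using P by blast
      also have "\<dots> \<le> 1 / Suc N" using \<open>N \<le> n\<close> by (simp add: frac_le)
      finally show "dist (poly (P n) t) (f t) < e" using N by (simp add: dist_real_def abs_minus_commute)
    qed
  qed
  then show thesis by (rule that)
qed

text \<open>Polynomials close on the interval have values close in norm. So approximating sequences
  give Cauchy sequences of operators with one common limit, and the description in
  \<open>fun_calc\<close> is well defined.\<close>

lemma fun_calc_tendsto: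
  assumes x: "x \<in> bounded_ops" and f: "continuous_on {0..norm (gram x)} f"
    and P: "uniform_limit {0..norm (gram x)} (\<lambda>n. poly (P n)) f sequentially"
  shows "(\<lambda>n. op_poly (P n) (gram x)) \<longlonglongrightarrow> fun_calc f (gram x)"
proof -
  let ?I = "{0..norm (gram x)}"
  have cauchy: "Cauchy (\<lambda>n. op_poly (Q n) (gram x))"
    if Q: "uniform_limit ?I (\<lambda>n. poly (Q n)) f sequentially" for Q
  proof (rule metric_CauchyI)
    fix e :: real assume e: "0 < e"
    then have e4: "0 < e / 4" by simp
    obtain M where M: "\<And>n t. n \<ge> M \<Longrightarrow> t \<in> ?I \<Longrightarrow> dist (poly (Q n) t) (f t) < e / 4"
      using uniform_limitD[OF Q e4] unfolding eventually_sequentially by blast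
    have "dist (op_poly (Q m) (gram x)) (op_poly (Q n) (gram x)) < e" if "m \<ge> M" "n \<ge> M" for m n
    proof -
      have "norm (op_poly (Q m) (gram x) - op_poly (Q n) (gram x)) \<le> e / 2"
        unfolding op_poly_diff[symmetric]
      proof (rule norm_op_poly_gram_le[OF x])
        fix t assume t: "t \<in> ?I"
        show "\<bar>poly (Q m - Q n) t\<bar> \<le> e / 2"
          using M[OF that(1) t] M[OF that(2) t] unfolding dist_real_def poly_diff by linarith
      qed
      then show ?thesis using e by (simp add: dist_norm)
    qed
    then show "\<exists>M. \<forall>m\<ge>M. \<forall>n\<ge>M. dist (op_poly (Q m) (gram x)) (op_poly (Q n) (gram x)) < e" by blast
  qed
  obtain L where L: "(\<lambda>n. op_poly (P n) (gram x)) \<longlonglongrightarrow> L"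
    using cauchy[OF P] by (meson Cauchy_convergent_iff convergentD)
  have all: "(\<lambda>n. op_poly (Q n) (gram x)) \<longlonglongrightarrow> L"
    if Q: "uniform_limit ?I (\<lambda>n. poly (Q n)) f sequentially" for Q
  proof -
    have "(\<lambda>n. op_poly (Q n) (gram x) - op_poly (P n) (gram x)) \<longlonglongrightarrow> 0"
    proof (rule LIMSEQ_I)
      fix e :: real assume e: "0 < e"
      then have e4: "0 < e / 4" by simp
      obtain M where M: "\<And>n t. n \<ge> M \<Longrightarrow> t \<in> ?I \<Longrightarrow> dist (poly (Q n) t) (f t) < e / 4"
        using uniform_limitD[OF Q e4] unfolding eventually_sequentially by blast
      obtain N where N: "\<And>n t. n \<ge> N \<Longrightarrow> t \<in> ?I \<Longrightarrow> dist (poly (P n) t) (f t) < e / 4"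
        using uniform_limitD[OF P e4] unfolding eventually_sequentially by blast
      have "norm (op_poly (Q n) (gram x) - op_poly (P n) (gram x) - 0) < e" if "n \<ge> max M N" for n
      proof -
        have "norm (op_poly (Q n) (gram x) - op_poly (P n) (gram x)) \<le> e / 2"
          unfolding op_poly_diff[symmetric]
        proof (rule norm_op_poly_gram_le[OF x])
          fix t assume t: "t \<in> ?I"
          show "\<bar>poly (Q n - P n) t\<bar> \<le> e / 2"
            using M[OF _ t, of n] N[OF _ t, of n] that unfolding dist_real_def poly_diff by linarith
        qed
        then show ?thesis using e by simp
      qed
      then show "\<exists>no. \<forall>n\<ge>no. norm (op_poly (Q n) (gram x) - op_poly (P n) (gram x) - 0) < e" by blast
    qed
    from tendsto_add[OF this L] show ?thesis by simp
  qed
  have "fun_calc f (gram x) = L"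
    unfolding fun_calc_def
  proof (rule the_equality)
    fix b assume "\<forall>Q. uniform_limit ?I (\<lambda>n. poly (Q n)) f sequentially \<longrightarrow> (\<lambda>n. op_poly (Q n) (gram x)) \<longlonglongrightarrow> b"
    then show "b = L" using P L LIMSEQ_unique by blast
  qed (use all in blast)
  with L show ?thesis by simp
qed

lemma fun_calc_bounded_ops:
  assumes x: "x \<in> bounded_ops" and f: "continuous_on {0..norm (gram x)} f"
  shows "fun_calc f (gram x) \<in> bounded_ops"
proof -
  obtain P where "uniform_limit {0..norm (gram x)} (\<lambda>n. poly (P n)) f sequentially"
    using poly_approx_seq[OF f] .
  from fun_calc_tendsto[OF x f this] show ?thesis
    by (rule bounded_ops_lim) (intro op_poly_bounded_ops gram_bounded_ops x)
qed

lemma fun_calc_near: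
  assumes x: "x \<in> bounded_ops" and f: "continuous_on {0..norm (gram x)} f"
    and near: "\<And>t. t \<in> {0..norm (gram x)} \<Longrightarrow> \<bar>f t - poly p t\<bar> \<le> e"
  shows "norm (fun_calc f (gram x) - op_poly p (gram x)) \<le> e"
proof (rule field_le_epsilon)
  fix d :: real assume d: "0 < d"
  obtain P where P: "uniform_limit {0..norm (gram x)} (\<lambda>n. poly (P n)) f sequentially"
    using poly_approx_seq[OF f] .
  show "norm (fun_calc f (gram x) - op_poly p (gram x)) \<le> e + d"
  proof (rule tendsto_upperbound)
    show "(\<lambda>n. norm (op_poly (P n) (gram x) - op_poly p (gram x))) \<longlonglongrightarrow> norm (fun_calc f (gram x) - op_poly p (gram x))"
      by (intro tendsto_intros fun_calc_tendsto x f P)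
    show "\<forall>\<^sub>F n in sequentially. norm (op_poly (P n) (gram x) - op_poly p (gram x)) \<le> e + d"
      using uniform_limitD[OF P d]
    proof (rule eventually_mono)
      fix n assume n: "\<forall>t\<in>{0..norm (gram x)}. dist (poly (P n) t) (f t) < d"
      show "norm (op_poly (P n) (gram x) - op_poly p (gram x)) \<le> e + d"
        unfolding op_poly_diff[symmetric]
      proof (rule norm_op_poly_gram_le[OF x])
        fix t assume t: "t \<in> {0..norm (gram x)}"
        show "\<bar>poly (P n - p) t\<bar> \<le> e + d"
          using n[rule_format, OF t] near[OF t] unfolding dist_real_def poly_diff by linarith
      qed
    qed
  qed simp
qed

text \<open>One polynomial approximates \<open>f\<close> on the interval of \<open>x\<close>, hence
  on those of all truncations at once, and its values at the truncations converge strongly; three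
  errors of \<open>e / 3\<close> add up.\<close>

lemma slim_fun_calc:
  assumes x: "x \<in> bounded_ops" and f: "continuous_on {0..norm (gram x)} f"
  shows "slim (\<lambda>F. fun_calc f (gram (trunc F x))) (fun_calc f (gram x))"
proof -
  have sub: "{0..norm (gram (trunc F x))} \<subseteq> {0..norm (gram x)}" if "finite F" for F
    using norm_gram_trunc_le[OF x that] by auto
  have near: "norm (fun_calc f (gram (trunc F x)) - op_poly p (gram (trunc F x))) \<le> e"
    if "finite F" "\<And>t. t \<in> {0..norm (gram x)} \<Longrightarrow> \<bar>f t - poly p t\<bar> \<le> e" for F p e
    using that sub[OF that(1)] continuous_on_subset[OF f sub[OF that(1)]]
    by (intro fun_calc_near trunc_bounded_ops x) auto
  obtain p0 where p0: "\<And>t. t \<in> {0..norm (gram x)} \<Longrightarrow> \<bar>f t - poly p0 t\<bar> < 1"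
    using poly_approx[OF f, of 1] by auto
  have "bounded (poly p0 ` {0..norm (gram x)})"
    by (intro compact_imp_bounded compact_continuous_image continuous_intros compact_Icc)
  then obtain B where B: "\<forall>t\<in>{0..norm (gram x)}. \<bar>poly p0 t\<bar> \<le> B"
    by (auto simp: bounded_iff)
  have "norm (fun_calc f (gram (trunc F x))) \<le> B + 1" if F: "finite F" for F
  proof -
    have "norm (op_poly p0 (gram (trunc F x))) \<le> B"
      by (rule norm_op_poly_gram_trunc_le[OF x F]) (use B sub[OF F] in blast)
    moreover have "norm (fun_calc f (gram (trunc F x)) - op_poly p0 (gram (trunc F x))) \<le> 1"
      using p0 by (intro near F) (auto intro: less_imp_le)
    ultimately show ?thesis using norm_triangle_sub[of "fun_calc f (gram (trunc F x))" "op_poly p0 (gram (trunc F x))"] by linarith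
  qed
  moreover have "((\<lambda>F. blinfun_apply (fun_calc f (gram (trunc F x))) v) \<longlongrightarrow> blinfun_apply (fun_calc f (gram x)) v) finsub" for v
  proof (rule tendstoI)
    fix e :: real assume e: "0 < e"
    \<comment> \<open>Adding 1 keeps the divisor in \<open>d\<close> positive when
      \<open>v = 0\<close>.\<close>
    define c where "c = norm v + 1"
    define d where "d = e / (3 * c)"
    have c: "0 < c" using norm_ge_zero[of v] unfolding c_def by linarith
    have d: "0 < d" unfolding d_def using e c by simp
    have "d * norm v \<le> d * c" using d by (intro mult_left_mono) (auto simp: c_def)
    also have "\<dots> = e / 3" unfolding d_def using c by simp
    finally have dv: "d * norm v \<le> e / 3" .
    obtain p where p: "\<And>t. t \<in> {0..norm (gram x)} \<Longrightarrow> \<bar>f t - poly p t\<bar> < d"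
      by (rule poly_approx[OF f d]) (rule that; simp)
    have n1: "norm (blinfun_apply (fun_calc f (gram x)) v - blinfun_apply (op_poly p (gram x)) v) \<le> e / 3"
    proof -
      have "norm (fun_calc f (gram x) - op_poly p (gram x)) \<le> d"
        using p by (intro fun_calc_near x f) (auto intro: less_imp_le)
      then have "norm (fun_calc f (gram x) - op_poly p (gram x)) * norm v \<le> d * norm v"
        by (intro mult_right_mono) auto
      then show ?thesis
        using norm_blinfun[of "fun_calc f (gram x) - op_poly p (gram x)" v] dv by (simp add: blinfun.diff_left)
    qed
    have n2: "norm (blinfun_apply (fun_calc f (gram (trunc F x))) v - blinfun_apply (op_poly p (gram (trunc F x))) v) \<le> e / 3"
      if F: "finite F" for F
    proof -
      have "norm (fun_calc f (gram (trunc F x)) - op_poly p (gram (trunc F x))) \<le> d"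
        using p by (intro near F) (auto intro: less_imp_le)
      then have "norm (fun_calc f (gram (trunc F x)) - op_poly p (gram (trunc F x))) * norm v \<le> d * norm v"
        by (intro mult_right_mono) auto
      then show ?thesis
        using norm_blinfun[of "fun_calc f (gram (trunc F x)) - op_poly p (gram (trunc F x))" v] dv
        by (simp add: blinfun.diff_left)
    qed
    have "\<forall>\<^sub>F F in finsub. dist (blinfun_apply (op_poly p (gram (trunc F x))) v) (blinfun_apply (op_poly p (gram x)) v) < e / 3"
      using e by (intro tendstoD[OF tendsto_op_poly[OF slim_gram_trunc[OF x]]]) auto
    then show "\<forall>\<^sub>F F in finsub. dist (blinfun_apply (fun_calc f (gram (trunc F x))) v) (blinfun_apply (fun_calc f (gram x)) v) < e"
      using eventually_finsub[OF finite.emptyI]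
    proof eventually_elim
      case (elim F)
      have "dist (blinfun_apply (fun_calc f (gram (trunc F x))) v) (blinfun_apply (fun_calc f (gram x)) v)
        \<le> dist (blinfun_apply (fun_calc f (gram (trunc F x))) v) (blinfun_apply (op_poly p (gram (trunc F x))) v)
        + dist (blinfun_apply (op_poly p (gram (trunc F x))) v) (blinfun_apply (op_poly p (gram x)) v)
        + dist (blinfun_apply (op_poly p (gram x)) v) (blinfun_apply (fun_calc f (gram x)) v)"
        using dist_triangle[of "blinfun_apply (fun_calc f (gram (trunc F x))) v" "blinfun_apply (fun_calc f (gram x)) v"
            "blinfun_apply (op_poly p (gram (trunc F x))) v"]
          dist_triangle[of "blinfun_apply (op_poly p (gram (trunc F x))) v" "blinfun_apply (fun_calc f (gram x)) v"
            "blinfun_apply (op_poly p (gram x)) v"] by linarith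
      then show ?case using elim n1 n2[of F] by (simp add: dist_norm norm_minus_commute)
    qed
  qed
  ultimately show ?thesis unfolding slim_def by blast
qed

lemma fun_calc_diag:
  assumes x: "x \<in> bounded_ops" and f: "continuous_on {0..norm (gram x)} f"
    and v: "ons K v" "finite K" and g: "gram x = diag_op K (\<lambda>k. of_real (t k)) v v"
    and t: "\<And>k. k \<in> K \<Longrightarrow> t k \<in> {0..norm (gram x)}"
  shows "fun_calc f (gram x) = diag_calc f K t v"
proof -
  have "norm (fun_calc f (gram x) - diag_calc f K t v) \<le> 0 + e" if e: "0 < e" for e
  proof -
    obtain p where p: "\<And>t. t \<in> {0..norm (gram x)} \<Longrightarrow> \<bar>f t - poly p t\<bar> < e / 2"
      using poly_approx[OF f, of "e / 2"] e by auto
    have "norm (fun_calc f (gram x) - op_poly p (gram x)) \<le> e / 2"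
      using p by (intro fun_calc_near x f) (auto intro: less_imp_le)
    moreover have "norm (diag_calc f K t v - op_poly p (gram x)) \<le> e / 2"
      unfolding g op_poly_diag[OF v] diag_calc_diff[symmetric]
      using p t by (intro norm_diag_calc_le v) (auto intro!: less_imp_le)
    ultimately show ?thesis
      using norm_triangle_ineq4[of "fun_calc f (gram x) - op_poly p (gram x)" "diag_calc f K t v - op_poly p (gram x)"]
      by simp
  qed
  then have "norm (fun_calc f (gram x) - diag_calc f K t v) \<le> 0" by (rule field_le_epsilon)
  then show ?thesis by simp
qed

text \<open>The decomposition is the same for every \<open>f\<close>, so relations between several
  functions, such as order or products, reduce to relations between their values at the squared
  singular values.\<close>

lemma trunc_calc:
  assumes x: "x \<in> bounded_ops" and F: "finite F"
  obtains n :: nat and u v :: "nat \<Rightarrow> 'i ell2" and s :: "nat \<Rightarrow> real" where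
    "ons {..<n} u" "ons {..<n} v" "\<And>k. k < n \<Longrightarrow> 0 < s k"
    "\<And>k. k < n \<Longrightarrow> cinner (u k) (blinfun_apply x (v k)) = of_real (s k)"
    "trunc F x = diag_op {..<n} (\<lambda>k. of_real (s k)) u v"
    "\<And>k. k < n \<Longrightarrow> (s k)\<^sup>2 \<in> {0..norm (gram x)}"
    "\<And>f. continuous_on {0..norm (gram x)} f \<Longrightarrow>
        fun_calc f (gram (trunc F x)) = diag_calc f {..<n} (\<lambda>k. (s k)\<^sup>2) v"
proof (rule gram_trunc_diag[OF x F])
  fix n :: nat and u v :: "nat \<Rightarrow> 'i ell2" and s :: "nat \<Rightarrow> real"
  assume d: "ons {..<n} u" "ons {..<n} v" "\<And>k. k < n \<Longrightarrow> 0 < s k"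
    "\<And>k. k < n \<Longrightarrow> cinner (u k) (blinfun_apply x (v k)) = of_real (s k)"
    "trunc F x = diag_op {..<n} (\<lambda>k. of_real (s k)) u v"
    "gram (trunc F x) = diag_op {..<n} (\<lambda>k. of_real ((s k)\<^sup>2)) v v"
    "\<And>k. k < n \<Longrightarrow> (s k)\<^sup>2 \<in> {0..norm (gram (trunc F x))}"
  have sub: "{0..norm (gram (trunc F x))} \<subseteq> {0..norm (gram x)}"
    using norm_gram_trunc_le[OF x F] by auto
  have "fun_calc f (gram (trunc F x)) = diag_calc f {..<n} (\<lambda>k. (s k)\<^sup>2) v"
    if "continuous_on {0..norm (gram x)} f" for f
    by (rule fun_calc_diag[OF trunc_bounded_ops[OF x] continuous_on_subset[OF that sub] d(2) finite_lessThan d(6)])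
      (use d(7) in auto)
  then show thesis
    by (intro that[of n u v s] d subsetD[OF sub] d(7))
qed

lemma Re_cinner_diag_calc:
  "Re (cinner w (blinfun_apply (diag_calc f K t v) w))
    = f 0 * ((norm w)\<^sup>2 - (\<Sum>k\<in>K. (cmod (cinner (v k) w))\<^sup>2)) + (\<Sum>k\<in>K. f (t k) * (cmod (cinner (v k) w))\<^sup>2)"
proof -
  have c: "cinner w (v k) * cinner (v k) w = of_real ((cmod (cinner (v k) w))\<^sup>2)" for k
    unfolding cnj_cinner[of "v k" w, symmetric] complex_norm_square by simp
  have "cinner w (blinfun_apply (diag_calc f K t v) w)
      = of_real (f 0 * ((norm w)\<^sup>2 - (\<Sum>k\<in>K. (cmod (cinner (v k) w))\<^sup>2)) + (\<Sum>k\<in>K. f (t k) * (cmod (cinner (v k) w))\<^sup>2))"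
    unfolding cinner_diag_calc mult.assoc c cinner_self by simp
  then show ?thesis by (simp only: Re_complex_of_real)
qed

lemma fun_calc_self_adjoint:
  assumes x: "x \<in> bounded_ops" and f: "continuous_on {0..norm (gram x)} f"
  shows "cinner (blinfun_apply (fun_calc f (gram x)) v) w = cinner v (blinfun_apply (fun_calc f (gram x)) w)"
proof (rule tendsto_unique[OF finsub_neq_bot])
  note lim = slim_apply[OF slim_fun_calc[OF x f] tendsto_const]
  show "((\<lambda>F. cinner (blinfun_apply (fun_calc f (gram (trunc F x))) v) w)
      \<longlongrightarrow> cinner (blinfun_apply (fun_calc f (gram x)) v) w) finsub"
    by (intro tendsto_cinner tendsto_const lim)
  show "((\<lambda>F. cinner (blinfun_apply (fun_calc f (gram (trunc F x))) v) w)
      \<longlongrightarrow> cinner v (blinfun_apply (fun_calc f (gram x)) w)) finsub"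
  proof (rule Lim_transform_eventually)
    show "((\<lambda>F. cinner v (blinfun_apply (fun_calc f (gram (trunc F x))) w))
      \<longlongrightarrow> cinner v (blinfun_apply (fun_calc f (gram x)) w)) finsub"
      by (intro tendsto_cinner tendsto_const lim)
    show "\<forall>\<^sub>F F in finsub. cinner v (blinfun_apply (fun_calc f (gram (trunc F x))) w)
        = cinner (blinfun_apply (fun_calc f (gram (trunc F x))) v) w"
    proof (rule eventually_finsubI)
      fix F :: "'a set" assume F: "finite F"
      show "cinner v (blinfun_apply (fun_calc f (gram (trunc F x))) w)
        = cinner (blinfun_apply (fun_calc f (gram (trunc F x))) v) w"
      proof (rule trunc_calc[OF x F])
        fix n :: nat and e :: "nat \<Rightarrow> 'a ell2" and s :: "nat \<Rightarrow> real"
        assume "\<And>f. continuous_on {0..norm (gram x)} f \<Longrightarrow>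
          fun_calc f (gram (trunc F x)) = diag_calc f {..<n} (\<lambda>k. (s k)\<^sup>2) e"
        from this[OF f] have d: "fun_calc f (gram (trunc F x)) = diag_calc f {..<n} (\<lambda>k. (s k)\<^sup>2) e" .
        have "cinner (blinfun_apply (fun_calc f (gram (trunc F x))) v) w
            = cnj (cinner w (blinfun_apply (fun_calc f (gram (trunc F x))) v))" by (simp add: cnj_cinner)
        also have "\<dots> = cinner v (blinfun_apply (fun_calc f (gram (trunc F x))) w)"
          unfolding d cinner_diag_calc by (simp add: cnj_cinner mult_ac)
        finally show ?thesis by simp
      qed
    qed
  qed
qed

lemma fun_calc_mono:
  assumes x: "x \<in> bounded_ops" and f: "continuous_on {0..norm (gram x)} f"
    and g: "continuous_on {0..norm (gram x)} g" and le: "\<And>t. t \<in> {0..norm (gram x)} \<Longrightarrow> f t \<le> g t"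
  shows "Re (cinner w (blinfun_apply (fun_calc f (gram x)) w)) \<le> Re (cinner w (blinfun_apply (fun_calc g (gram x)) w))"
proof (rule tendsto_le[OF finsub_neq_bot])
  show "((\<lambda>F. Re (cinner w (blinfun_apply (fun_calc f (gram (trunc F x))) w)))
      \<longlongrightarrow> Re (cinner w (blinfun_apply (fun_calc f (gram x)) w))) finsub"
    by (intro tendsto_Re tendsto_cinner tendsto_const slim_apply[OF slim_fun_calc] x f)
  show "((\<lambda>F. Re (cinner w (blinfun_apply (fun_calc g (gram (trunc F x))) w)))
      \<longlongrightarrow> Re (cinner w (blinfun_apply (fun_calc g (gram x)) w))) finsub"
    by (intro tendsto_Re tendsto_cinner tendsto_const slim_apply[OF slim_fun_calc] x g)
  show "\<forall>\<^sub>F F in finsub. Re (cinner w (blinfun_apply (fun_calc f (gram (trunc F x))) w))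
      \<le> Re (cinner w (blinfun_apply (fun_calc g (gram (trunc F x))) w))"
  proof (rule eventually_finsubI)
    fix F :: "'a set" assume F: "finite F"
    show "Re (cinner w (blinfun_apply (fun_calc f (gram (trunc F x))) w))
      \<le> Re (cinner w (blinfun_apply (fun_calc g (gram (trunc F x))) w))"
    proof (rule trunc_calc[OF x F])
      fix n :: nat and e :: "nat \<Rightarrow> 'a ell2" and s :: "nat \<Rightarrow> real"
      assume e: "ons {..<n} e" and s: "\<And>k. k < n \<Longrightarrow> (s k)\<^sup>2 \<in> {0..norm (gram x)}"
        and d: "\<And>f. continuous_on {0..norm (gram x)} f \<Longrightarrow>
        fun_calc f (gram (trunc F x)) = diag_calc f {..<n} (\<lambda>k. (s k)\<^sup>2) e"
      show ?thesis unfolding d[OF f] d[OF g] Re_cinner_diag_calc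
        by (intro add_mono sum_mono mult_right_mono le s) (use bessel[OF e] in auto)
    qed
  qed
qed

lemma fun_calc_mult:
  assumes x: "x \<in> bounded_ops" and f: "continuous_on {0..norm (gram x)} f"
    and g: "continuous_on {0..norm (gram x)} g"
  shows "fun_calc f (gram x) o\<^sub>L fun_calc g (gram x) = fun_calc (\<lambda>t. f t * g t) (gram x)"
proof (rule slim_unique)
  have fg: "continuous_on {0..norm (gram x)} (\<lambda>t. f t * g t)" by (intro continuous_intros f g)
  show "slim (\<lambda>F. fun_calc f (gram (trunc F x)) o\<^sub>L fun_calc g (gram (trunc F x)))
      (fun_calc f (gram x) o\<^sub>L fun_calc g (gram x))"
    by (intro slim_compose slim_fun_calc x f g)
  have "fun_calc (\<lambda>t. f t * g t) (gram (trunc F x)) = fun_calc f (gram (trunc F x)) o\<^sub>L fun_calc g (gram (trunc F x))"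
    if F: "finite F" for F
  proof (rule trunc_calc[OF x F])
    fix n :: nat and e :: "nat \<Rightarrow> 'a ell2" and s :: "nat \<Rightarrow> real"
    assume e: "ons {..<n} e"
      and d: "\<And>f. continuous_on {0..norm (gram x)} f \<Longrightarrow>
      fun_calc f (gram (trunc F x)) = diag_calc f {..<n} (\<lambda>k. (s k)\<^sup>2) e"
    show ?thesis unfolding d[OF f] d[OF g] d[OF fg]
    proof (rule blinfun_eqI, rule cinner_ext)
      fix v w
      have r: "cinner (e k) (blinfun_apply (diag_calc g {..<n} (\<lambda>k. (s k)\<^sup>2) e) v) = of_real (g ((s k)\<^sup>2)) * cinner (e k) v"
        if "k < n" for k
      proof -
        have S1: "(\<Sum>l<n. cinner (e k) (e l) * cinner (e l) v) = (\<Sum>l<n. if k = l then cinner (e k) v else 0)"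
          by (rule sum.cong) (use that in \<open>auto simp: onsD[OF e]\<close>)
        have S2: "(\<Sum>l<n. of_real (g ((s l)\<^sup>2)) * cinner (e k) (e l) * cinner (e l) v)
            = (\<Sum>l<n. if k = l then of_real (g ((s k)\<^sup>2)) * cinner (e k) v else 0)"
          by (rule sum.cong) (use that in \<open>auto simp: onsD[OF e]\<close>)
        show ?thesis unfolding cinner_diag_calc S1 S2 using that by simp
      qed
      have S1: "(\<Sum>k<n. cinner w (e k) * cinner (e k) (blinfun_apply (diag_calc g {..<n} (\<lambda>k. (s k)\<^sup>2) e) v))
          = (\<Sum>k<n. of_real (g ((s k)\<^sup>2)) * cinner w (e k) * cinner (e k) v)"
        by (intro sum.cong refl) (simp add: r)
      have S2: "(\<Sum>k<n. of_real (f ((s k)\<^sup>2)) * cinner w (e k) * cinner (e k) (blinfun_apply (diag_calc g {..<n} (\<lambda>k. (s k)\<^sup>2) e) v))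
          = (\<Sum>k<n. of_real (f ((s k)\<^sup>2) * g ((s k)\<^sup>2)) * cinner w (e k) * cinner (e k) v)"
        by (intro sum.cong refl) (simp add: r)
      show "cinner w (blinfun_apply (diag_calc (\<lambda>t. f t * g t) {..<n} (\<lambda>k. (s k)\<^sup>2) e) v) =
         cinner w (blinfun_apply (diag_calc f {..<n} (\<lambda>k. (s k)\<^sup>2) e o\<^sub>L diag_calc g {..<n} (\<lambda>k. (s k)\<^sup>2) e) v)"
        unfolding blinfun_apply_blinfun_compose
        by (subst (2) cinner_diag_calc) (simp only: S1 S2, simp add: cinner_diag_calc algebra_simps)
    qed
  qed
  then show "slim (\<lambda>F. fun_calc f (gram (trunc F x)) o\<^sub>L fun_calc g (gram (trunc F x)))
      (fun_calc (\<lambda>t. f t * g t) (gram x))"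
    using slim_fun_calc[OF x fg] by (subst slim_cong) (auto simp: sym)
qed

lemma fun_calc_affine:
  assumes x: "x \<in> bounded_ops" and f: "continuous_on {0..norm (gram x)} f"
  shows "fun_calc (\<lambda>t. c + f t) (gram x) = c *\<^sub>R id_blinfun + fun_calc f (gram x)"
proof (rule blinfun_eqI, rule tendsto_unique[OF finsub_neq_bot])
  fix v
  have cf: "continuous_on {0..norm (gram x)} (\<lambda>t. c + f t)" by (intro continuous_intros f)
  show "((\<lambda>F. blinfun_apply (fun_calc (\<lambda>t. c + f t) (gram (trunc F x))) v)
      \<longlongrightarrow> blinfun_apply (fun_calc (\<lambda>t. c + f t) (gram x)) v) finsub"
    by (intro slim_apply[OF slim_fun_calc] x cf tendsto_const)
  have "((\<lambda>F. c *\<^sub>R v + blinfun_apply (fun_calc f (gram (trunc F x))) v)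
      \<longlongrightarrow> c *\<^sub>R v + blinfun_apply (fun_calc f (gram x)) v) finsub"
    by (intro tendsto_intros slim_apply[OF slim_fun_calc] x f)
  then show "((\<lambda>F. blinfun_apply (fun_calc (\<lambda>t. c + f t) (gram (trunc F x))) v)
      \<longlongrightarrow> blinfun_apply (c *\<^sub>R id_blinfun + fun_calc f (gram x)) v) finsub"
    unfolding blinfun.add_left blinfun.scaleR_left blinfun_apply_id_blinfun
  proof (rule Lim_transform_eventually)
    show "\<forall>\<^sub>F F in finsub. c *\<^sub>R v + blinfun_apply (fun_calc f (gram (trunc F x))) v
        = blinfun_apply (fun_calc (\<lambda>t. c + f t) (gram (trunc F x))) v"
    proof (rule eventually_finsubI)
      fix F :: "'a set" assume F: "finite F"
      show "c *\<^sub>R v + blinfun_apply (fun_calc f (gram (trunc F x))) v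
          = blinfun_apply (fun_calc (\<lambda>t. c + f t) (gram (trunc F x))) v"
      proof (rule trunc_calc[OF x F])
        fix n :: nat and e :: "nat \<Rightarrow> 'a ell2" and s :: "nat \<Rightarrow> real"
        assume d: "\<And>f. continuous_on {0..norm (gram x)} f \<Longrightarrow>
          fun_calc f (gram (trunc F x)) = diag_calc f {..<n} (\<lambda>k. (s k)\<^sup>2) e"
        show ?thesis unfolding d[OF f] d[OF cf]
          by (rule cinner_ext) (simp add: cinner_diag_calc algebra_simps sum.distrib sum_distrib_left)
      qed
    qed
  qed
qed

lemma fun_calc_poly:
  assumes "x \<in> bounded_ops"
  shows "fun_calc (poly p) (gram x) = op_poly p (gram x)"
  using fun_calc_near[OF assms, of "poly p" p 0] by (simp add: continuous_on_poly)

lemma norm_fun_calc_diff_le: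
  assumes x: "x \<in> bounded_ops" and f: "continuous_on {0..norm (gram x)} f"
    and g: "continuous_on {0..norm (gram x)} g"
    and le: "\<And>t. t \<in> {0..norm (gram x)} \<Longrightarrow> \<bar>f t - g t\<bar> \<le> e"
  shows "norm (fun_calc f (gram x) - fun_calc g (gram x)) \<le> e"
proof (rule field_le_epsilon)
  fix d :: real assume d: "0 < d"
  then have "0 < d / 2" by simp
  then obtain p where p: "\<And>t. t \<in> {0..norm (gram x)} \<Longrightarrow> \<bar>g t - poly p t\<bar> < d / 2"
    by (rule poly_approx[OF g]) (rule that; simp)
  have "norm (fun_calc f (gram x) - op_poly p (gram x)) \<le> e + d / 2"
  proof (rule fun_calc_near[OF x f])
    fix t assume t: "t \<in> {0..norm (gram x)}"
    show "\<bar>f t - poly p t\<bar> \<le> e + d / 2" using le[OF t] p[OF t] by linarith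
  qed
  moreover have "norm (fun_calc g (gram x) - op_poly p (gram x)) \<le> d / 2"
    by (rule fun_calc_near[OF x g]) (use p in \<open>auto intro: less_imp_le\<close>)
  ultimately show "norm (fun_calc f (gram x) - fun_calc g (gram x)) \<le> e + d"
    using norm_triangle_ineq4[of "fun_calc f (gram x) - op_poly p (gram x)" "fun_calc g (gram x) - op_poly p (gram x)"]
    by simp
qed

text \<open>Computing \<open>|x|\<^sup>p\<close> applies \<open>fun_calc\<close> to
  \<open>op_abs x\<close>, itself a value of \<open>fun_calc\<close>. Polynomials of the square root
  are rewritten as functions of \<open>gram x\<close>, and the defining property of the outer
  \<open>fun_calc\<close> is then verified directly.\<close>

lemma fun_calc_sqrt:
  assumes x: "x \<in> bounded_ops" and f: "continuous_on {0..} f"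
  shows "fun_calc f (fun_calc sqrt (gram x)) = fun_calc (\<lambda>t. f (sqrt t)) (gram x)"
proof -
  let ?I = "{0..norm (gram x)}"
  define b where "b = fun_calc sqrt (gram x)"
  have cs: "continuous_on ?I sqrt" by (intro continuous_intros)
  have cp: "continuous_on ?I (\<lambda>t. poly p (sqrt t))" for p by (intro continuous_intros)
  have cf: "continuous_on ?I (\<lambda>t. f (sqrt t))"
    by (rule continuous_on_compose2[OF f cs]) auto
  have poly_b: "op_poly p b = fun_calc (\<lambda>t. poly p (sqrt t)) (gram x)" for p
  proof (induction p)
    case 0
    have "poly (0 :: real poly) = (\<lambda>_. 0)" by (simp add: fun_eq_iff)
    then show ?case using fun_calc_poly[OF x, of 0] by simp
  next
    case (pCons c p)
    have "op_poly (pCons c p) b = c *\<^sub>R id_blinfun + (fun_calc sqrt (gram x) o\<^sub>L fun_calc (\<lambda>t. poly p (sqrt t)) (gram x))"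
      by (simp only: op_poly_pCons pCons.IH) (simp only: b_def)
    also have "\<dots> = fun_calc (\<lambda>t. c + sqrt t * poly p (sqrt t)) (gram x)"
      unfolding fun_calc_mult[OF x cs cp] by (intro fun_calc_affine[symmetric] x continuous_intros)
    finally show ?case by simp
  qed
  \<comment> \<open>Since \<open>b\<close> squares to \<open>gram x\<close>, its norm is at least
    the root of \<open>norm (gram x)\<close>. Hence the roots of all points of the interval lie
    where the approximation of \<open>f\<close> is uniform.\<close>
  have "b o\<^sub>L b = fun_calc (\<lambda>t. sqrt t * sqrt t) (gram x)"
    unfolding b_def by (rule fun_calc_mult[OF x cs cs])
  also have "norm (fun_calc (\<lambda>t. sqrt t * sqrt t) (gram x) - op_poly [:0, 1:] (gram x)) \<le> 0"
    by (rule fun_calc_near[OF x]) (auto intro!: continuous_intros)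
  then have "fun_calc (\<lambda>t. sqrt t * sqrt t) (gram x) = gram x"
    by (simp add: op_poly_pCons)
  finally have "norm (gram x) \<le> (norm b)\<^sup>2"
    using norm_blinfun_compose[of b b] by (simp add: power2_eq_square)
  then have rng: "sqrt t \<in> {0..norm b}" if "t \<in> ?I" for t
    using that by (auto intro!: real_le_lsqrt)
  have lim: "(\<lambda>n. op_poly (Q n) b) \<longlonglongrightarrow> fun_calc (\<lambda>t. f (sqrt t)) (gram x)"
    if Q: "uniform_limit {0..norm b} (\<lambda>n. poly (Q n)) f sequentially" for Q
  proof (rule LIMSEQ_I)
    fix e :: real assume e: "0 < e"
    then have "0 < e / 2" by simp
    from uniform_limitD[OF Q this]
    obtain N where N: "\<forall>n\<ge>N. \<forall>t\<in>{0..norm b}. dist (poly (Q n) t) (f t) < e / 2"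
      unfolding eventually_sequentially by blast
    have "norm (op_poly (Q n) b - fun_calc (\<lambda>t. f (sqrt t)) (gram x)) < e" if "n \<ge> N" for n
    proof -
      have "norm (fun_calc (\<lambda>t. poly (Q n) (sqrt t)) (gram x) - fun_calc (\<lambda>t. f (sqrt t)) (gram x)) \<le> e / 2"
      proof (rule norm_fun_calc_diff_le[OF x cp cf])
        fix t assume "t \<in> ?I"
        then have "dist (poly (Q n) (sqrt t)) (f (sqrt t)) < e / 2" using N that rng by blast
        then show "\<bar>poly (Q n) (sqrt t) - f (sqrt t)\<bar> \<le> e / 2" by (simp add: dist_real_def)
      qed
      then show ?thesis using e by (simp add: poly_b)
    qed
    then show "\<exists>no. \<forall>n\<ge>no. norm (op_poly (Q n) b - fun_calc (\<lambda>t. f (sqrt t)) (gram x)) < e" by blast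
  qed
  have "continuous_on {0..norm b} f" by (rule continuous_on_subset[OF f]) auto
  then obtain P where P: "uniform_limit {0..norm b} (\<lambda>n. poly (P n)) f sequentially"
    using poly_approx_seq by blast
  show ?thesis unfolding b_def[symmetric]
    unfolding fun_calc_def[of f b]
  proof (rule the_equality)
    fix c assume "\<forall>Q. uniform_limit {0..norm b} (\<lambda>n. poly (Q n)) f sequentially \<longrightarrow> (\<lambda>n. op_poly (Q n) b) \<longlonglongrightarrow> c"
    then show "c = fun_calc (\<lambda>t. f (sqrt t)) (gram x)" using P lim LIMSEQ_unique by blast
  qed (use lim in blast)
qed

section \<open>A variational formula for the Schatten norms\<close>

text \<open>Young's inequality; rearranged, it says that the graph of \<open>t powr p\<close> lies
  above its tangent at \<open>c\<close>.\<close>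

lemma powr_tangent:
  fixes p c t :: real
  assumes p: "1 \<le> p" and c: "0 < c" and t: "0 \<le> t"
  shows "t * c powr (p - 1) \<le> t powr p / p + (1 - 1 / p) * c powr p"
proof (cases "t = 0")
  case True
  then show ?thesis using p c by simp
next
  case False
  have "(t powr p) powr (1 / p) * (c powr p) powr (1 - 1 / p) \<le> (1 / p) * t powr p + (1 - 1 / p) * c powr p"
    using p c t False by (intro Youngs_inequality_0) auto
  moreover have "(t powr p) powr (1 / p) = t" using p t by (simp add: powr_powr)
  moreover have "(c powr p) powr (1 - 1 / p) = c powr (p - 1)"
    using p by (simp add: powr_powr right_diff_distrib)
  ultimately show ?thesis by simp
qed

text \<open>Jensen's inequality, from the tangent at the weighted sum. Total mass below 1 does no
  harm, as the missing mass can be placed at 0.\<close>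

lemma powr_sum_le:
  fixes w t :: "'k \<Rightarrow> real"
  assumes p: "1 \<le> p" and K: "finite K" and w: "\<And>k. k \<in> K \<Longrightarrow> 0 \<le> w k" "(\<Sum>k\<in>K. w k) \<le> 1"
    and t: "\<And>k. k \<in> K \<Longrightarrow> 0 \<le> t k"
  shows "(\<Sum>k\<in>K. w k * t k) powr p \<le> (\<Sum>k\<in>K. w k * t k powr p)"
proof -
  define c where "c = (\<Sum>k\<in>K. w k * t k)"
  have c0: "0 \<le> c" unfolding c_def by (intro sum_nonneg mult_nonneg_nonneg w t)
  show ?thesis
  proof (cases "c = 0")
    case True
    then show ?thesis unfolding c_def[symmetric] by (auto intro!: sum_nonneg mult_nonneg_nonneg w)
  next
    case False
    with c0 have c: "0 < c" by simp
    have "c powr p = c * c powr (p - 1)" using c powr_add[of c 1 "p - 1"] by simp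
    also have "\<dots> = (\<Sum>k\<in>K. w k * (t k * c powr (p - 1)))"
      unfolding c_def by (simp add: sum_distrib_right mult.assoc)
    also have "\<dots> \<le> (\<Sum>k\<in>K. w k * (t k powr p / p + (1 - 1 / p) * c powr p))"
      by (intro sum_mono mult_left_mono powr_tangent p c w t)
    also have "\<dots> = (\<Sum>k\<in>K. w k * t k powr p) / p + (\<Sum>k\<in>K. w k) * ((1 - 1 / p) * c powr p)"
      by (simp add: distrib_left sum.distrib sum_distrib_right sum_divide_distrib)
    also have "\<dots> \<le> (\<Sum>k\<in>K. w k * t k powr p) / p + 1 * ((1 - 1 / p) * c powr p)"
      using p by (intro add_left_mono mult_right_mono w mult_nonneg_nonneg) auto
    finally have "c powr p / p \<le> (\<Sum>k\<in>K. w k * t k powr p) / p" by (simp add: algebra_simps)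
    then show ?thesis using p by (simp add: c_def divide_le_cancel)
  qed
qed

text \<open>Each competitor is continuous under strong convergence, so this supremum is lower
  semicontinuous; the value in \<open>ennreal\<close> is infinite exactly when the competitors are
  unbounded.\<close>

definition sing_sum :: "real \<Rightarrow> 'i oper \<Rightarrow> ennreal" where
  "sing_sum p x = (SUP (n, u, v) \<in> {(n :: nat, u, v). ons {..<n} u \<and> ons {..<n} v}.
      ennreal (\<Sum>k<n. cmod (cinner (u k) (blinfun_apply x (v k))) powr p))"

lemma sing_sum_upper_nat:
  "ons {..<n :: nat} u \<Longrightarrow> ons {..<n} v \<Longrightarrow>
    ennreal (\<Sum>k<n. cmod (cinner (u k) (blinfun_apply x (v k))) powr p) \<le> sing_sum p x"
  unfolding sing_sum_def by (rule SUP_upper2[of "(n, u, v)"]) auto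

lemma sing_sum_least:
  assumes "\<And>n u v. ons {..<n::nat} u \<Longrightarrow> ons {..<n} v \<Longrightarrow>
    ennreal (\<Sum>k<n. cmod (cinner (u k) (blinfun_apply x (v k))) powr p) \<le> B"
  shows "sing_sum p x \<le> B"
  unfolding sing_sum_def by (rule SUP_least) (use assms in auto)

lemma op_trace_altdef:
  "op_trace a = (SUP J\<in>{J. finite J}. \<Sum>j\<in>J. ennreal (Re (cinner (ket j) (blinfun_apply a (ket j)))))"
  unfolding op_trace_def by (subst nonneg_infsum_complete) simp_all

lemma op_trace_upper:
  assumes "finite J" "\<And>j. j \<in> J \<Longrightarrow> 0 \<le> Re (cinner (ket j) (blinfun_apply a (ket j)))"
  shows "ennreal (\<Sum>j\<in>J. Re (cinner (ket j) (blinfun_apply a (ket j)))) \<le> op_trace a"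
proof -
  have "ennreal (\<Sum>j\<in>J. Re (cinner (ket j) (blinfun_apply a (ket j))))
      = (\<Sum>j\<in>J. ennreal (Re (cinner (ket j) (blinfun_apply a (ket j)))))"
    by (rule sum_ennreal[symmetric]) (rule assms(2))
  also have "\<dots> \<le> op_trace a"
    unfolding op_trace_altdef by (rule SUP_upper) (use assms(1) in simp)
  finally show ?thesis .
qed

lemma op_trace_least:
  assumes "\<And>J. finite J \<Longrightarrow> (\<Sum>j\<in>J. ennreal (Re (cinner (ket j) (blinfun_apply a (ket j))))) \<le> B"
  shows "op_trace a \<le> B"
  unfolding op_trace_altdef by (rule SUP_least) (use assms in blast)

lemma op_trace_mono:
  assumes "\<And>j. Re (cinner (ket j) (blinfun_apply a (ket j))) \<le> Re (cinner (ket j) (blinfun_apply b (ket j)))"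
  shows "op_trace a \<le> op_trace b"
  unfolding op_trace_def by (intro infsum_mono nonneg_summable_on_complete ennreal_leI assms zero_le)

text \<open>Combines the invariance of the trace under a change of basis with the equality of the
  traces of an operator times its adjoint in either order: both come from exchanging a double sum of
  squared coefficients, here with Bessel because \<open>w\<close> may be incomplete.\<close>

lemma sum_norm_adj_le_trace:
  assumes b: "b \<in> bounded_ops" and w: "ons K w" "finite K"
  shows "ennreal (\<Sum>k\<in>K. (norm (blinfun_apply (op_adj b) (w k)))\<^sup>2) \<le> op_trace (gram b)"
proof (rule tendsto_upperbound)
  let ?y = "\<lambda>k. blinfun_apply (op_adj b) (w k)"
  have "((\<lambda>J. \<Sum>j\<in>J. (cmod (coord v j))\<^sup>2) \<longlongrightarrow> (norm v)\<^sup>2) finsub" for v :: "'a ell2"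
    using has_sum_infsum[OF summable_coord[of v UNIV]] unfolding has_sum_def norm_ell2_square .
  then show "((\<lambda>J. ennreal (\<Sum>k\<in>K. \<Sum>j\<in>J. (cmod (coord (?y k) j))\<^sup>2))
      \<longlongrightarrow> ennreal (\<Sum>k\<in>K. (norm (?y k))\<^sup>2)) finsub"
    by (intro tendsto_ennrealI tendsto_sum)
  show "\<forall>\<^sub>F J in finsub. ennreal (\<Sum>k\<in>K. \<Sum>j\<in>J. (cmod (coord (?y k) j))\<^sup>2) \<le> op_trace (gram b)"
    using eventually_finsub[OF finite.emptyI]
  proof (rule eventually_mono)
    fix J :: "'a set" assume "finite J \<and> {} \<subseteq> J"
    then have J: "finite J" by simp
    have nn: "Re (cinner (ket j) (blinfun_apply (gram b) (ket j))) = (norm (blinfun_apply b (ket j)))\<^sup>2" for j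
      unfolding cinner_gram[OF b] cinner_self by simp
    have "(\<Sum>k\<in>K. \<Sum>j\<in>J. (cmod (coord (?y k) j))\<^sup>2) = (\<Sum>j\<in>J. \<Sum>k\<in>K. (cmod (cinner (blinfun_apply b (ket j)) (w k)))\<^sup>2)"
      by (subst sum.swap) (simp add: cinner_op_adj[OF b])
    also have "\<dots> \<le> (\<Sum>j\<in>J. (norm (blinfun_apply b (ket j)))\<^sup>2)"
      by (intro sum_mono bessel' w)
    finally have "ennreal (\<Sum>k\<in>K. \<Sum>j\<in>J. (cmod (coord (?y k) j))\<^sup>2)
        \<le> ennreal (\<Sum>j\<in>J. Re (cinner (ket j) (blinfun_apply (gram b) (ket j))))"
      unfolding nn by (rule ennreal_leI)
    also have "\<dots> \<le> op_trace (gram b)" by (rule op_trace_upper[OF J]) (simp only: nn zero_le_power2)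
    finally show "ennreal (\<Sum>k\<in>K. \<Sum>j\<in>J. (cmod (coord (?y k) j))\<^sup>2) \<le> op_trace (gram b)" .
  qed
qed simp

text \<open>\<open>t \<mapsto> t g(t)\<close> is a minorant of \<open>t\<^sup>p\<^sup>/\<^sup>2\<close> for which \<open>x g(x\<^sup>* x) x\<^sup>*\<close> makes sense even though
  \<open>t\<^sup>p\<^sup>/\<^sup>2\<^sup>-\<^sup>1\<close> may be singular at \<open>0\<close>; it replaces \<open>(x x\<^sup>*)\<^sup>p\<^sup>/\<^sup>2\<close>.\<close>

definition reg :: "real \<Rightarrow> real \<Rightarrow> real \<Rightarrow> real" where
  "reg p \<delta> t = t powr (p / 2) / max t \<delta>"

lemma continuous_on_powr_half: "1 \<le> p \<Longrightarrow> continuous_on {0..} (\<lambda>t::real. t powr (p / 2))"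
  by (intro continuous_on_powr' continuous_intros) auto

lemma continuous_on_reg: "1 \<le> p \<Longrightarrow> 0 < \<delta> \<Longrightarrow> continuous_on {0..} (reg p \<delta>)"
  unfolding reg_def[abs_def]
  by (intro continuous_on_divide continuous_on_powr_half continuous_on_max continuous_intros) auto

lemma reg_nonneg: "0 < \<delta> \<Longrightarrow> 0 \<le> reg p \<delta> t"
  by (simp add: reg_def)

lemma mult_reg_le: "0 < \<delta> \<Longrightarrow> 0 \<le> t \<Longrightarrow> t * reg p \<delta> t \<le> t powr (p / 2)"
  unfolding reg_def by (auto simp: max_def divide_simps mult.commute[of t] intro!: mult_left_mono)

lemma powr_le_mult_reg: "1 \<le> p \<Longrightarrow> 0 < \<delta> \<Longrightarrow> 0 \<le> t \<Longrightarrow> t powr (p / 2) \<le> t * reg p \<delta> t + \<delta> powr (p / 2)"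
proof (cases "\<delta> \<le> t")
  case False
  assume "1 \<le> p" "0 < \<delta>" "0 \<le> t"
  then have "t powr (p / 2) \<le> \<delta> powr (p / 2)" using False by (intro powr_mono2) auto
  moreover have "0 \<le> t * reg p \<delta> t" using \<open>0 < \<delta>\<close> \<open>0 \<le> t\<close> by (simp add: reg_nonneg)
  ultimately show ?thesis by linarith
qed (simp add: reg_def max_def)

text \<open>On a truncation the singular value decomposition and the inequality of arithmetic and
  geometric means bound the coefficient by a sum of singular values with weights
  \<open>(\<alpha> k + \<beta> k) / 2\<close> of total mass at most 1, to which Jensen applies. The
  two halves are the quadratic forms at \<open>u\<close> and \<open>v\<close>; the last summand pays
  for replacing the power by its minorant on the left side.\<close>

lemma cmod_form_powr_le:
  assumes x: "x \<in> bounded_ops" and p: "1 \<le> p" and \<delta>: "0 < \<delta>" and u: "norm u = 1" and v: "norm v = 1"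
  shows "2 * cmod (cinner u (blinfun_apply x v)) powr p
    \<le> Re (cinner u (blinfun_apply (x o\<^sub>L fun_calc (reg p \<delta>) (gram x) o\<^sub>L op_adj x) u))
      + Re (cinner v (blinfun_apply (fun_calc (\<lambda>t. t powr (p / 2)) (gram x)) v)) + \<delta> powr (p / 2)"
proof (rule tendsto_le[OF finsub_neq_bot])
  have cr: "continuous_on {0..norm (gram x)} (reg p \<delta>)"
    using continuous_on_subset[OF continuous_on_reg[OF p \<delta>]] by auto
  have cp: "continuous_on {0..norm (gram x)} (\<lambda>t. t powr (p / 2))"
    using continuous_on_subset[OF continuous_on_powr_half[OF p]] by auto
  let ?L = "\<lambda>x. 2 * cmod (cinner u (blinfun_apply x v)) powr p"
  let ?R = "\<lambda>x. Re (cinner u (blinfun_apply (x o\<^sub>L fun_calc (reg p \<delta>) (gram x) o\<^sub>L op_adj x) u))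
      + Re (cinner v (blinfun_apply (fun_calc (\<lambda>t. t powr (p / 2)) (gram x)) v)) + \<delta> powr (p / 2)"
  show "((\<lambda>F. ?L (trunc F x)) \<longlongrightarrow> ?L x) finsub"
    using p by (intro tendsto_mult tendsto_const tendsto_powr' tendsto_norm tendsto_cinner slim_apply[OF slim_trunc]) auto
  show "((\<lambda>F. ?R (trunc F x)) \<longlongrightarrow> ?R x) finsub"
    by (intro tendsto_add tendsto_const tendsto_Re tendsto_cinner
        slim_apply[OF slim_compose[OF slim_compose[OF slim_trunc slim_fun_calc[OF x cr]] slim_op_adj_trunc[OF x]]]
        slim_apply[OF slim_fun_calc[OF x cp]])
  show "\<forall>\<^sub>F F in finsub. ?L (trunc F x) \<le> ?R (trunc F x)"
  proof (rule eventually_finsubI)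
    fix F :: "'a set" assume F: "finite F"
    show "?L (trunc F x) \<le> ?R (trunc F x)"
    proof (rule trunc_calc[OF x F])
      fix n :: nat and a b :: "nat \<Rightarrow> 'a ell2" and s :: "nat \<Rightarrow> real"
      assume a: "ons {..<n} a" and b: "ons {..<n} b" and s: "\<And>k. k < n \<Longrightarrow> 0 < s k"
        and tr: "trunc F x = diag_op {..<n} (\<lambda>k. of_real (s k)) a b"
        and d: "\<And>f. continuous_on {0..norm (gram x)} f \<Longrightarrow>
          fun_calc f (gram (trunc F x)) = diag_calc f {..<n} (\<lambda>k. (s k)\<^sup>2) b"
      define \<alpha> where "\<alpha> k = (cmod (cinner (a k) u))\<^sup>2" for k
      define \<beta> where "\<beta> k = (cmod (cinner (b k) v))\<^sup>2" for k
      have A: "(\<Sum>k<n. \<alpha> k) \<le> 1" unfolding \<alpha>_def using bessel[OF a finite_lessThan, of u] u by simp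
      have B: "(\<Sum>k<n. \<beta> k) \<le> 1" unfolding \<beta>_def using bessel[OF b finite_lessThan, of v] v by simp
      have ps: "((s k)\<^sup>2) powr (p / 2) = s k powr p" if "k < n" for k
        using s[OF that] powr_powr[of "s k" 2 "p / 2"] by (simp add: powr_numeral)
      have conj: "cmod (cinner u (a k)) = cmod (cinner (a k) u)" for k
        by (metis cnj_cinner complex_mod_cnj)
      have "cmod (cinner u (blinfun_apply (trunc F x) v)) \<le> (\<Sum>k<n. s k * (cmod (cinner (a k) u) * cmod (cinner (b k) v)))"
        unfolding tr cinner_diag_op using s
        by (intro order_trans[OF norm_sum] sum_mono) (auto simp: norm_mult conj mult.assoc abs_of_pos)
      also have "\<dots> \<le> (\<Sum>k<n. (\<alpha> k + \<beta> k) / 2 * s k)"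
      proof (intro sum_mono)
        fix k assume "k \<in> {..<n}"
        then have "0 \<le> s k" using s[of k] by simp
        moreover have "cmod (cinner (a k) u) * cmod (cinner (b k) v) \<le> (\<alpha> k + \<beta> k) / 2"
          using sum_squares_bound[of "cmod (cinner (a k) u)" "cmod (cinner (b k) v)"] by (simp add: \<alpha>_def \<beta>_def)
        ultimately show "s k * (cmod (cinner (a k) u) * cmod (cinner (b k) v)) \<le> (\<alpha> k + \<beta> k) / 2 * s k"
          using mult_left_mono[of _ "(\<alpha> k + \<beta> k) / 2" "s k"] by (simp only: mult.commute[of "s k"])
      qed
      finally have "cmod (cinner u (blinfun_apply (trunc F x) v)) powr p \<le> (\<Sum>k<n. (\<alpha> k + \<beta> k) / 2 * s k) powr p"
        using p by (intro powr_mono2) auto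
      also have "\<dots> \<le> (\<Sum>k<n. (\<alpha> k + \<beta> k) / 2 * s k powr p)"
      proof (rule powr_sum_le[OF p])
        have "(\<Sum>k<n. (\<alpha> k + \<beta> k) / 2) = ((\<Sum>k<n. \<alpha> k) + (\<Sum>k<n. \<beta> k)) / 2"
          unfolding sum_divide_distrib[symmetric] sum.distrib ..
        then show "(\<Sum>k<n. (\<alpha> k + \<beta> k) / 2) \<le> 1" using A B by simp
      qed (use s in \<open>auto simp: \<alpha>_def \<beta>_def intro: less_imp_le\<close>)
      also have "\<dots> = ((\<Sum>k<n. \<alpha> k * s k powr p) + (\<Sum>k<n. \<beta> k * s k powr p)) / 2"
        by (simp add: sum.distrib[symmetric] distrib_right sum_divide_distrib)
      finally have "?L (trunc F x) \<le> (\<Sum>k<n. \<alpha> k * s k powr p) + (\<Sum>k<n. \<beta> k * s k powr p)" by simp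
      moreover have "(\<Sum>k<n. \<beta> k * s k powr p) = Re (cinner v (blinfun_apply (fun_calc (\<lambda>t. t powr (p / 2)) (gram (trunc F x))) v))"
        unfolding d[OF cp] Re_cinner_diag_calc by (simp add: ps \<beta>_def mult.commute)
      moreover have "(\<Sum>k<n. \<alpha> k * s k powr p) \<le> Re (cinner u (blinfun_apply (trunc F x o\<^sub>L fun_calc (reg p \<delta>) (gram (trunc F x))
          o\<^sub>L op_adj (trunc F x)) u)) + \<delta> powr (p / 2)"
      proof -
        have "trunc F x o\<^sub>L fun_calc (reg p \<delta>) (gram (trunc F x)) o\<^sub>L op_adj (trunc F x)
            = diag_op {..<n} (\<lambda>k. of_real (s k * reg p \<delta> ((s k)\<^sup>2) * s k)) a a"
          unfolding d[OF cr]
          unfolding tr op_adj_diag_op diag_calc_def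
            bounded_bilinear.add_right[OF bounded_bilinear_blinfun_compose]
            bounded_bilinear.diff_right[OF bounded_bilinear_blinfun_compose]
            bounded_bilinear.scaleR_right[OF bounded_bilinear_blinfun_compose] diag_op_compose[OF b finite_lessThan]
          by (simp add: diag_op_compose[OF b finite_lessThan])
        then have "Re (cinner u (blinfun_apply (trunc F x o\<^sub>L fun_calc (reg p \<delta>) (gram (trunc F x)) o\<^sub>L op_adj (trunc F x)) u))
            = (\<Sum>k<n. (s k)\<^sup>2 * reg p \<delta> ((s k)\<^sup>2) * \<alpha> k)"
        proof -
          have "cinner u (a k) * cinner (a k) u = of_real (\<alpha> k)" for k
            unfolding \<alpha>_def complex_norm_square cnj_cinner by (simp add: mult.commute)
          then have "cinner u (blinfun_apply (diag_op {..<n} (\<lambda>k. of_real (s k * reg p \<delta> ((s k)\<^sup>2) * s k)) a a) u)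
              = of_real (\<Sum>k<n. (s k)\<^sup>2 * reg p \<delta> ((s k)\<^sup>2) * \<alpha> k)"
            unfolding cinner_diag_op mult.assoc by (simp add: power2_eq_square mult_ac)
          with \<open>trunc F x o\<^sub>L _ o\<^sub>L _ = _\<close> show ?thesis by (simp only: Re_complex_of_real)
        qed
        moreover have "(\<Sum>k<n. \<alpha> k * s k powr p) \<le> (\<Sum>k<n. (s k)\<^sup>2 * reg p \<delta> ((s k)\<^sup>2) * \<alpha> k + \<alpha> k * \<delta> powr (p / 2))"
        proof (intro sum_mono)
          fix k assume "k \<in> {..<n}"
          then have "s k powr p \<le> (s k)\<^sup>2 * reg p \<delta> ((s k)\<^sup>2) + \<delta> powr (p / 2)"
            using powr_le_mult_reg[OF p \<delta>, of "(s k)\<^sup>2"] ps[of k] by simp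
          then have "\<alpha> k * s k powr p \<le> \<alpha> k * ((s k)\<^sup>2 * reg p \<delta> ((s k)\<^sup>2) + \<delta> powr (p / 2))"
            by (intro mult_left_mono) (auto simp: \<alpha>_def)
          then show "\<alpha> k * s k powr p \<le> (s k)\<^sup>2 * reg p \<delta> ((s k)\<^sup>2) * \<alpha> k + \<alpha> k * \<delta> powr (p / 2)"
            by (simp add: algebra_simps)
        qed
        moreover have "(\<Sum>k<n. \<alpha> k * \<delta> powr (p / 2)) \<le> 1 * \<delta> powr (p / 2)"
          unfolding sum_distrib_right[symmetric] by (intro mult_right_mono A) auto
        ultimately show ?thesis by (simp add: sum.distrib)
      qed
      ultimately show "?L (trunc F x) \<le> ?R (trunc F x)" by linarith
    qed
  qed
qed

text \<open>Summing \<open>cmod_form_powr_le\<close> over \<open>k\<close> leaves two sums of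
  quadratic forms. Each form is \<open>(norm (op_adj b w))\<^sup>2\<close> for some \<open>b\<close>
  such that \<open>gram b\<close> is at most the \<open>p/2\<close>-th power of
  \<open>gram x\<close>, so \<open>sum_norm_adj_le_trace\<close> bounds both by the trace.\<close>

lemma sing_sum_le_trace:
  assumes x: "x \<in> bounded_ops" and p: "1 \<le> p"
  shows "sing_sum p x \<le> op_trace (fun_calc (\<lambda>t. t powr (p / 2)) (gram x))"
proof (rule sing_sum_least)
  fix n :: nat and u v :: "nat \<Rightarrow> 'a ell2"
  assume u: "ons {..<n} u" and v: "ons {..<n} v"
  let ?f = "\<lambda>t::real. t powr (p / 2)" and ?I = "{0..norm (gram x)}"
  let ?T = "op_trace (fun_calc ?f (gram x))"
  let ?S = "\<Sum>k<n. cmod (cinner (u k) (blinfun_apply x (v k))) powr p"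
  have cf: "continuous_on ?I ?f"
    using continuous_on_subset[OF continuous_on_powr_half[OF p]] by auto
  show "ennreal ?S \<le> ?T"
  proof (cases "?T = \<infinity>")
    case False
    then obtain T where T: "?T = ennreal T" "0 \<le> T" by (metis ennreal_cases infinity_ennreal_def)
    have V: "(\<Sum>k<n. Re (cinner (v k) (blinfun_apply (fun_calc ?f (gram x)) (v k)))) \<le> T"
    proof -
      \<comment> \<open>The \<open>p/4\<close>-th power of \<open>gram x\<close>; being
        self-adjoint, it has the required \<open>p/2\<close>-th power as its square.\<close>
      define b where "b = fun_calc (\<lambda>t. sqrt (?f t)) (gram x)"
      have c: "continuous_on ?I (\<lambda>t. sqrt (?f t))" by (intro continuous_intros cf)
      have b: "b \<in> bounded_ops" unfolding b_def by (rule fun_calc_bounded_ops[OF x c])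
      have adj: "op_adj b = b" by (rule op_adj_eqI) (simp add: b_def fun_calc_self_adjoint[OF x c])
      have g: "gram b = fun_calc ?f (gram x)"
      proof -
        have "gram b = b o\<^sub>L b" by (simp add: gram_def adj)
        then show ?thesis by (simp add: b_def fun_calc_mult[OF x c c])
      qed
      have "Re (cinner w (blinfun_apply (fun_calc ?f (gram x)) w)) = (norm (blinfun_apply (op_adj b) w))\<^sup>2" for w
        unfolding g[symmetric] cinner_gram[OF b] adj cinner_self by simp
      then show ?thesis
        using sum_norm_adj_le_trace[OF b v finite_lessThan] T unfolding g by (simp add: sum_nonneg)
    qed
    have U: "(\<Sum>k<n. Re (cinner (u k) (blinfun_apply (x o\<^sub>L fun_calc (reg p \<delta>) (gram x) o\<^sub>L op_adj x) (u k)))) \<le> T"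
      if \<delta>: "0 < \<delta>" for \<delta>
    proof -
      have cr: "continuous_on ?I (reg p \<delta>)"
        using continuous_on_subset[OF continuous_on_reg[OF p \<delta>]] by auto
      then have c: "continuous_on ?I (\<lambda>t. sqrt (reg p \<delta> t))" by (intro continuous_intros)
      define h where "h = fun_calc (\<lambda>t. sqrt (reg p \<delta> t)) (gram x)"
      \<comment> \<open>In one order \<open>b\<close> and its adjoint give the left operator
        \<open>x o\<^sub>L fun_calc (reg p \<delta>) (gram x) o\<^sub>L op_adj x\<close>, in the
        other the function \<open>t * reg p \<delta> t\<close> of \<open>gram x\<close>. This
        transfers the left side to the right without a polar decomposition.\<close>
      define b where "b = x o\<^sub>L h"
      have h: "h \<in> bounded_ops" unfolding h_def by (rule fun_calc_bounded_ops[OF x c])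
      have b: "b \<in> bounded_ops" unfolding b_def by (intro bounded_ops_compose x h)
      have hs: "cinner (blinfun_apply h f) g = cinner f (blinfun_apply h g)" for f g
        by (simp add: h_def fun_calc_self_adjoint[OF x c])
      have hh: "h o\<^sub>L h = fun_calc (reg p \<delta>) (gram x)"
        unfolding h_def fun_calc_mult[OF x c c] using reg_nonneg[OF \<delta>, of p] by (simp add: abs_of_nonneg)
      have adj: "op_adj b = h o\<^sub>L op_adj x"
        by (rule op_adj_eqI) (simp add: b_def cinner_op_adj[OF x] hs)
      have gx: "gram x = fun_calc (\<lambda>t. t) (gram x)"
      proof -
        have "poly [:0, 1::real:] = (\<lambda>t. t)" by (simp add: fun_eq_iff)
        then show ?thesis using fun_calc_poly[OF x, of "[:0, 1:]"] by (simp add: op_poly_pCons)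
      qed
      have "gram b = h o\<^sub>L (gram x o\<^sub>L h)"
        by (rule blinfun_eqI) (simp add: gram_def adj, simp add: b_def)
      also have "\<dots> = fun_calc (\<lambda>t. sqrt (reg p \<delta> t) * (t * sqrt (reg p \<delta> t))) (gram x)"
        unfolding h_def by (subst (2) gx) (simp only: fun_calc_mult[OF x] c continuous_intros)
      also have "(\<lambda>t. sqrt (reg p \<delta> t) * (t * sqrt (reg p \<delta> t))) = (\<lambda>t. t * reg p \<delta> t)"
        using reg_nonneg[OF \<delta>, of p] by (simp add: fun_eq_iff mult_ac)
      finally have g: "gram b = fun_calc (\<lambda>t. t * reg p \<delta> t) (gram x)" .
      have "op_trace (gram b) \<le> ?T"
        unfolding g
        by (rule op_trace_mono, rule fun_calc_mono[OF x _ cf])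
          (auto intro!: continuous_intros cr mult_reg_le \<delta>)
      moreover have "Re (cinner w (blinfun_apply (x o\<^sub>L fun_calc (reg p \<delta>) (gram x) o\<^sub>L op_adj x) w))
          = (norm (blinfun_apply (op_adj b) w))\<^sup>2" for w
      proof -
        have "cinner w (blinfun_apply (x o\<^sub>L fun_calc (reg p \<delta>) (gram x) o\<^sub>L op_adj x) w)
            = cnj (cinner (blinfun_apply x (blinfun_apply h (blinfun_apply h (blinfun_apply (op_adj x) w)))) w)"
          by (simp add: hh[symmetric] cnj_cinner)
        also have "\<dots> = cnj (cinner (blinfun_apply (op_adj b) w) (blinfun_apply (op_adj b) w))"
          by (simp add: cinner_op_adj[OF x] hs adj)
        finally show ?thesis by (simp add: cinner_self)
      qed
      ultimately show ?thesis
        using sum_norm_adj_le_trace[OF b u finite_lessThan] T by (simp add: sum_nonneg) (metis (no_types, lifting) ennreal_le_iff order_trans)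
    qed
    have key: "2 * ?S \<le> 2 * T + real n * \<delta> powr (p / 2)" if \<delta>: "0 < \<delta>" for \<delta>
    proof -
      have "2 * ?S \<le> (\<Sum>k<n. Re (cinner (u k) (blinfun_apply (x o\<^sub>L fun_calc (reg p \<delta>) (gram x) o\<^sub>L op_adj x) (u k)))
          + Re (cinner (v k) (blinfun_apply (fun_calc ?f (gram x)) (v k))) + \<delta> powr (p / 2))"
        unfolding sum_distrib_left
        by (intro sum_mono cmod_form_powr_le x p \<delta>) (use ons_norm[OF u] ons_norm[OF v] in auto)
      also have "\<dots> \<le> T + T + real n * \<delta> powr (p / 2)"
        unfolding sum.distrib using U[OF \<delta>] V by simp
      finally show ?thesis by simp
    qed
    \<comment> \<open>The number \<open>n\<close> of vectors is fixed, so the accumulated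
      regularisation error vanishes as \<open>\<delta>\<close> tends to 0.\<close>
    have "2 * ?S \<le> 2 * T"
    proof (rule tendsto_lowerbound)
      have "((\<lambda>\<delta>. 2 * T + real n * \<delta> powr (p / 2)) \<longlongrightarrow> 2 * T + real n * 0 powr (p / 2)) (at_right 0)"
        using p by (intro tendsto_intros tendsto_powr') (auto simp: eventually_at_right_less intro!: eventually_mono[OF eventually_at_right_less])
      then show "((\<lambda>\<delta>. 2 * T + real n * \<delta> powr (p / 2)) \<longlongrightarrow> 2 * T) (at_right 0)" by simp
      show "\<forall>\<^sub>F \<delta> in at_right 0. 2 * ?S \<le> 2 * T + real n * \<delta> powr (p / 2)"
        using eventually_at_right_less by (rule eventually_mono) (rule key)
    qed simp
    then show ?thesis unfolding T(1) by (intro ennreal_leI) simp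
  qed simp
qed

text \<open>For a truncation the trace is at most the sum of the powers of its singular values,
  which are coefficients of \<open>x\<close> by \<open>singular_value_eq\<close>; then pass to the
  strong limit.\<close>

lemma trace_le_sing_sum:
  assumes x: "x \<in> bounded_ops" and p: "1 \<le> p"
  shows "op_trace (fun_calc (\<lambda>t. t powr (p / 2)) (gram x)) \<le> sing_sum p x"
proof (rule op_trace_least)
  fix J :: "'a set" assume J: "finite J"
  let ?f = "\<lambda>t::real. t powr (p / 2)"
  have cf: "continuous_on {0..norm (gram x)} ?f"
    using continuous_on_subset[OF continuous_on_powr_half[OF p]] by auto
  \<comment> \<open>Nonnegative diagonal entries ensure that \<open>ennreal\<close> truncates
    nothing when it is moved out of the sum.\<close>
  have nn: "0 \<le> Re (cinner w (blinfun_apply (fun_calc ?f (gram x)) w))" for w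
  proof -
    have "Re (cinner w (blinfun_apply (fun_calc (poly 0) (gram x)) w)) \<le> Re (cinner w (blinfun_apply (fun_calc ?f (gram x)) w))"
      by (rule fun_calc_mono[OF x _ cf]) (auto intro!: continuous_intros)
    then show ?thesis by (simp only: fun_calc_poly[OF x] op_poly_0) simp
  qed
  show "(\<Sum>j\<in>J. ennreal (Re (cinner (ket j) (blinfun_apply (fun_calc ?f (gram x)) (ket j))))) \<le> sing_sum p x"
    unfolding sum_ennreal[OF nn]
  proof (rule tendsto_upperbound)
    show "((\<lambda>F. ennreal (\<Sum>j\<in>J. Re (cinner (ket j) (blinfun_apply (fun_calc ?f (gram (trunc F x))) (ket j)))))
      \<longlongrightarrow> ennreal (\<Sum>j\<in>J. Re (cinner (ket j) (blinfun_apply (fun_calc ?f (gram x)) (ket j))))) finsub"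
      by (intro tendsto_ennrealI tendsto_sum tendsto_Re tendsto_cinner tendsto_const slim_apply[OF slim_fun_calc[OF x cf]])
    show "\<forall>\<^sub>F F in finsub. ennreal (\<Sum>j\<in>J. Re (cinner (ket j) (blinfun_apply (fun_calc ?f (gram (trunc F x))) (ket j)))) \<le> sing_sum p x"
    proof (rule eventually_finsubI)
      fix F :: "'a set" assume F: "finite F"
      show "ennreal (\<Sum>j\<in>J. Re (cinner (ket j) (blinfun_apply (fun_calc ?f (gram (trunc F x))) (ket j)))) \<le> sing_sum p x"
      proof (rule trunc_calc[OF x F])
        fix n :: nat and a b :: "nat \<Rightarrow> 'a ell2" and s :: "nat \<Rightarrow> real"
        assume a: "ons {..<n} a" and b: "ons {..<n} b" and s: "\<And>k. k < n \<Longrightarrow> 0 < s k"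
          and sv: "\<And>k. k < n \<Longrightarrow> cinner (a k) (blinfun_apply x (b k)) = of_real (s k)"
          and d: "\<And>f. continuous_on {0..norm (gram x)} f \<Longrightarrow>
            fun_calc f (gram (trunc F x)) = diag_calc f {..<n} (\<lambda>k. (s k)\<^sup>2) b"
        have ps: "((s k)\<^sup>2) powr (p / 2) = s k powr p" if "k < n" for k
          using s[OF that] powr_powr[of "s k" 2 "p / 2"] by (simp add: powr_numeral)
        have "(\<Sum>j\<in>J. Re (cinner (ket j) (blinfun_apply (fun_calc ?f (gram (trunc F x))) (ket j))))
            = (\<Sum>j\<in>J. \<Sum>k<n. s k powr p * (cmod (coord (b k) j))\<^sup>2)"
          unfolding d[OF cf] Re_cinner_diag_calc by (simp add: ps)
        also have "\<dots> = (\<Sum>k<n. s k powr p * (\<Sum>j\<in>J. (cmod (coord (b k) j))\<^sup>2))"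
          by (subst sum.swap) (simp add: sum_distrib_left)
        also have "\<dots> \<le> (\<Sum>k<n. s k powr p * 1)"
          using sum_coord_le_norm[OF J] ons_norm[OF b]
          by (intro sum_mono mult_left_mono) (metis lessThan_iff one_power2, simp)
        also have "\<dots> = (\<Sum>k<n. cmod (cinner (a k) (blinfun_apply x (b k))) powr p)"
          by (intro sum.cong refl) (use s in \<open>simp add: sv abs_of_pos\<close>)
        finally have "ennreal (\<Sum>j\<in>J. Re (cinner (ket j) (blinfun_apply (fun_calc ?f (gram (trunc F x))) (ket j))))
            \<le> ennreal (\<Sum>k<n. cmod (cinner (a k) (blinfun_apply x (b k))) powr p)" by (rule ennreal_leI)
        also have "\<dots> \<le> sing_sum p x" by (rule sing_sum_upper_nat[OF a b])
        finally show ?thesis .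
      qed
    qed
  qed simp
qed

text \<open>From here on finite Schatten norms are handled through \<open>sing_sum\<close>, and the
  functional calculus does not occur again.\<close>

theorem trace_abs_powr_eq:
  assumes x: "x \<in> bounded_ops" and p: "1 \<le> enn2real p"
  shows "trace_abs_powr p x = sing_sum (enn2real p) x"
proof -
  have "continuous_on {0..} (\<lambda>t::real. t powr enn2real p)"
    using p by (intro continuous_on_powr' continuous_intros) auto
  then have "fun_calc (\<lambda>t. t powr enn2real p) (op_abs x) = fun_calc (\<lambda>t. sqrt t powr enn2real p) (gram x)"
    unfolding op_abs_def gram_def[symmetric] by (rule fun_calc_sqrt[OF x])
  also have "\<dots> = fun_calc (\<lambda>t. t powr (enn2real p / 2)) (gram x)"
  proof -
    have c1: "continuous_on {0..norm (gram x)} (\<lambda>t. sqrt t powr enn2real p)"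
      using p by (intro continuous_on_powr' continuous_intros) auto
    have c2: "continuous_on {0..norm (gram x)} (\<lambda>t. t powr (enn2real p / 2))"
      using continuous_on_subset[OF continuous_on_powr_half[OF p]] by auto
    \<comment> \<open>The two functions are compared on the interval only, as they may differ at
      negative arguments.\<close>
    have "norm (fun_calc (\<lambda>t. sqrt t powr enn2real p) (gram x) - fun_calc (\<lambda>t. t powr (enn2real p / 2)) (gram x)) \<le> 0"
      by (rule norm_fun_calc_diff_le[OF x c1 c2]) (simp add: powr_half_sqrt[symmetric] powr_powr)
    then show ?thesis by simp
  qed
  finally show ?thesis
    unfolding trace_abs_powr_def using trace_le_sing_sum[OF x p] sing_sum_le_trace[OF x p] by simp
qed

section \<open>Schatten classes in terms of \<open>sing_sum\<close>\<close>

lemma one_le_enn2real: "1 \<le> p \<Longrightarrow> p \<noteq> \<infinity> \<Longrightarrow> 1 \<le> enn2real p"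
  by (metis enn2real_mono enn2real_1 infinity_ennreal_def top.not_eq_extremum)

lemma schatten_class_iff:
  assumes "1 \<le> p" "p \<noteq> \<infinity>"
  shows "x \<in> schatten_class p \<longleftrightarrow> x \<in> bounded_ops \<and> sing_sum (enn2real p) x < \<infinity>"
proof -
  have "1 \<le> enn2real p" using assms by (intro one_le_enn2real) auto
  then show ?thesis using assms(2) by (auto simp: schatten_class_def trace_abs_powr_eq)
qed

lemma schatten_norm_eq:
  assumes "1 \<le> p" "p \<noteq> \<infinity>" "x \<in> bounded_ops"
  shows "schatten_norm p x = enn2real (sing_sum (enn2real p) x) powr (1 / enn2real p)"
proof -
  have "1 \<le> enn2real p" using assms by (intro one_le_enn2real) auto
  then show ?thesis using assms(2,3) by (simp add: schatten_norm_def trace_abs_powr_eq)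
qed

text \<open>The weights \<open>w l k\<close> form a doubly substochastic matrix: Bessel and
  Cauchy-Schwarz bound its rows, \<open>bessel_pair\<close> its columns. Jensen along rows and
  summation along columns give the claim.\<close>

lemma sing_sum_diag_op_le:
  fixes f g :: "'k \<Rightarrow> 'i ell2"
  assumes p: "1 \<le> p" and K: "finite K" and f: "ons K f" and g: "ons K g"
  shows "sing_sum p (diag_op K s f g) \<le> ennreal (\<Sum>k\<in>K. cmod (s k) powr p)"
proof (rule sing_sum_least, rule ennreal_leI)
  fix n :: nat and u v :: "nat \<Rightarrow> 'i ell2"
  assume u: "ons {..<n} u" and v: "ons {..<n} v"
  define w where "w l k = cmod (cinner (u l) (f k)) * cmod (cinner (g k) (v l))" for l k
  have w0: "0 \<le> w l k" for l k by (simp add: w_def)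
  have wk: "(\<Sum>k\<in>K. w l k) \<le> 1" if "l < n" for l
  proof -
    have "(\<Sum>k\<in>K. w l k) \<le> norm (u l) * norm (v l)"
      unfolding w_def using bessel'[OF f K] bessel[OF g K] by (intro sum_mult_le_sqrt) auto
    then show ?thesis using that ons_norm[OF u] ons_norm[OF v] by simp
  qed
  have wl: "(\<Sum>l<n. w l k) \<le> 1" if "k \<in> K" for k
    using bessel_pair[OF u v finite_lessThan, of "f k" "g k"] that ons_norm[OF f] ons_norm[OF g]
    by (simp add: w_def)
  have "(\<Sum>l<n. cmod (cinner (u l) (blinfun_apply (diag_op K s f g) (v l))) powr p)
      \<le> (\<Sum>l<n. \<Sum>k\<in>K. w l k * cmod (s k) powr p)"
  proof (intro sum_mono)
    fix l assume l: "l \<in> {..<n}"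
    have "cmod (cinner (u l) (blinfun_apply (diag_op K s f g) (v l))) \<le> (\<Sum>k\<in>K. w l k * cmod (s k))"
      unfolding cinner_diag_op by (intro order_trans[OF norm_sum] sum_mono) (simp add: w_def norm_mult mult_ac)
    then have "cmod (cinner (u l) (blinfun_apply (diag_op K s f g) (v l))) powr p \<le> (\<Sum>k\<in>K. w l k * cmod (s k)) powr p"
      using p by (intro powr_mono2) auto
    also have "\<dots> \<le> (\<Sum>k\<in>K. w l k * cmod (s k) powr p)"
      using wk l by (intro powr_sum_le p K w0) auto
    finally show "cmod (cinner (u l) (blinfun_apply (diag_op K s f g) (v l))) powr p \<le> (\<Sum>k\<in>K. w l k * cmod (s k) powr p)" .
  qed
  also have "\<dots> = (\<Sum>k\<in>K. (\<Sum>l<n. w l k) * cmod (s k) powr p)"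
    by (subst sum.swap) (simp add: sum_distrib_right)
  also have "\<dots> \<le> (\<Sum>k\<in>K. 1 * cmod (s k) powr p)"
    by (intro sum_mono mult_right_mono wl) auto
  finally show "(\<Sum>l<n. cmod (cinner (u l) (blinfun_apply (diag_op K s f g) (v l))) powr p) \<le> (\<Sum>k\<in>K. cmod (s k) powr p)"
    by simp
qed

lemma norm_diag_op_le:
  assumes K: "finite K" and f: "ons K f" and g: "ons K g" and B: "\<And>k. k \<in> K \<Longrightarrow> cmod (s k) \<le> B" "0 \<le> B"
  shows "norm (diag_op K s f g) \<le> B"
proof (rule norm_blinfun_bound[OF B(2)])
  fix w
  have "(norm (blinfun_apply (diag_op K s f g) w))\<^sup>2 = (\<Sum>k\<in>K. (cmod (s k))\<^sup>2 * (cmod (cinner (g k) w))\<^sup>2)"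
    unfolding diag_op_apply pythagoras[OF f K] by (simp add: norm_mult power_mult_distrib)
  also have "\<dots> \<le> (\<Sum>k\<in>K. B\<^sup>2 * (cmod (cinner (g k) w))\<^sup>2)"
    by (intro sum_mono mult_right_mono power_mono B) auto
  also have "\<dots> \<le> B\<^sup>2 * (norm w)\<^sup>2"
    unfolding sum_distrib_left[symmetric] by (intro mult_left_mono bessel g K) auto
  finally have "(norm (blinfun_apply (diag_op K s f g) w))\<^sup>2 \<le> (B * norm w)\<^sup>2"
    by (simp only: power_mult_distrib)
  then show "norm (blinfun_apply (diag_op K s f g) w) \<le> B * norm w"
    by (rule power2_le_imp_le) (use B in simp)
qed

lemma finite_opsE:
  assumes "x \<in> finite_ops"
  obtains F where "finite F" "x \<in> bounded_ops" "\<And>i j. entry x i j \<noteq> 0 \<Longrightarrow> i \<in> F \<and> j \<in> F" "trunc F x = x"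
proof -
  obtain F where F: "finite F" "x \<in> bounded_ops" "\<forall>i j. entry x i j \<noteq> 0 \<longrightarrow> i \<in> F \<and> j \<in> F"
    using assms unfolding finite_ops_iff by blast
  then have "trunc F x = x" by (intro trunc_eq) auto
  with F show thesis by (intro that[of F]) auto
qed

lemma sing_sum_finite_ops:
  assumes "x \<in> finite_ops" "1 \<le> p"
  shows "sing_sum p x < \<infinity>"
proof (rule finite_opsE[OF assms(1)])
  fix F assume F: "finite F" and x: "x \<in> bounded_ops" and t: "trunc F x = x"
  show ?thesis
  proof (rule svd_trunc[OF x F])
    fix n :: nat and u v :: "nat \<Rightarrow> 'a ell2" and s :: "nat \<Rightarrow> real"
    assume u: "ons {..<n} u" "ons {..<n} v" and d: "trunc F x = diag_op {..<n} (\<lambda>k. of_real (s k)) u v"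
    have "sing_sum p x \<le> ennreal (\<Sum>k<n. cmod (of_real (s k)) powr p)"
      using sing_sum_diag_op_le[OF assms(2) finite_lessThan u, of "\<lambda>k. of_real (s k)"] d t by simp
    then show ?thesis by (rule order.strict_trans1) simp
  qed
qed

lemma finite_ops_compact:
  assumes "x \<in> finite_ops"
  shows "compact_oper x"
proof (rule finite_opsE[OF assms])
  fix F assume F: "finite F" and t: "trunc F x = x"
  let ?B = "{v. supported F v \<and> (\<forall>i. cmod (coord v i) \<le> norm x)}"
  have "blinfun_apply x ` cball 0 1 \<subseteq> ?B"
  proof (clarsimp, intro conjI allI)
    fix v :: "'a ell2" and i assume v: "norm v \<le> 1"
    show "supported F (blinfun_apply x v)"
      using t supported_cut[OF F] trunc_apply by metis
    have "norm (blinfun_apply x v) \<le> norm x * 1"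
      using v by (intro order_trans[OF norm_blinfun] mult_left_mono) auto
    then show "cmod (coord (blinfun_apply x v) i) \<le> norm x"
      using norm_coord_le[of "blinfun_apply x v" i] by linarith
  qed
  moreover have cB: "compact ?B" by (rule compact_finite_box[OF F])
  ultimately have "closure (blinfun_apply x ` cball 0 1) \<subseteq> ?B"
    by (intro closure_minimal compact_imp_closed)
  then have eq: "closure (blinfun_apply x ` cball 0 1) = ?B \<inter> closure (blinfun_apply x ` cball 0 1)" by blast
  show ?thesis unfolding compact_oper_def by (subst eq) (rule compact_Int_closed[OF cB closed_closure])
qed

lemma finite_ops_schatten_class: "x \<in> finite_ops \<Longrightarrow> 1 \<le> p \<Longrightarrow> x \<in> schatten_class p"
proof (cases "p = \<infinity>")
  case True
  assume "x \<in> finite_ops"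
  then show ?thesis using True finite_ops_compact by (simp add: schatten_class_def finite_ops_def)
next
  case False
  assume x: "x \<in> finite_ops" and p: "1 \<le> p"
  then have "1 \<le> enn2real p" using False by (intro one_le_enn2real)
  then show ?thesis using False x p sing_sum_finite_ops by (auto simp: schatten_class_iff finite_ops_def)
qed

section \<open>Multiplier bounds in terms of orthonormal systems\<close>

text \<open>The coefficient at \<open>u\<close>, \<open>v\<close> of the Schur product of
  \<open>M\<close> with the rank one matrix \<open>|f><g|\<close>, over the block
  \<open>F \<times> F\<close>.\<close>

definition schur_form :: "('i \<times> 'i \<Rightarrow> complex) \<Rightarrow> 'i set \<Rightarrow> 'i ell2 \<Rightarrow> 'i ell2 \<Rightarrow> 'i ell2 \<Rightarrow> 'i ell2 \<Rightarrow> complex" where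
  "schur_form M F u v f g =
    (\<Sum>i\<in>F. \<Sum>j\<in>F. M (i, j) * (cnj (coord u i) * coord f i * cnj (coord g j) * coord v j))"

definition subprob :: "nat \<Rightarrow> (nat \<Rightarrow> real) \<Rightarrow> bool" where
  "subprob n \<sigma> \<longleftrightarrow> (\<forall>k<n. 0 \<le> \<sigma> k) \<and> (\<Sum>k<n. \<sigma> k) \<le> 1"

text \<open>\<open>fin_bound M (1/p) A\<close> expresses that the Schur multiplier \<open>M\<close> has norm at most \<open>A\<close> on the
  finite matrices of \<open>\<S>\<^sub>p\<close>: the matrix \<open>\<Sum>\<^sub>k \<zeta>\<^sub>k \<sigma>\<^sub>k\<^sup>a |f\<^sub>k\<rangle>\<langle>g\<^sub>k|\<close> runs over the unit ball of \<open>\<S>\<^sub>p\<close> and the result is paired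
  with the unit ball of the dual space. Since \<open>0 powr 0 = 0\<close>, the vanishing weights are harmless at both
  end points \<open>a = 0\<close> and \<open>a = 1\<close>.\<close>

definition fin_bound :: "('i \<times> 'i \<Rightarrow> complex) \<Rightarrow> real \<Rightarrow> real \<Rightarrow> bool" where
  "fin_bound M a A \<longleftrightarrow> (\<forall>(n :: nat) (m :: nat) F u v f g \<sigma> \<tau> \<omega> \<zeta>.
    finite F \<and> ons {..<n} u \<and> ons {..<n} v \<and> ons {..<m} f \<and> ons {..<m} g \<and>
    (\<forall>k<m. supported F (f k) \<and> supported F (g k)) \<and> subprob m \<sigma> \<and> subprob n \<tau> \<and>
    (\<forall>l<n. cmod (\<omega> l) \<le> 1) \<and> (\<forall>k<m. cmod (\<zeta> k) \<le> 1) \<longrightarrow>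
    cmod (\<Sum>l<n. \<Sum>k<m. \<omega> l * of_real (\<tau> l powr (1 - a)) * (\<zeta> k * of_real (\<sigma> k powr a))
      * schur_form M F (u l) (v l) (f k) (g k)) \<le> A)"

lemma fin_boundI:
  assumes "\<And>n m F u v f g \<sigma> \<tau> \<omega> \<zeta>. finite F \<Longrightarrow> ons {..<n} u \<Longrightarrow> ons {..<n} v \<Longrightarrow>
    ons {..<m} f \<Longrightarrow> ons {..<m} g \<Longrightarrow> (\<And>k. k < m \<Longrightarrow> supported F (f k)) \<Longrightarrow> (\<And>k. k < m \<Longrightarrow> supported F (g k)) \<Longrightarrow>
    subprob m \<sigma> \<Longrightarrow> subprob n \<tau> \<Longrightarrow> (\<And>l. l < n \<Longrightarrow> cmod (\<omega> l) \<le> 1) \<Longrightarrow> (\<And>k. k < m \<Longrightarrow> cmod (\<zeta> k) \<le> 1) \<Longrightarrow>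
    cmod (\<Sum>l<n. \<Sum>k<m. \<omega> l * of_real (\<tau> l powr (1 - a)) * (\<zeta> k * of_real (\<sigma> k powr a))
      * schur_form M F (u l) (v l) (f k) (g k)) \<le> A"
  shows "fin_bound M a A"
  unfolding fin_bound_def by (intro allI impI) (rule assms; simp)

lemma fin_boundD:
  assumes "fin_bound M a A" "finite F" "ons {..<n::nat} u" "ons {..<n} v" "ons {..<m::nat} f" "ons {..<m} g"
    "\<And>k. k < m \<Longrightarrow> supported F (f k)" "\<And>k. k < m \<Longrightarrow> supported F (g k)" "subprob m \<sigma>" "subprob n \<tau>"
    "\<And>l. l < n \<Longrightarrow> cmod (\<omega> l) \<le> 1" "\<And>k. k < m \<Longrightarrow> cmod (\<zeta> k) \<le> 1"
  shows "cmod (\<Sum>l<n. \<Sum>k<m. \<omega> l * of_real (\<tau> l powr (1 - a)) * (\<zeta> k * of_real (\<sigma> k powr a))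
      * schur_form M F (u l) (v l) (f k) (g k)) \<le> A"
  using assms(1)[unfolded fin_bound_def, rule_format, of F n u v m f g \<sigma> \<tau> \<omega> \<zeta>] assms(2-) by simp

lemma schur_form_sum:
  assumes "\<And>i j. i \<in> F \<Longrightarrow> j \<in> F \<Longrightarrow> e i j = M (i, j) * (\<Sum>k\<in>K. s k * coord (f k) i * cnj (coord (g k) j))"
  shows "(\<Sum>i\<in>F. \<Sum>j\<in>F. cnj (coord u i) * e i j * coord v j) = (\<Sum>k\<in>K. s k * schur_form M F u v (f k) (g k))"
proof -
  have "(\<Sum>i\<in>F. \<Sum>j\<in>F. cnj (coord u i) * e i j * coord v j)
      = (\<Sum>i\<in>F. \<Sum>j\<in>F. \<Sum>k\<in>K. s k * (M (i, j) * (cnj (coord u i) * coord (f k) i * cnj (coord (g k) j) * coord v j)))"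
    by (intro sum.cong refl) (simp add: assms sum_distrib_left sum_distrib_right mult_ac)
  also have "\<dots> = (\<Sum>i\<in>F. \<Sum>k\<in>K. \<Sum>j\<in>F. s k * (M (i, j) * (cnj (coord u i) * coord (f k) i * cnj (coord (g k) j) * coord v j)))"
    by (intro sum.cong refl sum.swap)
  also have "\<dots> = (\<Sum>k\<in>K. \<Sum>i\<in>F. \<Sum>j\<in>F. s k * (M (i, j) * (cnj (coord u i) * coord (f k) i * cnj (coord (g k) j) * coord v j)))"
    by (rule sum.swap)
  also have "\<dots> = (\<Sum>k\<in>K. s k * schur_form M F u v (f k) (g k))"
    by (simp add: schur_form_def sum_distrib_left)
  finally show ?thesis .
qed

lemma subprob_powr_le:
  assumes "subprob n \<sigma>" "k < n" "0 \<le> a"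
  shows "\<sigma> k powr a \<le> 1"
proof -
  have "\<sigma> k \<le> (\<Sum>k<n. \<sigma> k)" using assms by (intro member_le_sum) (auto simp: subprob_def)
  then have "\<sigma> k \<le> 1" "0 \<le> \<sigma> k" using assms by (auto simp: subprob_def)
  then show ?thesis using assms(3) powr_mono2[of a "\<sigma> k" 1] by simp
qed

text \<open>Hoelder's inequality against weights whose conjugate norm is at most 1, obtained by
  applying Young's inequality to \<open>y l / B\<close> termwise.\<close>

lemma holder_subprob:
  assumes p: "1 \<le> p" and \<tau>: "subprob n \<tau>" and y: "\<And>l. l < n \<Longrightarrow> 0 \<le> y l"
    and B: "0 \<le> B" "(\<Sum>l<n. y l powr p) \<le> B powr p"
  shows "(\<Sum>l<n. \<tau> l powr (1 - 1 / p) * y l) \<le> B"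
proof (cases "B = 0")
  case True
  then have "(\<Sum>l<n. y l powr p) = 0" using B(2) by (simp add: antisym sum_nonneg)
  then have "y l = 0" if "l < n" for l
    using that by (subst (asm) sum_nonneg_eq_0_iff) auto
  then show ?thesis using True by simp
next
  case False
  with B(1) have B0: "0 < B" by simp
  have "(\<Sum>l<n. \<tau> l powr (1 - 1 / p) * (y l / B)) \<le> (\<Sum>l<n. (1 / p) * ((y l / B) powr p) + (1 - 1 / p) * \<tau> l)"
  proof (intro sum_mono)
    fix l assume "l \<in> {..<n}"
    then have l: "0 \<le> y l" "0 \<le> \<tau> l" using y \<tau> by (auto simp: subprob_def)
    show "\<tau> l powr (1 - 1 / p) * (y l / B) \<le> (1 / p) * ((y l / B) powr p) + (1 - 1 / p) * \<tau> l"
    \<comment> \<open>With a vanishing factor the left side is 0, even for \<open>p = 1\<close>,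
      because \<open>0 powr 0 = 0\<close>.\<close>
    proof (cases "y l = 0 \<or> \<tau> l = 0")
      case True
      then show ?thesis using l p B0 by auto
    next
      case False
      then have pos: "0 < y l / B" "0 < \<tau> l" using l B0 by auto
      have "((y l / B) powr p) powr (1 / p) * \<tau> l powr (1 - 1 / p) \<le> (1 / p) * ((y l / B) powr p) + (1 - 1 / p) * \<tau> l"
        using p pos by (intro Youngs_inequality_0) auto
      moreover have "((y l / B) powr p) powr (1 / p) = y l / B"
        using p pos l B0 by (simp add: powr_powr abs_of_nonneg abs_of_pos)
      ultimately show ?thesis by (simp only: mult.commute)
    qed
  qed
  also have "\<dots> = (1 / p) * ((\<Sum>l<n. y l powr p) / B powr p) + (1 - 1 / p) * (\<Sum>l<n. \<tau> l)"
    using y B0 by (simp add: sum.distrib sum_distrib_left sum_divide_distrib powr_divide)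
  also have "\<dots> \<le> (1 / p) * 1 + (1 - 1 / p) * 1"
    using p \<tau> B B0 by (intro add_mono mult_left_mono) (auto simp: subprob_def)
  finally have "(\<Sum>l<n. \<tau> l powr (1 - 1 / p) * (y l / B)) \<le> 1" by simp
  then have "(\<Sum>l<n. \<tau> l powr (1 - 1 / p) * y l) / B \<le> 1"
    by (simp add: sum_divide_distrib)
  then show ?thesis using B0 by simp
qed

lemma le_powr_iff_powr_inverse_le:
  fixes r A p :: real
  assumes "0 \<le> r" "0 \<le> A" "1 \<le> p" "r powr (1 / p) \<le> A"
  shows "r \<le> A powr p"
proof -
  have "(r powr (1 / p)) powr p \<le> A powr p" using assms by (intro powr_mono2) auto
  then show ?thesis using assms by (simp add: powr_powr)
qed

text \<open>The hypothesis concerns finite matrices over an arbitrary index type, so it is available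
  for a multiplier and for its amplification alike, and at \<open>q = \<infinity>\<close> too. The
  weighted rank one sum is an input in the unit ball; the output is paired by
  \<open>holder_subprob\<close>.\<close>

lemma fin_bound_of_schatten_norm:
  fixes M :: "'i \<times> 'i \<Rightarrow> complex"
  assumes q: "1 \<le> q" and A: "0 \<le> A"
    and ex: "\<And>x. x \<in> finite_ops \<Longrightarrow> schatten_norm q x \<le> 1 \<Longrightarrow>
      \<exists>y\<in>bounded_ops. (\<forall>i j. entry y i j = M (i, j) * entry x i j) \<and> schatten_norm q y \<le> A"
  shows "fin_bound M (1 / enn2real q) A"
proof (rule fin_boundI)
  fix n m :: nat and F :: "'i set" and u v f g :: "nat \<Rightarrow> 'i ell2" and \<sigma> \<tau> :: "nat \<Rightarrow> real" and \<omega> \<zeta> :: "nat \<Rightarrow> complex"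
  assume F: "finite F" and u: "ons {..<n} u" and v: "ons {..<n} v" and f: "ons {..<m} f" and g: "ons {..<m} g"
    and sf: "\<And>k. k < m \<Longrightarrow> supported F (f k)" and sg: "\<And>k. k < m \<Longrightarrow> supported F (g k)"
    and \<sigma>: "subprob m \<sigma>" and \<tau>: "subprob n \<tau>" and \<omega>: "\<And>l. l < n \<Longrightarrow> cmod (\<omega> l) \<le> 1" and \<zeta>: "\<And>k. k < m \<Longrightarrow> cmod (\<zeta> k) \<le> 1"
  define a where "a = 1 / enn2real q"
  have a0: "0 \<le> a" by (simp add: a_def)
  define s where "s k = \<zeta> k * of_real (\<sigma> k powr a)" for k
  define x where "x = diag_op {..<m} s f g"
  have x: "x \<in> finite_ops" unfolding x_def by (rule diag_op_finite_ops[OF F]) (use sf sg in auto)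
  have s1: "cmod (s k) \<le> \<sigma> k powr a" if "k < m" for k
    using \<zeta>[OF that] by (simp add: s_def norm_mult mult_left_le_one_le)
  have nx: "schatten_norm q x \<le> 1"
  proof (cases "q = \<infinity>")
    case True
    have "norm x \<le> 1" unfolding x_def
      using s1 subprob_powr_le[OF \<sigma> _ a0] by (intro norm_diag_op_le f g) (auto intro: order_trans)
    then show ?thesis using True by (simp add: schatten_norm_def)
  next
    case False
    have p: "1 \<le> enn2real q" using q False by (intro one_le_enn2real)
    have "sing_sum (enn2real q) x \<le> ennreal (\<Sum>k<m. cmod (s k) powr enn2real q)"
      unfolding x_def by (rule sing_sum_diag_op_le[OF p finite_lessThan f g])
    also have "(\<Sum>k<m. cmod (s k) powr enn2real q) \<le> (\<Sum>k<m. \<sigma> k)"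
    proof (intro sum_mono)
      fix k assume k: "k \<in> {..<m}"
      have "cmod (s k) powr enn2real q \<le> (\<sigma> k powr a) powr enn2real q"
        using s1 k p by (intro powr_mono2) auto
      also have "\<dots> = \<sigma> k" using p \<sigma> k by (simp add: a_def powr_powr subprob_def)
      finally show "cmod (s k) powr enn2real q \<le> \<sigma> k" .
    qed
    then have "ennreal (\<Sum>k<m. cmod (s k) powr enn2real q) \<le> ennreal 1"
      using \<sigma> by (intro ennreal_leI) (auto simp: subprob_def)
    finally have "enn2real (sing_sum (enn2real q) x) \<le> 1"
      by (intro enn2real_leI) auto
    then have "enn2real (sing_sum (enn2real q) x) powr (1 / enn2real q) \<le> 1 powr (1 / enn2real q)"
      by (intro powr_mono2) auto
    then show ?thesis using schatten_norm_eq[OF q False, of x] x by (simp add: finite_ops_def)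
  qed
  obtain y where y: "y \<in> bounded_ops" "\<And>i j. entry y i j = M (i, j) * entry x i j" "schatten_norm q y \<le> A"
    using ex[OF x nx] by blast
  have ey: "entry y i j = M (i, j) * (\<Sum>k<m. s k * coord (f k) i * cnj (coord (g k) j))" for i j
    unfolding y(2) x_def entry_diag_op ..
  \<comment> \<open>The output inherits the support of the input, so its coefficients are finite
    forms over \<open>F\<close>.\<close>
  have outF: "i \<in> F \<and> j \<in> F" if "entry y i j \<noteq> 0" for i j
  proof (rule ccontr)
    assume "\<not> (i \<in> F \<and> j \<in> F)"
    then have "(\<Sum>k<m. s k * coord (f k) i * cnj (coord (g k) j)) = 0"
      using sf sg by (intro sum.neutral) (auto simp: supported_def)
    then show False using that ey by simp
  qed
  have yf: "y \<in> finite_ops" unfolding finite_ops_iff using y(1) F outF by blast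
  have ty: "trunc F y = y" by (rule trunc_eq[OF F y(1) outF])
  define Y where "Y l = cinner (u l) (blinfun_apply y (v l))" for l
  have Y: "Y l = (\<Sum>k<m. s k * schur_form M F (u l) (v l) (f k) (g k))" for l
  proof -
    have "Y l = cinner (cut F (u l)) (blinfun_apply y (cut F (v l)))"
      unfolding Y_def cinner_cut[OF F] trunc_apply[symmetric] ty ..
    then show ?thesis unfolding finite_form[OF y(1) F] by (simp only: schur_form_sum[OF ey])
  qed
  have "cmod (\<Sum>l<n. \<Sum>k<m. \<omega> l * of_real (\<tau> l powr (1 - a)) * (\<zeta> k * of_real (\<sigma> k powr a))
      * schur_form M F (u l) (v l) (f k) (g k)) = cmod (\<Sum>l<n. \<omega> l * of_real (\<tau> l powr (1 - a)) * Y l)"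
    unfolding Y s_def sum_distrib_left by (simp only: mult.assoc)
  also have "\<dots> \<le> (\<Sum>l<n. \<tau> l powr (1 - a) * cmod (Y l))"
  proof (intro order_trans[OF norm_sum] sum_mono)
    fix l assume "l \<in> {..<n}"
    then have "cmod (\<omega> l) * (\<tau> l powr (1 - a) * cmod (Y l)) \<le> 1 * (\<tau> l powr (1 - a) * cmod (Y l))"
      using \<omega> by (intro mult_right_mono) auto
    then show "cmod (\<omega> l * of_real (\<tau> l powr (1 - a)) * Y l) \<le> \<tau> l powr (1 - a) * cmod (Y l)"
      by (simp add: norm_mult mult.assoc)
  qed
  also have "\<dots> \<le> A"
  proof (cases "q = \<infinity>")
    case True
    \<comment> \<open>Both \<open>enn2real \<infinity>\<close> and division by 0 yield 0, the right
      exponent for the operator norm.\<close>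
    then have a: "a = 0" by (simp add: a_def)
    have "norm y \<le> A" using y(3) True by (simp add: schatten_norm_def)
    moreover have "cmod (Y l) \<le> norm y" if "l < n" for l
    proof -
      have "cmod (Y l) \<le> norm (u l) * norm (blinfun_apply y (v l))" unfolding Y_def by (rule cmod_cinner_le)
      also have "\<dots> \<le> norm y" using norm_blinfun[of y "v l"] ons_norm[OF u] ons_norm[OF v] that by simp
      finally show ?thesis .
    qed
    ultimately have "(\<Sum>l<n. \<tau> l powr (1 - a) * cmod (Y l)) \<le> (\<Sum>l<n. \<tau> l * A)"
      using \<tau> by (intro sum_mono mult_mono) (auto simp: a subprob_def intro: order_trans)
    also have "\<dots> \<le> 1 * A"
      unfolding sum_distrib_right[symmetric] using \<tau> A by (intro mult_right_mono) (auto simp: subprob_def)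
    finally show ?thesis by simp
  next
    case False
    have p: "1 \<le> enn2real q" using q False by (intro one_le_enn2real)
    obtain r where r: "sing_sum (enn2real q) y = ennreal r" "0 \<le> r"
      using sing_sum_finite_ops[OF yf p] by (cases "sing_sum (enn2real q) y") auto
    have "r powr (1 / enn2real q) \<le> A" using y(3) schatten_norm_eq[OF q False y(1)] r by simp
    then have "r \<le> A powr enn2real q" using le_powr_iff_powr_inverse_le r A p by blast
    moreover have "ennreal (\<Sum>l<n. cmod (Y l) powr enn2real q) \<le> ennreal r"
      unfolding Y_def r(1)[symmetric] by (rule sing_sum_upper_nat[OF u v])
    ultimately have "(\<Sum>l<n. cmod (Y l) powr enn2real q) \<le> A powr enn2real q"
      using r(2) by simp
    then show ?thesis unfolding a_def by (intro holder_subprob p \<tau> A) auto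
  qed
  finally show "cmod (\<Sum>l<n. \<Sum>k<m. \<omega> l * of_real (\<tau> l powr (1 - 1 / enn2real q)) * (\<zeta> k * of_real (\<sigma> k powr (1 / enn2real q)))
      * schur_form M F (u l) (v l) (f k) (g k)) \<le> A"
    unfolding a_def .
qed

text \<open>Converse to \<open>fin_bound_of_schatten_norm\<close>: inserting the singular values of
  a truncation and the equality case of Hoelder's inequality turns the pairing into
  \<open>(R / S) powr (1 / p)\<close>.\<close>

lemma schur_form_sum_powr_le:
  fixes M :: "'i \<times> 'i \<Rightarrow> complex"
  assumes M: "fin_bound M (1 / p) A" and p: "1 \<le> p" and A: "0 \<le> A" and x: "x \<in> bounded_ops"
    and F: "finite F" and u: "ons {..<n::nat} u" and v: "ons {..<n} v"
  shows "ennreal (\<Sum>l<n. cmod (\<Sum>i\<in>F. \<Sum>j\<in>F. cnj (coord (u l) i) * (M (i, j) * entry x i j) * coord (v l) j) powr p)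
    \<le> ennreal (A powr p) * sing_sum p x"
proof (rule svd_trunc[OF x F])
  fix m :: nat and f g :: "nat \<Rightarrow> 'i ell2" and s :: "nat \<Rightarrow> real"
  assume f: "ons {..<m} f" and g: "ons {..<m} g" and s: "\<And>k. k < m \<Longrightarrow> 0 < s k"
    and sf: "\<And>k. k < m \<Longrightarrow> supported F (f k)" and sg: "\<And>k. k < m \<Longrightarrow> supported F (g k)"
    and tr: "trunc F x = diag_op {..<m} (\<lambda>k. of_real (s k)) f g"
  define Y where "Y l = (\<Sum>i\<in>F. \<Sum>j\<in>F. cnj (coord (u l) i) * (M (i, j) * entry x i j) * coord (v l) j)" for l
  define S where "S = (\<Sum>k<m. s k powr p)"
  define R where "R = (\<Sum>l<n. cmod (Y l) powr p)"
  have Y: "Y l = (\<Sum>k<m. of_real (s k) * schur_form M F (u l) (v l) (f k) (g k))" for l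
    unfolding Y_def
  proof (rule schur_form_sum)
    fix i j assume "i \<in> F" "j \<in> F"
    then have "entry x i j = entry (trunc F x) i j" by (simp add: entry_trunc F)
    then show "M (i, j) * entry x i j = M (i, j) * (\<Sum>k<m. of_real (s k) * coord (f k) i * cnj (coord (g k) j))"
      unfolding tr entry_diag_op by simp
  qed
  have S0: "0 \<le> S" and R0: "0 \<le> R" unfolding S_def R_def by (auto intro: sum_nonneg)
  have key: "R \<le> A powr p * S"
  proof (cases "R = 0")
    case True
    then show ?thesis using S0 by simp
  next
    case False
    with R0 have R: "0 < R" by simp
    \<comment> \<open>If \<open>S\<close> vanished there would be no singular values, as they are
      positive; then all \<open>Y l\<close>, and hence \<open>R\<close>, would vanish.\<close>
    have S: "0 < S"
    proof (rule ccontr)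
      assume "\<not> 0 < S"
      have "m = 0"
      proof (rule ccontr)
        assume "m \<noteq> 0"
        then have "0 < S" unfolding S_def using s by (intro sum_pos) (auto simp: less_imp_neq[symmetric])
        with \<open>\<not> 0 < S\<close> show False by simp
      qed
      then have "R = 0" using p by (simp add: R_def Y)
      with R show False by simp
    qed
    \<comment> \<open>Normalised powers of input and output together with the conjugate phases of
      the output: the extremal choice in the duality of \<open>p\<close>-norms.\<close>
    define \<sigma> where "\<sigma> k = s k powr p / S" for k
    define \<tau> where "\<tau> l = cmod (Y l) powr p / R" for l
    define \<omega> where "\<omega> l = cnj (sgn (Y l))" for l
    have "subprob m \<sigma>" "subprob n \<tau>"
      using R S unfolding subprob_def \<sigma>_def \<tau>_def sum_divide_distrib[symmetric]
      by (auto simp: S_def[symmetric] R_def[symmetric])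
    moreover have "cmod (\<omega> l) \<le> 1" for l by (simp add: \<omega>_def norm_sgn)
    ultimately have b: "cmod (\<Sum>l<n. \<Sum>k<m. \<omega> l * of_real (\<tau> l powr (1 - 1 / p)) * (1 * of_real (\<sigma> k powr (1 / p)))
        * schur_form M F (u l) (v l) (f k) (g k)) \<le> A"
      by (intro fin_boundD[OF M F u v f g sf sg]) auto
    have sk: "\<sigma> k powr (1 / p) = s k / S powr (1 / p)" if "k < m" for k
      using s[OF that] p S by (simp add: \<sigma>_def powr_divide powr_powr)
    have "(\<Sum>l<n. \<Sum>k<m. \<omega> l * of_real (\<tau> l powr (1 - 1 / p)) * (1 * of_real (\<sigma> k powr (1 / p)))
        * schur_form M F (u l) (v l) (f k) (g k))
        = (\<Sum>l<n. \<omega> l * of_real (\<tau> l powr (1 - 1 / p)) * (Y l / of_real (S powr (1 / p))))"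
    proof (intro sum.cong refl)
      fix l
      have "Y l / of_real (S powr (1 / p)) = (\<Sum>k<m. of_real (\<sigma> k powr (1 / p)) * schur_form M F (u l) (v l) (f k) (g k))"
        unfolding Y sum_divide_distrib by (intro sum.cong refl) (simp add: sk)
      then show "(\<Sum>k<m. \<omega> l * of_real (\<tau> l powr (1 - 1 / p)) * (1 * of_real (\<sigma> k powr (1 / p)))
        * schur_form M F (u l) (v l) (f k) (g k)) = \<omega> l * of_real (\<tau> l powr (1 - 1 / p)) * (Y l / of_real (S powr (1 / p)))"
        by (simp add: sum_distrib_left mult.assoc)
    qed
    also have "\<dots> = (\<Sum>l<n. of_real (cmod (Y l) powr p / (R powr (1 - 1 / p) * S powr (1 / p))))"
    proof (intro sum.cong refl)
      fix l
      show "\<omega> l * of_real (\<tau> l powr (1 - 1 / p)) * (Y l / of_real (S powr (1 / p)))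
          = of_real (cmod (Y l) powr p / (R powr (1 - 1 / p) * S powr (1 / p)))"
      proof (cases "Y l = 0")
        case True
        then show ?thesis using p by simp
      next
        case False
        have "\<omega> l * Y l = of_real (cmod (Y l))"
          using False complex_norm_square[of "Y l"] unfolding \<omega>_def sgn_eq
          by (simp add: field_simps power2_eq_square)
        moreover have "\<tau> l powr (1 - 1 / p) = cmod (Y l) powr (p - 1) / R powr (1 - 1 / p)"
          using False R p by (simp add: \<tau>_def powr_divide powr_powr right_diff_distrib)
        moreover have "cmod (Y l) powr p = cmod (Y l) powr (p - 1) * cmod (Y l)"
          using False powr_add[of "cmod (Y l)" "p - 1" 1] by simp
        ultimately show ?thesis by (simp add: mult_ac)
      qed
    qed
    also have "\<dots> = of_real (R / (R powr (1 - 1 / p) * S powr (1 / p)))"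
      by (simp add: R_def sum_divide_distrib)
    also have "R / (R powr (1 - 1 / p) * S powr (1 / p)) = R powr (1 / p) / S powr (1 / p)"
    proof -
      have "R = R powr (1 / p) * R powr (1 - 1 / p)" using R powr_add[of R "1 / p" "1 - 1 / p"] by simp
      then show ?thesis using R by (metis mult_divide_mult_cancel_right powr_eq_0_iff less_irrefl mult.commute)
    qed
    finally have "cmod (of_real (R powr (1 / p) / S powr (1 / p))) \<le> A" using b by (simp only:)
    then have "R powr (1 / p) / S powr (1 / p) \<le> A" unfolding norm_of_real by (rule abs_le_D1)
    then have "(R / S) powr (1 / p) \<le> A" using R S by (simp add: powr_divide)
    then have "R / S \<le> A powr p" using R S A p by (intro le_powr_iff_powr_inverse_le) auto
    then show ?thesis using S by (simp add: field_simps)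
  qed
  have "ennreal R \<le> ennreal (A powr p) * ennreal S"
    using key S0 by (simp add: ennreal_mult'[symmetric])
  also have "\<dots> \<le> ennreal (A powr p) * sing_sum p x"
  proof (rule mult_left_mono)
    have "cinner (f k) (blinfun_apply x (g k)) = of_real (s k)" if "k < m" for k
      by (rule singular_value_eq[OF F sf[OF that] sg[OF that] f g finite_lessThan _ tr]) (use that in simp)
    then have "S = (\<Sum>k<m. cmod (cinner (f k) (blinfun_apply x (g k))) powr p)"
      unfolding S_def by (intro sum.cong refl) (use s in \<open>simp add: abs_of_pos\<close>)
    then show "ennreal S \<le> sing_sum p x" using sing_sum_upper_nat[OF f g] by simp
  qed simp
  finally show ?thesis unfolding R_def Y_def .
qed

text \<open>Single unit vectors in \<open>schur_form_sum_powr_le\<close> bound the finite forms, so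
  \<open>op_of_matrix\<close> builds the product from its entries; longer orthonormal systems then
  give the norm estimate in the limit over \<open>F\<close>. Extension by continuity from finite
  matrices is thereby bypassed.\<close>

lemma schur_multiplication_exists:
  fixes M :: "'i \<times> 'i \<Rightarrow> complex"
  assumes M: "fin_bound M (1 / p) A" and p: "1 \<le> p" and A: "0 \<le> A" and x: "x \<in> bounded_ops"
    and fin: "sing_sum p x < \<infinity>"
  obtains y where "y \<in> bounded_ops" "\<And>i j. entry y i j = M (i, j) * entry x i j"
    "sing_sum p y \<le> ennreal (A powr p) * sing_sum p x"
proof -
  obtain r where r: "sing_sum p x = ennreal r" "0 \<le> r" using fin by (cases "sing_sum p x") auto
  define C where "C = A * r powr (1 / p)"
  have C0: "0 \<le> C" using A by (simp add: C_def)
  have form: "cmod (\<Sum>i\<in>F. \<Sum>j\<in>F. cnj (coord u i) * (M (i, j) * entry x i j) * coord v j) \<le> C"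
    if F: "finite F" and u: "norm u = 1" and v: "norm v = 1" for F u v
  proof -
    let ?Y = "\<Sum>i\<in>F. \<Sum>j\<in>F. cnj (coord u i) * (M (i, j) * entry x i j) * coord v j"
    \<comment> \<open>Systems of length 1, where the sum of powers is a single coefficient.\<close>
    have "ons {..<1::nat} (\<lambda>_. u)" "ons {..<1::nat} (\<lambda>_. v)" using u v by (auto simp: ons_def norm_eq_1_iff)
    from schur_form_sum_powr_le[OF M p A x F this]
    have "ennreal (cmod ?Y powr p) \<le> ennreal (A powr p) * sing_sum p x" by simp
    then have "cmod ?Y powr p \<le> A powr p * r"
      unfolding r(1) using r(2) by (simp add: ennreal_mult'[symmetric])
    also have "\<dots> = C powr p" using A r(2) p by (simp add: C_def powr_mult powr_powr)
    finally show ?thesis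
      using powr_less_mono2[of p C "cmod ?Y"] p C0 by linarith
  qed
  obtain y where y: "y \<in> bounded_ops" "\<And>i j. entry y i j = M (i, j) * entry x i j"
  proof (rule op_of_matrix[of "\<lambda>i j. M (i, j) * entry x i j" C])
    fix F :: "'i set" and u v :: "'i ell2"
    assume F: "finite F"
    let ?Y = "\<lambda>u v. \<Sum>i\<in>F. \<Sum>j\<in>F. cnj (coord u i) * (M (i, j) * entry x i j) * coord v j"
    show "cmod (?Y u v) \<le> C * norm u * norm v"
    proof (cases "u = 0 \<or> v = 0")
      case False
      let ?u = "(1 / norm u) *\<^sub>R u" and ?v = "(1 / norm v) *\<^sub>R v"
      have "?Y ?u ?v = ?Y u v / of_real (norm u * norm v)"
        by (simp add: sum_divide_distrib mult_ac)
      moreover have "cmod (?Y ?u ?v) \<le> C" using False by (intro form F) auto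
      ultimately show ?thesis using False by (simp add: norm_divide norm_mult divide_le_eq mult.assoc)
    qed auto
  qed (use C0 that in auto)
  have "sing_sum p y \<le> ennreal (A powr p) * sing_sum p x"
  proof (rule sing_sum_least)
    fix n :: nat and u v :: "nat \<Rightarrow> 'i ell2"
    assume u: "ons {..<n} u" and v: "ons {..<n} v"
    show "ennreal (\<Sum>k<n. cmod (cinner (u k) (blinfun_apply y (v k))) powr p) \<le> ennreal (A powr p) * sing_sum p x"
    proof (rule tendsto_upperbound)
      show "((\<lambda>F. ennreal (\<Sum>l<n. cmod (\<Sum>i\<in>F. \<Sum>j\<in>F. cnj (coord (u l) i) * entry y i j * coord (v l) j) powr p))
          \<longlongrightarrow> ennreal (\<Sum>k<n. cmod (cinner (u k) (blinfun_apply y (v k))) powr p)) finsub"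
        using p by (intro tendsto_ennrealI tendsto_sum tendsto_powr' tendsto_norm tendsto_finite_form y(1) tendsto_const) auto
      show "\<forall>\<^sub>F F in finsub. ennreal (\<Sum>l<n. cmod (\<Sum>i\<in>F. \<Sum>j\<in>F. cnj (coord (u l) i) * entry y i j * coord (v l) j) powr p)
          \<le> ennreal (A powr p) * sing_sum p x"
        unfolding y(2) by (rule eventually_finsubI) (auto intro: schur_form_sum_powr_le[OF M p A x _ u v])
    qed simp
  qed
  with y that show thesis by blast
qed

text \<open>Described by entries alone, and unique by \<open>bounded_ops_eqI\<close>, so that it can
  be identified with the amplification of another such map in
  \<open>cb_norm_schur_op\<close>.\<close>

definition schur_op :: "('i \<times> 'i \<Rightarrow> complex) \<Rightarrow> 'i oper \<Rightarrow> 'i oper" where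
  "schur_op M x = (THE y. y \<in> bounded_ops \<and> (\<forall>i j. entry y i j = M (i, j) * entry x i j))"

lemma schur_op_eqI:
  assumes "y \<in> bounded_ops" "\<And>i j. entry y i j = M (i, j) * entry x i j"
  shows "schur_op M x = y"
  unfolding schur_op_def
  by (rule the_equality) (use assms in \<open>auto intro: bounded_ops_eqI\<close>)

lemma schur_op_schatten:
  assumes p: "1 \<le> p" "p \<noteq> \<infinity>" and M: "fin_bound M (1 / enn2real p) A" "0 \<le> A" and x: "x \<in> schatten_class p"
  shows "schur_op M x \<in> schatten_class p" "entry (schur_op M x) i j = M (i, j) * entry x i j"
    "sing_sum (enn2real p) (schur_op M x) \<le> ennreal (A powr enn2real p) * sing_sum (enn2real p) x"
proof -
  have xb: "x \<in> bounded_ops" and fin: "sing_sum (enn2real p) x < \<infinity>"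
    using x schatten_class_iff[OF p] by auto
  have "schur_op M x \<in> schatten_class p \<and> entry (schur_op M x) i j = M (i, j) * entry x i j \<and>
    sing_sum (enn2real p) (schur_op M x) \<le> ennreal (A powr enn2real p) * sing_sum (enn2real p) x"
  proof (rule schur_multiplication_exists[OF M(1) one_le_enn2real[OF p] M(2) xb fin])
    fix y assume y: "y \<in> bounded_ops" "\<And>i j. entry y i j = M (i, j) * entry x i j"
      "sing_sum (enn2real p) y \<le> ennreal (A powr enn2real p) * sing_sum (enn2real p) x"
    have "ennreal (A powr enn2real p) * sing_sum (enn2real p) x < \<infinity>"
      using fin by (simp add: ennreal_mult_less_top)
    then have "sing_sum (enn2real p) y < \<infinity>" using y(3) by (rule order.strict_trans1[rotated])
    then show ?thesis using y schur_op_eqI[OF y(1,2)] schatten_class_iff[OF p, of y] by simp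
  qed
  then show "schur_op M x \<in> schatten_class p" "entry (schur_op M x) i j = M (i, j) * entry x i j"
    "sing_sum (enn2real p) (schur_op M x) \<le> ennreal (A powr enn2real p) * sing_sum (enn2real p) x" by auto
qed

lemma schatten_norm_schur_op_le:
  assumes p: "1 \<le> p" "p \<noteq> \<infinity>" and M: "fin_bound M (1 / enn2real p) A" "0 \<le> A"
    and x: "x \<in> schatten_class p" "schatten_norm p x \<le> 1"
  shows "schatten_norm p (schur_op M x) \<le> A"
proof -
  have xb: "x \<in> bounded_ops" and fin: "sing_sum (enn2real p) x < \<infinity>"
    using x schatten_class_iff[OF p] by auto
  obtain r where r: "sing_sum (enn2real p) x = ennreal r" "0 \<le> r"
    using fin by (cases "sing_sum (enn2real p) x") auto
  have p1: "1 \<le> enn2real p" by (rule one_le_enn2real[OF p])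
  have "r powr (1 / enn2real p) \<le> 1" using x(2) r schatten_norm_eq[OF p xb] by simp
  then have "r \<le> 1" using le_powr_iff_powr_inverse_le[OF r(2) _ p1, of 1] by simp
  note s = schur_op_schatten[OF p M x(1)]
  have "sing_sum (enn2real p) (schur_op M x) \<le> ennreal (A powr enn2real p) * ennreal 1"
  proof (rule order_trans[OF s(3)])
    show "ennreal (A powr enn2real p) * sing_sum (enn2real p) x \<le> ennreal (A powr enn2real p) * ennreal 1"
      unfolding r(1) using \<open>r \<le> 1\<close> by (intro mult_left_mono ennreal_leI) auto
  qed
  then have "enn2real (sing_sum (enn2real p) (schur_op M x)) \<le> A powr enn2real p"
    by (intro enn2real_leI) auto
  then have "enn2real (sing_sum (enn2real p) (schur_op M x)) powr (1 / enn2real p) \<le> (A powr enn2real p) powr (1 / enn2real p)"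
    using p1 by (intro powr_mono2) auto
  also have "\<dots> = A" using p1 M(2) by (simp add: powr_powr)
  finally show ?thesis using s(1) schatten_class_iff[OF p, of "schur_op M x"] schatten_norm_eq[OF p, of "schur_op M x"] by simp
qed

lemma map_norm_leI:
  "(\<And>x. x \<in> X \<Longrightarrow> schatten_norm p x \<le> 1 \<Longrightarrow> schatten_norm p (T x) \<le> A) \<Longrightarrow> map_norm p X T \<le> ennreal A"
  unfolding map_norm_def by (rule SUP_least) (auto intro: ennreal_leI)

lemma schur_map_schur_op:
  assumes p: "1 \<le> p" "p \<noteq> \<infinity>" and M: "fin_bound M (1 / enn2real p) A" "0 \<le> A"
  shows "schur_map p M (schur_op M)"
  unfolding schur_map_def
proof (intro conjI ballI allI)
  note s = schur_op_schatten[OF p M]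
  have b: "x \<in> bounded_ops" if "x \<in> schatten_class p" for x :: "int oper"
    using that by (simp add: schatten_class_def)
  show "schur_op M \<in> schatten_class p \<rightarrow> schatten_class p" using s(1) by auto
  show "schur_op M (x + y) = schur_op M x + schur_op M y" if "x \<in> schatten_class p" "y \<in> schatten_class p" for x y
    using that s by (intro schur_op_eqI bounded_ops_add b) (auto simp: distrib_left)
  show "schur_op M (op_scale c x) = op_scale c (schur_op M x)" if "x \<in> schatten_class p" for c x
    using that s by (intro schur_op_eqI bounded_ops_op_scale b) (auto simp: mult_ac)
  have "map_norm p (schatten_class p) (schur_op M) \<le> ennreal A"
    by (rule map_norm_leI) (rule schatten_norm_schur_op_le[OF p M])
  then show "map_norm p (schatten_class p) (schur_op M) < \<infinity>" by (rule order.strict_trans1) simp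
  show "entry (schur_op M x) i j = M (i, j) * entry x i j" if "x \<in> finite_ops" for x i j
    using s(2) finite_ops_schatten_class[OF that p(1)] by blast
qed

lemma map_norm_upper:
  assumes "x \<in> X" "schatten_norm p x \<le> 1" "map_norm p X T < \<infinity>" "map_norm p X T \<le> B" "B < \<infinity>"
  shows "schatten_norm p (T x) \<le> enn2real B"
proof -
  have "ennreal (schatten_norm p (T x)) \<le> map_norm p X T"
    unfolding map_norm_def using assms(1,2) by (intro SUP_upper) auto
  then have "ennreal (schatten_norm p (T x)) \<le> ennreal (enn2real B)"
    using assms(4,5) by (metis ennreal_enn2real infinity_ennreal_def order_trans)
  then show ?thesis by (simp add: ennreal_le_iff)
qed

text \<open>The map \<open>T\<close> is consulted on finite matrices only, where
  \<open>schur_map\<close> prescribes its entries.\<close>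

lemma fin_bound_of_schur_map:
  assumes q: "1 \<le> q" and T: "schur_map q M T"
  obtains A where "0 \<le> A" "fin_bound M (1 / enn2real q) A"
proof (rule that)
  let ?A = "enn2real (map_norm q (schatten_class q) T)"
  show "0 \<le> ?A" by simp
  show "fin_bound M (1 / enn2real q) ?A"
  proof (rule fin_bound_of_schatten_norm[OF q])
    fix x :: "int oper" assume x: "x \<in> finite_ops" and n: "schatten_norm q x \<le> 1"
    have xc: "x \<in> schatten_class q" by (rule finite_ops_schatten_class[OF x q])
    have "T x \<in> schatten_class q" using T xc by (auto simp: schur_map_def)
    then have "T x \<in> bounded_ops" by (simp add: schatten_class_def)
    moreover have "\<forall>i j. entry (T x) i j = M (i, j) * entry x i j" using T x by (simp add: schur_map_def)
    moreover have "schatten_norm q (T x) \<le> ?A"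
      using T by (intro map_norm_upper[OF xc n]) (auto simp: schur_map_def)
    ultimately show "\<exists>y\<in>bounded_ops. (\<forall>i j. entry y i j = M (i, j) * entry x i j) \<and> schatten_norm q y \<le> ?A"
      by blast
  qed simp
qed

subsection \<open>Amplification\<close>

lemma coord_slot [simp]: "coord (blinfun_apply (slot k) v) z = (if fst z = k then coord v (snd z) else 0)"
  by (simp add: slot.rep_eq slot_fun.rep_eq)

lemma coord_unslot [simp]: "coord (blinfun_apply (unslot k) w) i = coord w (k, i)"
  by (simp add: unslot.rep_eq unslot_fun.rep_eq)

lemma cinner_slot: "cinner (blinfun_apply (slot k) v) w = cinner v (blinfun_apply (unslot k) w)"
proof -
  have "cinner (blinfun_apply (slot k) v) w
      = (\<Sum>\<^sub>\<infinity>z\<in>Pair k ` UNIV. cnj (coord (blinfun_apply (slot k) v) z) * coord w z)"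
    unfolding cinner_def by (rule infsum_cong_neutral) auto
  also have "\<dots> = cinner v (blinfun_apply (unslot k) w)"
    unfolding cinner_def by (subst infsum_reindex) (auto simp: inj_on_def o_def)
  finally show ?thesis .
qed

lemma cinner_slot_slot: "cinner (blinfun_apply (slot k) v) (blinfun_apply (slot k) w) = cinner v w"
proof -
  have "blinfun_apply (unslot k) (blinfun_apply (slot k) w) = w" by (rule ell2_eqI) simp
  then show ?thesis by (simp add: cinner_slot)
qed

lemma slot_cscale: "blinfun_apply (slot k) (cscale c v) = cscale c (blinfun_apply (slot k) v)"
  by (rule ell2_eqI) simp

lemma unslot_cscale: "blinfun_apply (unslot k) (cscale c v) = cscale c (blinfun_apply (unslot k) v)"
  by (rule ell2_eqI) simp

abbreviation embed_block :: "nat \<Rightarrow> nat \<Rightarrow> int oper \<Rightarrow> (nat \<times> int) oper" where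
  "embed_block k l x \<equiv> slot k o\<^sub>L x o\<^sub>L unslot l"

abbreviation get_block :: "nat \<Rightarrow> nat \<Rightarrow> (nat \<times> int) oper \<Rightarrow> int oper" where
  "get_block k l z \<equiv> unslot k o\<^sub>L z o\<^sub>L slot l"

lemma embed_block_bounded_ops: "x \<in> bounded_ops \<Longrightarrow> embed_block k l x \<in> bounded_ops"
  by (rule bounded_opsI) (simp add: slot_cscale unslot_cscale bounded_opsD)

lemma get_block_bounded_ops: "z \<in> bounded_ops \<Longrightarrow> get_block k l z \<in> bounded_ops"
  by (rule bounded_opsI) (simp add: slot_cscale unslot_cscale bounded_opsD)

lemma unslot_ket: "blinfun_apply (unslot l) (ket z) = (if fst z = l then ket (snd z) else 0)"
  by (rule ell2_eqI) (cases z, auto)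

lemma slot_ket: "blinfun_apply (slot l) (ket j) = ket (l, j)"
  by (rule ell2_eqI) auto

lemma entry_embed_block: "entry (embed_block k l x) z w =
    (if fst z = k \<and> fst w = l then entry x (snd z) (snd w) else 0)"
  by (simp add: entry_def unslot_ket)

lemma entry_get_block: "entry (get_block k l z) i j = entry z (k, i) (l, j)"
  by (simp add: entry_def slot_ket)

text \<open>Slots carry orthonormal systems to orthonormal systems, so coefficients of a block are
  among those of \<open>z\<close>.\<close>

lemma sing_sum_get_block: "sing_sum p (get_block k l z) \<le> sing_sum p z"
proof (rule sing_sum_least)
  fix n :: nat and u v :: "nat \<Rightarrow> int ell2"
  assume "ons {..<n} u" "ons {..<n} v"
  then have "ons {..<n} (\<lambda>i. blinfun_apply (slot k) (u i))" "ons {..<n} (\<lambda>i. blinfun_apply (slot l) (v i))"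
    by (simp_all add: ons_def cinner_slot_slot)
  from sing_sum_upper_nat[OF this, of z p]
  show "ennreal (\<Sum>i<n. cmod (cinner (u i) (blinfun_apply (get_block k l z) (v i))) powr p) \<le> sing_sum p z"
    by (simp add: cinner_slot)
qed

lemma get_block_finite_ops:
  assumes "z \<in> finite_ops"
  shows "get_block k l z \<in> finite_ops"
proof -
  obtain F where F: "finite F" "\<forall>i j. entry z i j \<noteq> 0 \<longrightarrow> i \<in> F \<and> j \<in> F" and z: "z \<in> bounded_ops"
    using assms unfolding finite_ops_iff by blast
  have "finite (snd ` F)" using F(1) by simp
  moreover have "\<forall>i j. entry (get_block k l z) i j \<noteq> 0 \<longrightarrow> i \<in> snd ` F \<and> j \<in> snd ` F"
    unfolding entry_get_block using F(2) by (metis image_eqI snd_conv)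
  ultimately show ?thesis unfolding finite_ops_iff using get_block_bounded_ops[OF z] by blast
qed

lemma get_block_schatten_class:
  assumes "1 \<le> p" "p \<noteq> \<infinity>" "z \<in> schatten_class p"
  shows "get_block k l z \<in> schatten_class p"
  using assms sing_sum_get_block[of "enn2real p" k z l]
  by (auto simp: schatten_class_iff get_block_bounded_ops intro: order.strict_trans1)

lemma slot_projection:
  "coord (blinfun_apply (\<Sum>k<s. slot k o\<^sub>L unslot k) w) z = (if fst z < s then coord w z else 0)"
proof -
  have "coord (blinfun_apply (\<Sum>k<s. slot k o\<^sub>L unslot k) w) z = (\<Sum>k<s. if fst z = k then coord w z else 0)"
    unfolding blinfun.sum_left coord_sum by (rule sum.cong) (auto simp: prod_eq_iff[symmetric])
  then show ?thesis by simp
qed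

lemma entry_slot_projection_left:
  "entry ((\<Sum>k<s. slot k o\<^sub>L unslot k) o\<^sub>L z) a b = (if fst a < s then entry z a b else 0)"
  by (simp only: entry_def blinfun_apply_blinfun_compose slot_projection)

lemma entry_slot_projection_right:
  "entry (z o\<^sub>L (\<Sum>k<s. slot k o\<^sub>L unslot k)) a b = (if fst b < s then entry z a b else 0)"
proof -
  have "blinfun_apply (\<Sum>k<s. slot k o\<^sub>L unslot k) (ket b) = (if fst b < s then ket b else 0)"
    by (rule ell2_eqI) (auto simp only: slot_projection, auto)
  then show ?thesis by (simp only: entry_def blinfun_apply_blinfun_compose) simp
qed

lemma slot_projection_bounded_ops: "(\<Sum>k<s. slot k o\<^sub>L unslot k) \<in> bounded_ops"
  by (intro bounded_ops_sum bounded_opsI) (simp add: slot_cscale unslot_cscale)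

text \<open>Projection equations become a condition on entries, the form in which Schur
  multiplication preserves them.\<close>

lemma schatten_class_amp_iff:
  "z \<in> schatten_class_amp s p \<longleftrightarrow> z \<in> schatten_class p \<and> (\<forall>a b. entry z a b \<noteq> 0 \<longrightarrow> fst a < s \<and> fst b < s)"
proof safe
  assume z: "z \<in> schatten_class_amp s p"
  then show "z \<in> schatten_class p" by (simp add: schatten_class_amp_def)
  fix a b :: nat and i j assume ne: "entry z (a, i) (b, j) \<noteq> 0"
  have "(\<Sum>k<s. slot k o\<^sub>L unslot k) o\<^sub>L z = z" "z o\<^sub>L (\<Sum>k<s. slot k o\<^sub>L unslot k) = z"
    using z by (auto simp: schatten_class_amp_def)
  then show "fst (a, i) < s" "fst (b, j) < s"
    using ne entry_slot_projection_left[of s z "(a, i)" "(b, j)"] entry_slot_projection_right[of z s "(a, i)" "(b, j)"]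
    by (auto split: if_splits)
next
  assume z: "z \<in> schatten_class p" and s: "\<forall>a b. entry z a b \<noteq> 0 \<longrightarrow> fst a < s \<and> fst b < s"
  then have zb: "z \<in> bounded_ops" by (simp add: schatten_class_def)
  have e: "entry ((\<Sum>k<s. slot k o\<^sub>L unslot k) o\<^sub>L z) a b = entry z a b"
      "entry (z o\<^sub>L (\<Sum>k<s. slot k o\<^sub>L unslot k)) a b = entry z a b" for a b
    unfolding entry_slot_projection_left entry_slot_projection_right using s[rule_format, of a b] by auto
  have "(\<Sum>k<s. slot k o\<^sub>L unslot k) o\<^sub>L z = z"
    by (rule bounded_ops_eqI[OF bounded_ops_compose[OF slot_projection_bounded_ops zb] zb e(1)])
  moreover have "z o\<^sub>L (\<Sum>k<s. slot k o\<^sub>L unslot k) = z"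
    by (rule bounded_ops_eqI[OF bounded_ops_compose[OF zb slot_projection_bounded_ops] zb e(2)])
  ultimately show "z \<in> schatten_class_amp s p" using z by (simp add: schatten_class_amp_def)
qed

lemma entry_amplify:
  "entry (amplify s T z) a b = (if fst a < s \<and> fst b < s then entry (T (get_block (fst a) (fst b) z)) (snd a) (snd b) else 0)"
proof -
  have "entry (amplify s T z) a b = (\<Sum>k<s. \<Sum>l<s. if fst a = k then if fst b = l then entry (T (get_block k l z)) (snd a) (snd b) else 0 else 0)"
    unfolding amplify_def entry_sum entry_embed_block by (intro sum.cong refl) simp
  also have "\<dots> = (\<Sum>k<s. if fst a = k then \<Sum>l<s. if fst b = l then entry (T (get_block k l z)) (snd a) (snd b) else 0 else 0)"
    by (intro sum.cong refl) simp
  finally show ?thesis by simp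
qed

definition amp_symbol :: "(int \<times> int \<Rightarrow> complex) \<Rightarrow> (nat \<times> int) \<times> (nat \<times> int) \<Rightarrow> complex" where
  "amp_symbol m z = m (snd (fst z), snd (snd z))"

text \<open>Blockwise application of \<open>schur_op m\<close> is Schur multiplication by
  \<open>amp_symbol m\<close>. Its index type contains every amplification, so the bound
  \<open>A\<close> is uniform in \<open>s\<close>.\<close>

lemma cb_norm_schur_op:
  assumes p: "1 \<le> p" "p \<noteq> \<infinity>" and m: "fin_bound m (1 / enn2real p) B" "0 \<le> B"
    and M: "fin_bound (amp_symbol m) (1 / enn2real p) A" "0 \<le> A"
  shows "cb_norm p (schur_op m) < \<infinity>"
proof -
  have "schatten_norm p (amplify s (schur_op m) z) \<le> A"
    if z: "z \<in> schatten_tensor s p" and n: "schatten_norm p z \<le> 1" for s z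
  proof -
    have za: "z \<in> schatten_class_amp s p" using z by (simp add: schatten_tensor_def)
    then have zc: "z \<in> schatten_class p" and zs: "\<And>a b. entry z a b \<noteq> 0 \<Longrightarrow> fst a < s \<and> fst b < s"
      by (auto simp only: schatten_class_amp_iff)
    have bl: "schur_op m (get_block k l z) \<in> schatten_class p"
        "entry (schur_op m (get_block k l z)) i j = m (i, j) * entry z (k, i) (l, j)" for k l i j
      using schur_op_schatten(1,2)[OF p m get_block_schatten_class[OF p zc]] by (auto simp: entry_get_block)
    have "schur_op (amp_symbol m) z = amplify s (schur_op m) z"
    proof (rule schur_op_eqI)
      show "amplify s (schur_op m) z \<in> bounded_ops"
        unfolding amplify_def using bl(1)
        by (intro bounded_ops_sum embed_block_bounded_ops) (auto simp: schatten_class_def)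
      show "entry (amplify s (schur_op m) z) a b = amp_symbol m (a, b) * entry z a b" for a b
        using zs[of a b] by (auto simp: entry_amplify bl(2) amp_symbol_def)
    qed
    then show ?thesis using schatten_norm_schur_op_le[OF p M zc n] by simp
  qed
  then have "cb_norm p (schur_op m) \<le> ennreal A"
    unfolding cb_norm_def by (intro SUP_least map_norm_leI)
  then show ?thesis by (rule order.strict_trans1) simp
qed

lemma schatten_norm_0:
  assumes "1 \<le> p"
  shows "schatten_norm p (0 :: 'i oper) = 0"
proof (cases "p = \<infinity>")
  case False
  have "sing_sum (enn2real p) (0 :: 'i oper) \<le> 0"
    by (rule sing_sum_least) simp
  then show ?thesis using schatten_norm_eq[OF assms False bounded_ops_0, where 'a='i] by simp
qed (simp add: schatten_norm_def)

text \<open>Such a matrix is the finite sum of matrix units tensored with its blocks; it lies in the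
  algebraic tensor product, so the approximation can be exact.\<close>

lemma finite_ops_schatten_tensor:
  assumes z: "z \<in> finite_ops" and p: "1 \<le> p" and s: "\<And>a b. entry z a b \<noteq> 0 \<Longrightarrow> fst a < s \<and> fst b < s"
  shows "z \<in> schatten_tensor s p"
proof -
  let ?T = "{tensor s a x |a x. x \<in> schatten_class p}"
  \<comment> \<open>The matrix unit at \<open>(k, l)\<close>.\<close>
  define d where "d k l = (\<lambda>k' l'. if k' = k \<and> l' = l then 1 else 0 :: complex)" for k l :: nat
  have tens: "tensor s (d k l) x = embed_block k l x" if "k < s" "l < s" for k l x
  proof -
    have "tensor s (d k l) x = (\<Sum>k'<s. \<Sum>l'<s. if l' = l then (if k' = k then embed_block k l x else 0) else 0)"
      unfolding tensor_def d_def
      by (intro sum.cong refl) (auto intro!: blinfun_eqI simp: blinfun.zero_left)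
    also have "\<dots> = embed_block k l x" using that by simp
    finally show ?thesis .
  qed
  have zb: "z \<in> bounded_ops" using z by (simp add: finite_ops_def)
  have eq: "z = (\<Sum>k<s. \<Sum>l<s. tensor s (d k l) (get_block k l z))"
  proof (rule bounded_ops_eqI[OF zb])
    show "(\<Sum>k<s. \<Sum>l<s. tensor s (d k l) (get_block k l z)) \<in> bounded_ops"
      by (intro bounded_ops_sum) (simp add: tens embed_block_bounded_ops get_block_bounded_ops zb)
    fix a b
    have "entry (\<Sum>k<s. \<Sum>l<s. tensor s (d k l) (get_block k l z)) a b
        = entry (amplify s (\<lambda>x. x) z) a b"
      unfolding amplify_def entry_sum by (intro sum.cong refl) (simp add: tens)
    also have "\<dots> = entry z a b" using s[of a b] by (auto simp: entry_amplify entry_get_block)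
    finally show "entry z a b = entry (\<Sum>k<s. \<Sum>l<s. tensor s (d k l) (get_block k l z)) a b" by simp
  qed
  have "(\<Sum>k<s. \<Sum>l<s. tensor s (d k l) (get_block k l z)) \<in> span ?T"
    using finite_ops_schatten_class[OF get_block_finite_ops[OF z] p]
    by (intro span_sum span_base) blast
  then have "z \<in> span ?T" using eq by simp
  moreover have "z \<in> schatten_class_amp s p"
    unfolding schatten_class_amp_iff using finite_ops_schatten_class[OF z p] s by blast
  moreover have "schatten_norm p (z - z) < \<epsilon>" if "0 < \<epsilon>" for \<epsilon>
    using schatten_norm_0[OF p, where 'i="nat \<times> int"] that by simp
  ultimately show ?thesis unfolding schatten_tensor_def by blast
qed

text \<open>A finite matrix over \<open>nat \<times> int\<close> meets finitely many slots, so some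
  finite amplification acts on it, and the supremum over \<open>s\<close> becomes one bound for all
  of them.\<close>

lemma fin_bound_of_cb:
  assumes q: "1 \<le> q" and T: "schur_map q m T" and cb: "cb_norm q T < \<infinity>"
  obtains A where "0 \<le> A" "fin_bound (amp_symbol m) (1 / enn2real q) A"
proof (rule that)
  let ?A = "enn2real (cb_norm q T)"
  show "0 \<le> ?A" by simp
  show "fin_bound (amp_symbol m) (1 / enn2real q) ?A"
  proof (rule fin_bound_of_schatten_norm[OF q])
    fix x :: "(nat \<times> int) oper" assume x: "x \<in> finite_ops" and n: "schatten_norm q x \<le> 1"
    obtain F where F: "finite F" "\<And>i j. entry x i j \<noteq> 0 \<Longrightarrow> i \<in> F \<and> j \<in> F"
      using x unfolding finite_ops_iff by blast
    \<comment> \<open>One more than the largest slot occurring in \<open>F\<close>; the inserted 0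
      covers empty \<open>F\<close> and also makes \<open>s\<close> at least 1.\<close>
    define s where "s = Suc (Max (insert 0 (fst ` F)))"
    have Fs: "fst a < s" if "a \<in> F" for a
      using F(1) that by (simp add: s_def less_Suc_eq_le)
    have s: "\<And>a b. entry x a b \<noteq> 0 \<Longrightarrow> fst a < s \<and> fst b < s" using F(2) Fs by blast
    have xt: "x \<in> schatten_tensor s q" by (rule finite_ops_schatten_tensor[OF x q s])
    have Tb: "T (get_block k l x) \<in> bounded_ops" for k l
      using T finite_ops_schatten_class[OF get_block_finite_ops[OF x] q]
      by (auto simp: schur_map_def schatten_class_def)
    have "amplify s T x \<in> bounded_ops"
      unfolding amplify_def by (intro bounded_ops_sum embed_block_bounded_ops Tb)
    moreover have "entry (amplify s T x) a b = amp_symbol m (a, b) * entry x a b" for a b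
    proof -
      have "entry (T (get_block k l x)) i j = m (i, j) * entry x (k, i) (l, j)" for k l i j
        using T get_block_finite_ops[OF x] by (simp add: schur_map_def entry_get_block)
      then show ?thesis using s[of a b] by (auto simp: entry_amplify amp_symbol_def)
    qed
    moreover have "schatten_norm q (amplify s T x) \<le> ?A"
    proof (rule map_norm_upper[OF xt n _ _ cb])
      show "map_norm q (schatten_tensor s q) (amplify s T) \<le> cb_norm q T"
        unfolding cb_norm_def by (rule SUP_upper) (simp add: s_def)
      then show "map_norm q (schatten_tensor s q) (amplify s T) < \<infinity>"
        using cb by (rule order.strict_trans1)
    qed
    ultimately show "\<exists>y\<in>bounded_ops. (\<forall>i j. entry y i j = amp_symbol m (i, j) * entry x i j) \<and> schatten_norm q y \<le> ?A"
      by blast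
  qed simp
qed

section \<open>Complex interpolation\<close>

text \<open>The bounded function is damped by \<open>exp (e (z^2 - 1))\<close>, which decays along
  the strip. The maximum modulus principle on a long rectangle gives \<open>C + e\<close>, and
  \<open>e\<close> tends to 0. Equal bounds on both lines are enough here because growth between the
  end points is put into the symbol.\<close>

lemma three_lines:
  fixes f :: "complex \<Rightarrow> complex"
  assumes holo: "f holomorphic_on UNIV"
    and bdd: "\<And>z. 0 \<le> Re z \<Longrightarrow> Re z \<le> 1 \<Longrightarrow> cmod (f z) \<le> K"
    and edge: "\<And>z. Re z = 0 \<or> Re z = 1 \<Longrightarrow> cmod (f z) \<le> C"
    and w: "0 \<le> Re w" "Re w \<le> 1"
  shows "cmod (f w) \<le> C"
proof -
  have C0: "0 \<le> C" using order_trans[OF norm_ge_zero edge[of 0]] by simp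
  have K0: "0 \<le> K" using order_trans[OF norm_ge_zero bdd[of 0]] by simp
  have key: "cmod (f w) * exp (e * Re (w\<^sup>2 - 1)) \<le> C + e" if e: "0 < e" for e :: real
  proof -
    \<comment> \<open>The last summand ensures that \<open>K exp (- e R^2)\<close> is at most
      \<open>e\<close> on the horizontal edges.\<close>
    define R where "R = \<bar>Im w\<bar> + 1 + K / e\<^sup>2"
    \<comment> \<open>Subtracting 1 keeps the damping factor at most 1 on the closed strip.\<close>
    define g where "g z = f z * exp (of_real e * (z\<^sup>2 - 1))" for z
    define S where "S = cbox (Complex 0 (- R)) (Complex 1 R)"
    have R: "\<bar>Im w\<bar> \<le> R" "1 \<le> R" "K \<le> e\<^sup>2 * R"
      using K0 e by (auto simp: R_def field_simps)
    have ng: "cmod (g z) = cmod (f z) * exp (e * Re (z\<^sup>2 - 1))" for z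
      by (simp add: g_def norm_mult)
    have Re2: "Re (z\<^sup>2 - 1) \<le> - (Im z)\<^sup>2" if "0 \<le> Re z" "Re z \<le> 1" for z
      using that power_le_one[of "Re z" 2] by (simp add: Re_power2)
    have exp1: "exp (e * Re (z\<^sup>2 - 1)) \<le> 1" if "0 \<le> Re z" "Re z \<le> 1" for z
    proof -
      have "Re (z\<^sup>2 - 1) \<le> 0" using Re2[OF that] zero_le_power2[of "Im z"] by linarith
      then show ?thesis using e by (simp add: mult_nonneg_nonpos)
    qed
    have "norm (g w) \<le> C + e"
    proof (rule maximum_modulus_frontier[of g S])
      have hol: "g holomorphic_on UNIV"
        unfolding g_def[abs_def] by (intro holomorphic_intros holo)
      then show "g holomorphic_on interior S" by (rule holomorphic_on_subset) simp
      show "continuous_on (closure S) g"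
        by (rule holomorphic_on_imp_continuous_on) (rule holomorphic_on_subset[OF hol], simp)
      show "bounded S" by (simp add: S_def bounded_cbox)
      show "w \<in> S" using w R by (auto simp: S_def in_cbox_complex_iff)
      fix z assume "z \<in> frontier S"
      then have z: "0 \<le> Re z" "Re z \<le> 1" "\<bar>Im z\<bar> \<le> R" and
        fr: "Re z = 0 \<or> Re z = 1 \<or> \<bar>Im z\<bar> = R"
        unfolding S_def frontier_cbox by (auto simp: in_cbox_complex_iff in_box_complex_iff)
      show "norm (g z) \<le> C + e"
      proof (cases "Re z = 0 \<or> Re z = 1")
        case True
        have "norm (g z) \<le> C * 1"
          unfolding ng using edge[OF True] exp1[OF z(1,2)] C0 by (intro mult_mono) auto
        then show ?thesis using e by simp
      next
        case False
        then have I: "(Im z)\<^sup>2 = R\<^sup>2" using fr by (metis power2_abs)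
        have "e * Re (z\<^sup>2 - 1) \<le> - (e * R\<^sup>2)"
          using Re2[OF z(1,2)] e mult_left_mono[of "Re (z\<^sup>2 - 1)" "- R\<^sup>2" e] by (simp add: I)
        then have "exp (e * Re (z\<^sup>2 - 1)) \<le> exp (- (e * R\<^sup>2))" by simp
        then have "norm (g z) \<le> K * exp (- (e * R\<^sup>2))"
          unfolding ng using bdd[OF z(1,2)] K0 by (intro mult_mono) auto
        also have "\<dots> \<le> e"
        proof -
          have "K \<le> e * (e * R)" using R(3) by (simp add: power2_eq_square)
          also have "\<dots> \<le> e * (e * R\<^sup>2)"
            using R(2) e by (intro mult_left_mono) (auto simp: power2_eq_square)
          also have "\<dots> \<le> e * exp (e * R\<^sup>2)"
            using e exp_ge_add_one_self[of "e * R\<^sup>2"] by (intro mult_left_mono) linarith+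
          finally show ?thesis by (simp add: exp_minus field_simps)
        qed
        finally show ?thesis using C0 by simp
      qed
    qed
    then show ?thesis by (simp only: ng)
  qed
  show ?thesis
  proof (rule tendsto_le[of "at_right 0"])
    show "((\<lambda>e. cmod (f w) * exp (e * Re (w\<^sup>2 - 1))) \<longlongrightarrow> cmod (f w)) (at_right 0)"
      by (auto intro!: tendsto_eq_intros)
    show "((\<lambda>e. C + e) \<longlongrightarrow> C) (at_right 0)"
      by (auto intro!: tendsto_eq_intros)
    show "\<forall>\<^sub>F e in at_right 0. cmod (f w) * exp (e * Re (w\<^sup>2 - 1)) \<le> C + e"
      using eventually_at_right_less by (rule eventually_mono) (rule key)
  qed simp
qed

definition strip_bounded :: "(complex \<Rightarrow> complex) \<Rightarrow> bool" where
  "strip_bounded f \<longleftrightarrow> (\<exists>K. \<forall>z. 0 \<le> Re z \<and> Re z \<le> 1 \<longrightarrow> cmod (f z) \<le> K)"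

lemma strip_bounded_const: "strip_bounded (\<lambda>_. c)"
  by (auto simp: strip_bounded_def)

lemma strip_bounded_add: "strip_bounded f \<Longrightarrow> strip_bounded g \<Longrightarrow> strip_bounded (\<lambda>z. f z + g z)"
  unfolding strip_bounded_def by (metis (no_types, lifting) add_mono norm_triangle_ineq order_trans)

lemma strip_bounded_mult:
  assumes "strip_bounded f" "strip_bounded g"
  shows "strip_bounded (\<lambda>z. f z * g z)"
proof -
  obtain K L where K: "\<And>z. 0 \<le> Re z \<Longrightarrow> Re z \<le> 1 \<Longrightarrow> cmod (f z) \<le> K"
    and L: "\<And>z. 0 \<le> Re z \<Longrightarrow> Re z \<le> 1 \<Longrightarrow> cmod (g z) \<le> L"
    using assms unfolding strip_bounded_def by blast
  have "cmod (f z * g z) \<le> K * L" if "0 \<le> Re z" "Re z \<le> 1" for z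
    unfolding norm_mult
    by (rule mult_mono[OF K[OF that] L[OF that] order_trans[OF norm_ge_zero K[OF that]] norm_ge_zero])
  then show ?thesis unfolding strip_bounded_def by blast
qed

lemma strip_bounded_sum:
  "(\<And>k. k \<in> K \<Longrightarrow> strip_bounded (f k)) \<Longrightarrow> strip_bounded (\<lambda>z. \<Sum>k\<in>K. f k z)"
  by (induction K rule: infinite_finite_induct) (auto intro: strip_bounded_const strip_bounded_add)

text \<open>The entire function \<open>r\<close> to the power \<open>z\<close>, set to 0 for
  \<open>r = 0\<close> in accordance with \<open>powr\<close>, so that vanishing weights stay zero
  along the whole family.\<close>

definition cpw :: "real \<Rightarrow> complex \<Rightarrow> complex" where
  "cpw r z = (if r = 0 then 0 else exp (z * of_real (ln r)))"

lemma cpw_of_real: "0 \<le> r \<Longrightarrow> cpw r (of_real a) = of_real (r powr a)"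
  by (auto simp: cpw_def powr_def simp flip: exp_of_real)

text \<open>The imaginary part of the exponent contributes a phase only, which the coefficients
  \<open>\<omega>\<close> and \<open>\<zeta>\<close> in \<open>fin_bound\<close> absorb.\<close>

lemma cpw_polar: "0 \<le> r \<Longrightarrow> cpw r z = of_real (r powr Re z) * cis (Im z * ln r)"
  by (auto simp: cpw_def powr_def exp_eq_polar)

lemma holomorphic_cpw: "g holomorphic_on A \<Longrightarrow> (\<lambda>z. cpw r (g z)) holomorphic_on A"
  by (cases "r = 0") (auto simp: cpw_def intro!: holomorphic_intros)

lemma strip_bounded_cpw:
  assumes "0 \<le> r" "r \<le> 1" "\<And>z. 0 \<le> Re z \<Longrightarrow> Re z \<le> 1 \<Longrightarrow> 0 \<le> Re (g z)"
  shows "strip_bounded (\<lambda>z. cpw r (g z))"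
  unfolding strip_bounded_def
proof (intro exI[of _ 1] allI impI)
  fix z assume "0 \<le> Re z \<and> Re z \<le> 1"
  then have "r powr Re (g z) \<le> 1 powr Re (g z)" using assms by (intro powr_mono2) auto
  then show "cmod (cpw r (g z)) \<le> 1" using assms(1) by (simp add: cpw_polar norm_mult)
qed

text \<open>For fixed orthonormal systems the pairing in \<open>fin_bound\<close> extends to an entire function
  of the exponent, so the three lines theorem applies as in the proof of the Riesz--Thorin (or, for
  a varying symbol, Stein) theorem on \<open>\<ell>\<^sub>p\<^sup>n\<close>.\<close>

lemma fin_bound_interpolate:
  fixes M :: "complex \<Rightarrow> 'i \<times> 'i \<Rightarrow> complex"
  assumes holo: "\<And>x. (\<lambda>z. M z x) holomorphic_on UNIV" and bdd: "\<And>x. strip_bounded (\<lambda>z. M z x)"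
    and a0: "0 \<le> a0" "a0 \<le> 1" and a1: "0 \<le> a1" "a1 \<le> 1"
    and e0: "\<And>z. Re z = 0 \<Longrightarrow> fin_bound (M z) a0 C" and e1: "\<And>z. Re z = 1 \<Longrightarrow> fin_bound (M z) a1 C"
    and \<theta>: "0 \<le> \<theta>" "\<theta> \<le> 1"
  shows "fin_bound (M (of_real \<theta>)) ((1 - \<theta>) * a0 + \<theta> * a1) C"
proof (rule fin_boundI)
  fix n m :: nat and F :: "'i set" and u v f g :: "nat \<Rightarrow> 'i ell2" and \<sigma> \<tau> :: "nat \<Rightarrow> real" and \<omega> \<zeta> :: "nat \<Rightarrow> complex"
  assume F: "finite F" and u: "ons {..<n} u" and v: "ons {..<n} v" and f: "ons {..<m} f" and g: "ons {..<m} g"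
    and sf: "\<And>k. k < m \<Longrightarrow> supported F (f k)" and sg: "\<And>k. k < m \<Longrightarrow> supported F (g k)"
    and \<sigma>: "subprob m \<sigma>" and \<tau>: "subprob n \<tau>" and \<omega>: "\<And>l. l < n \<Longrightarrow> cmod (\<omega> l) \<le> 1" and \<zeta>: "\<And>k. k < m \<Longrightarrow> cmod (\<zeta> k) \<le> 1"
  define a where "a z = (1 - z) * of_real a0 + z * of_real a1" for z :: complex
  define H where "H z = (\<Sum>l<n. \<Sum>k<m. \<omega> l * cpw (\<tau> l) (1 - a z) * (\<zeta> k * cpw (\<sigma> k) (a z))
      * schur_form (M z) F (u l) (v l) (f k) (g k))" for z
  have \<sigma>0: "0 \<le> \<sigma> k" "\<sigma> k \<le> 1" if "k < m" for k
    using \<sigma> that subprob_powr_le[OF \<sigma> that, of 1] by (auto simp: subprob_def)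
  have \<tau>0: "0 \<le> \<tau> l" "\<tau> l \<le> 1" if "l < n" for l
    using \<tau> that subprob_powr_le[OF \<tau> that, of 1] by (auto simp: subprob_def)
  have Re_a: "Re (a z) = (1 - Re z) * a0 + Re z * a1" for z by (simp add: a_def)
  have Re_a01: "0 \<le> Re (a z)" "Re (a z) \<le> 1" if "0 \<le> Re z" "Re z \<le> 1" for z
  proof -
    show "0 \<le> Re (a z)" unfolding Re_a using that a0 a1 by (intro add_nonneg_nonneg mult_nonneg_nonneg) auto
    have "Re (a z) \<le> (1 - Re z) * 1 + Re z * 1"
      unfolding Re_a using that a0 a1 by (intro add_mono mult_left_mono) auto
    then show "Re (a z) \<le> 1" by simp
  qed
  have "H holomorphic_on UNIV"
    unfolding H_def schur_form_def a_def
    by (intro holomorphic_intros holomorphic_cpw holo)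
  moreover have "strip_bounded H"
    unfolding H_def[abs_def] schur_form_def using \<sigma>0 \<tau>0 Re_a01
    by (intro strip_bounded_sum strip_bounded_mult strip_bounded_const bdd strip_bounded_cpw) auto
  then obtain K where "\<And>z. 0 \<le> Re z \<Longrightarrow> Re z \<le> 1 \<Longrightarrow> cmod (H z) \<le> K"
    unfolding strip_bounded_def by blast
  moreover have "cmod (H z) \<le> C" if z: "Re z = 0 \<or> Re z = 1" for z
  proof -
    define \<omega>' where "\<omega>' l = \<omega> l * cis (Im (1 - a z) * ln (\<tau> l))" for l
    define \<zeta>' where "\<zeta>' k = \<zeta> k * cis (Im (a z) * ln (\<sigma> k))" for k
    have b: "fin_bound (M z) (Re (a z)) C"
      using z e0[of z] e1[of z] by (auto simp: Re_a)
    have "H z = (\<Sum>l<n. \<Sum>k<m. \<omega>' l * of_real (\<tau> l powr (1 - Re (a z))) * (\<zeta>' k * of_real (\<sigma> k powr Re (a z)))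
      * schur_form (M z) F (u l) (v l) (f k) (g k))"
      unfolding H_def \<omega>'_def \<zeta>'_def
      by (intro sum.cong refl) (use \<sigma>0 \<tau>0 in \<open>simp add: cpw_polar mult_ac\<close>)
    also have "cmod \<dots> \<le> C"
      by (rule fin_boundD[OF b F u v f g sf sg \<sigma> \<tau>]) (use \<omega> \<zeta> in \<open>auto simp: \<omega>'_def \<zeta>'_def norm_mult\<close>)
    finally show ?thesis .
  qed
  ultimately have "cmod (H (of_real \<theta>)) \<le> C"
    by (rule three_lines) (use \<theta> in auto)
  also have "H (of_real \<theta>) = (\<Sum>l<n. \<Sum>k<m. \<omega> l * of_real (\<tau> l powr (1 - ((1 - \<theta>) * a0 + \<theta> * a1)))
      * (\<zeta> k * of_real (\<sigma> k powr ((1 - \<theta>) * a0 + \<theta> * a1)))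
      * schur_form (M (of_real \<theta>)) F (u l) (v l) (f k) (g k))"
  proof -
    have a\<theta>: "a (of_real \<theta>) = of_real ((1 - \<theta>) * a0 + \<theta> * a1)" by (simp add: a_def)
    have a\<theta>': "1 - a (of_real \<theta>) = of_real (1 - ((1 - \<theta>) * a0 + \<theta> * a1))" by (simp add: a_def)
    show ?thesis unfolding H_def a\<theta>' unfolding a\<theta>
      by (intro sum.cong refl) (use \<sigma>0 \<tau>0 in \<open>simp only: cpw_of_real lessThan_iff\<close>)
  qed
  finally show "cmod (\<Sum>l<n. \<Sum>k<m. \<omega> l * of_real (\<tau> l powr (1 - ((1 - \<theta>) * a0 + \<theta> * a1)))
      * (\<zeta> k * of_real (\<sigma> k powr ((1 - \<theta>) * a0 + \<theta> * a1)))
      * schur_form (M (of_real \<theta>)) F (u l) (v l) (f k) (g k)) \<le> C" .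
qed

section \<open>The end points \<open>p = 2\<close> and \<open>p = 1, \<infinity>\<close>\<close>

text \<open>A row consists of conjugated coordinates of a combination of the orthonormal
  \<open>g k\<close>, so Pythagoras computes its norm; the remaining sum over \<open>i\<close>
  concerns unit vectors \<open>f k\<close>.\<close>

lemma hilbert_schmidt_le:
  assumes F: "finite F" and f: "ons {..<m::nat} f" and g: "ons {..<m} g"
  shows "(\<Sum>i\<in>F. \<Sum>j\<in>F. (cmod (\<Sum>k<m. s k * coord (f k) i * cnj (coord (g k) j)))\<^sup>2) \<le> (\<Sum>k<m. (cmod (s k))\<^sup>2)"
proof -
  have row: "(\<Sum>j\<in>F. (cmod (\<Sum>k<m. s k * coord (f k) i * cnj (coord (g k) j)))\<^sup>2)
      \<le> (\<Sum>k<m. (cmod (s k))\<^sup>2 * (cmod (coord (f k) i))\<^sup>2)" for i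
  proof -
    define h where "h = (\<Sum>k<m. cscale (cnj (s k * coord (f k) i)) (g k))"
    have "cmod (\<Sum>k<m. s k * coord (f k) i * cnj (coord (g k) j)) = cmod (coord h j)" for j
    proof -
      have "(\<Sum>k<m. s k * coord (f k) i * cnj (coord (g k) j)) = cnj (coord h j)"
        by (simp add: h_def)
      then show ?thesis by simp
    qed
    then have "(\<Sum>j\<in>F. (cmod (\<Sum>k<m. s k * coord (f k) i * cnj (coord (g k) j)))\<^sup>2) \<le> (norm h)\<^sup>2"
      using sum_coord_le_norm[OF F, of h] by simp
    also have "(norm h)\<^sup>2 = (\<Sum>k<m. (cmod (s k))\<^sup>2 * (cmod (coord (f k) i))\<^sup>2)"
      unfolding h_def pythagoras[OF g finite_lessThan] by (simp add: norm_mult power_mult_distrib)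
    finally show ?thesis .
  qed
  have "(\<Sum>i\<in>F. \<Sum>j\<in>F. (cmod (\<Sum>k<m. s k * coord (f k) i * cnj (coord (g k) j)))\<^sup>2)
      \<le> (\<Sum>i\<in>F. \<Sum>k<m. (cmod (s k))\<^sup>2 * (cmod (coord (f k) i))\<^sup>2)" by (intro sum_mono row)
  also have "\<dots> = (\<Sum>k<m. (cmod (s k))\<^sup>2 * (\<Sum>i\<in>F. (cmod (coord (f k) i))\<^sup>2))"
    by (subst sum.swap) (simp add: sum_distrib_left)
  also have "\<dots> \<le> (\<Sum>k<m. (cmod (s k))\<^sup>2 * 1)"
  proof (intro sum_mono mult_left_mono)
    fix k assume "k \<in> {..<m}"
    then show "(\<Sum>i\<in>F. (cmod (coord (f k) i))\<^sup>2) \<le> 1"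
      using sum_coord_le_norm[OF F, of "f k"] ons_norm[OF f, of k] by simp
  qed simp
  finally show ?thesis by simp
qed

lemma weight_square_sum_le:
  assumes "subprob m \<sigma>" "\<And>k. k < m \<Longrightarrow> cmod (\<zeta> k) \<le> 1"
  shows "(\<Sum>k<m. (cmod (\<zeta> k * of_real (\<sigma> k powr (1 / 2))))\<^sup>2) \<le> 1"
proof -
  have "(\<Sum>k<m. (cmod (\<zeta> k * of_real (\<sigma> k powr (1 / 2))))\<^sup>2) \<le> (\<Sum>k<m. \<sigma> k)"
  proof (intro sum_mono)
    fix k assume k: "k \<in> {..<m}"
    then have s0: "0 \<le> \<sigma> k" using assms(1) by (simp add: subprob_def)
    have "(cmod (\<zeta> k))\<^sup>2 * \<sigma> k \<le> 1 * \<sigma> k"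
      using assms(2)[of k] k s0 by (intro mult_right_mono power_le_one) auto
    then show "(cmod (\<zeta> k * of_real (\<sigma> k powr (1 / 2))))\<^sup>2 \<le> \<sigma> k"
      using s0 by (simp add: norm_mult power_mult_distrib powr_half_sqrt)
  qed
  also have "\<dots> \<le> 1" using assms(1) by (simp add: subprob_def)
  finally show ?thesis .
qed

text \<open>At \<open>a = 1/2\<close> both families of weights are square roots, so the input
  \<open>X\<close> and the dual matrix \<open>Y\<close> have Hilbert-Schmidt norm at most 1. The
  pairing is an entrywise sum over \<open>M\<close>, and Cauchy-Schwarz finishes.\<close>

lemma fin_bound_half:
  fixes M :: "'i \<times> 'i \<Rightarrow> complex"
  assumes M: "\<And>x. cmod (M x) \<le> A"
  shows "fin_bound M (1 / 2) A"
proof (rule fin_boundI)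
  fix n m :: nat and F :: "'i set" and u v f g :: "nat \<Rightarrow> 'i ell2" and \<sigma> \<tau> :: "nat \<Rightarrow> real" and \<omega> \<zeta> :: "nat \<Rightarrow> complex"
  assume F: "finite F" and u: "ons {..<n} u" and v: "ons {..<n} v" and f: "ons {..<m} f" and g: "ons {..<m} g"
    and \<sigma>: "subprob m \<sigma>" and \<tau>: "subprob n \<tau>" and \<omega>: "\<And>l. l < n \<Longrightarrow> cmod (\<omega> l) \<le> 1" and \<zeta>: "\<And>k. k < m \<Longrightarrow> cmod (\<zeta> k) \<le> 1"
  have A: "0 \<le> A" using M[of undefined] norm_ge_zero[of "M undefined"] by linarith
  define s where "s k = \<zeta> k * of_real (\<sigma> k powr (1 / 2))" for k
  define t where "t l = \<omega> l * of_real (\<tau> l powr (1 / 2))" for l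
  define X where "X i j = (\<Sum>k<m. s k * coord (f k) i * cnj (coord (g k) j))" for i j
  define Y where "Y i j = (\<Sum>l<n. cnj (t l) * coord (u l) i * cnj (coord (v l) j))" for i j
  have "(\<Sum>l<n. \<Sum>k<m. \<omega> l * of_real (\<tau> l powr (1 - 1 / 2)) * (\<zeta> k * of_real (\<sigma> k powr (1 / 2)))
      * schur_form M F (u l) (v l) (f k) (g k))
      = (\<Sum>l<n. t l * (\<Sum>k<m. s k * schur_form M F (u l) (v l) (f k) (g k)))"
    by (simp add: s_def t_def sum_distrib_left mult_ac)
  also have "\<dots> = (\<Sum>l<n. t l * (\<Sum>i\<in>F. \<Sum>j\<in>F. cnj (coord (u l) i) * (M (i, j) * X i j) * coord (v l) j))"
  proof (intro sum.cong refl)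
    fix l
    have "(\<Sum>i\<in>F. \<Sum>j\<in>F. cnj (coord (u l) i) * (M (i, j) * X i j) * coord (v l) j)
        = (\<Sum>k<m. s k * schur_form M F (u l) (v l) (f k) (g k))"
      by (rule schur_form_sum) (simp add: X_def)
    then show "t l * (\<Sum>k<m. s k * schur_form M F (u l) (v l) (f k) (g k))
        = t l * (\<Sum>i\<in>F. \<Sum>j\<in>F. cnj (coord (u l) i) * (M (i, j) * X i j) * coord (v l) j)" by simp
  qed
  also have "\<dots> = (\<Sum>i\<in>F. \<Sum>j\<in>F. M (i, j) * (cnj (Y i j) * X i j))"
  proof -
    have "(\<Sum>l<n. t l * (\<Sum>i\<in>F. \<Sum>j\<in>F. cnj (coord (u l) i) * (M (i, j) * X i j) * coord (v l) j))
        = (\<Sum>l<n. \<Sum>i\<in>F. \<Sum>j\<in>F. t l * (cnj (coord (u l) i) * (M (i, j) * X i j) * coord (v l) j))"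
      by (simp only: sum_distrib_left)
    also have "\<dots> = (\<Sum>i\<in>F. \<Sum>l<n. \<Sum>j\<in>F. t l * (cnj (coord (u l) i) * (M (i, j) * X i j) * coord (v l) j))"
      by (rule sum.swap)
    also have "\<dots> = (\<Sum>i\<in>F. \<Sum>j\<in>F. \<Sum>l<n. t l * (cnj (coord (u l) i) * (M (i, j) * X i j) * coord (v l) j))"
      by (intro sum.cong refl sum.swap)
    also have "\<dots> = (\<Sum>i\<in>F. \<Sum>j\<in>F. M (i, j) * (cnj (Y i j) * X i j))"
      by (intro sum.cong refl) (simp add: Y_def sum_distrib_left sum_distrib_right mult_ac)
    finally show ?thesis .
  qed
  also have "cmod \<dots> \<le> (\<Sum>i\<in>F. \<Sum>j\<in>F. A * (cmod (Y i j) * cmod (X i j)))"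
    by (intro order_trans[OF norm_sum] sum_mono) (auto simp: norm_mult intro!: mult_right_mono M)
  also have "\<dots> = A * (\<Sum>x\<in>F \<times> F. cmod (Y (fst x) (snd x)) * cmod (X (fst x) (snd x)))"
    by (simp add: sum.cartesian_product sum_distrib_left split_def)
  also have "\<dots> \<le> A * (1 * 1)"
  proof (intro mult_left_mono sum_mult_le_sqrt A)
    have "(\<Sum>x\<in>F \<times> F. (cmod (Y (fst x) (snd x)))\<^sup>2) = (\<Sum>i\<in>F. \<Sum>j\<in>F. (cmod (Y i j))\<^sup>2)"
      by (simp add: sum.cartesian_product split_def)
    also have "\<dots> \<le> (\<Sum>l<n. (cmod (cnj (t l)))\<^sup>2)"
      unfolding Y_def by (rule hilbert_schmidt_le[OF F u v])
    also have "\<dots> \<le> 1" unfolding complex_mod_cnj t_def by (rule weight_square_sum_le[OF \<tau> \<omega>])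
    finally show "(\<Sum>x\<in>F \<times> F. (cmod (Y (fst x) (snd x)))\<^sup>2) \<le> 1\<^sup>2" by simp
    have "(\<Sum>x\<in>F \<times> F. (cmod (X (fst x) (snd x)))\<^sup>2) = (\<Sum>i\<in>F. \<Sum>j\<in>F. (cmod (X i j))\<^sup>2)"
      by (simp add: sum.cartesian_product split_def)
    also have "\<dots> \<le> (\<Sum>k<m. (cmod (s k))\<^sup>2)"
      unfolding X_def by (rule hilbert_schmidt_le[OF F f g])
    also have "\<dots> \<le> 1" unfolding s_def by (rule weight_square_sum_le[OF \<sigma> \<zeta>])
    finally show "(\<Sum>x\<in>F \<times> F. (cmod (X (fst x) (snd x)))\<^sup>2) \<le> 1\<^sup>2" by simp
  qed auto
  finally show "cmod (\<Sum>l<n. \<Sum>k<m. \<omega> l * of_real (\<tau> l powr (1 - 1 / 2)) * (\<zeta> k * of_real (\<sigma> k powr (1 / 2)))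
      * schur_form M F (u l) (v l) (f k) (g k)) \<le> A" by simp
qed

lemma coord_ket_sum:
  "finite G \<Longrightarrow> coord (\<Sum>i\<in>G. cscale (c i) (ket i)) j = (if j \<in> G then c j else 0)"
proof -
  assume G: "finite G"
  have "coord (\<Sum>i\<in>G. cscale (c i) (ket i)) j = (\<Sum>i\<in>G. if j = i then c i else 0)"
    unfolding coord_sum by (rule sum.cong) auto
  then show ?thesis using G by simp
qed

text \<open>The Schur product of the symbol with \<open>|f><g|\<close> splits along the fibres of
  \<open>\<pi>\<close> into rank one pieces \<open>|p b><q b|\<close>. The \<open>p b\<close> are
  orthogonal pieces of \<open>f\<close>, and the column bound controls the \<open>q b\<close>, so
  Cauchy-Schwarz over \<open>b\<close> bounds the trace norm by 1. As \<open>\<pi>\<close> may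
  identify indices, amplified symbols are included.\<close>

lemma sum_schur_form_le:
  fixes N :: "'b \<times> 'b \<Rightarrow> complex" and \<pi> :: "'i \<Rightarrow> 'b"
  assumes N: "\<And>G j. finite G \<Longrightarrow> (\<Sum>i\<in>G. (cmod (N (i, j)))\<^sup>2) \<le> 1"
    and F: "finite F" and u: "ons {..<n::nat} u" and v: "ons {..<n} v" and f: "norm f = 1" and g: "norm g = 1"
  shows "(\<Sum>l<n. cmod (schur_form (\<lambda>x. N (\<pi> (fst x), \<pi> (snd x))) F (u l) (v l) f g)) \<le> 1"
proof -
  define B where "B = \<pi> ` F"
  define Fb where "Fb b = {i \<in> F. \<pi> i = b}" for b
  \<comment> \<open>The part of \<open>f\<close> over the fibre of \<open>b\<close>; next,
    \<open>g\<close> weighted by the conjugated row \<open>b\<close> of \<open>N\<close>.\<close>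
  define p where "p b = (\<Sum>i\<in>Fb b. cscale (coord f i) (ket i))" for b
  define q where "q b = (\<Sum>j\<in>F. cscale (cnj (N (b, \<pi> j)) * coord g j) (ket j))" for b
  have fin: "finite B" "finite (Fb b)" for b using F by (auto simp: B_def Fb_def)
  have form: "schur_form (\<lambda>x. N (\<pi> (fst x), \<pi> (snd x))) F a c f g
      = (\<Sum>b\<in>B. cinner a (p b) * cinner (q b) c)" for a c
  proof -
    define h where "h i = (\<Sum>j\<in>F. N (\<pi> i, \<pi> j) * (cnj (coord a i) * coord f i * cnj (coord g j) * coord c j))" for i
    have "schur_form (\<lambda>x. N (\<pi> (fst x), \<pi> (snd x))) F a c f g = (\<Sum>i\<in>F. h i)"
      by (simp add: schur_form_def h_def)
    also have "\<dots> = (\<Sum>b\<in>B. \<Sum>i\<in>Fb b. h i)"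
      unfolding B_def Fb_def by (rule sum.image_gen[OF F])
    also have "\<dots> = (\<Sum>b\<in>B. cinner a (p b) * cinner (q b) c)"
    proof (intro sum.cong refl)
      fix b
      have "cinner a (p b) = (\<Sum>i\<in>Fb b. coord f i * cnj (coord a i))" by (simp add: p_def cinner_sum_right)
      moreover have "cinner (q b) c = (\<Sum>j\<in>F. N (b, \<pi> j) * cnj (coord g j) * coord c j)"
        by (simp add: q_def cinner_sum_left)
      ultimately have "cinner a (p b) * cinner (q b) c
          = (\<Sum>i\<in>Fb b. \<Sum>j\<in>F. coord f i * cnj (coord a i) * (N (b, \<pi> j) * cnj (coord g j) * coord c j))"
        by (simp add: sum_product)
      then show "(\<Sum>i\<in>Fb b. h i) = cinner a (p b) * cinner (q b) c"
        by (auto simp: h_def Fb_def mult_ac intro!: sum.cong)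
    qed
    finally show ?thesis .
  qed
  have "(\<Sum>l<n. cmod (schur_form (\<lambda>x. N (\<pi> (fst x), \<pi> (snd x))) F (u l) (v l) f g))
      \<le> (\<Sum>l<n. \<Sum>b\<in>B. cmod (cinner (u l) (p b)) * cmod (cinner (q b) (v l)))"
    unfolding form by (intro sum_mono order_trans[OF norm_sum]) (simp add: norm_mult)
  also have "\<dots> = (\<Sum>b\<in>B. \<Sum>l<n. cmod (cinner (u l) (p b)) * cmod (cinner (q b) (v l)))"
    by (rule sum.swap)
  also have "\<dots> \<le> (\<Sum>b\<in>B. norm (p b) * norm (q b))"
    by (intro sum_mono bessel_pair u v finite_lessThan)
  also have "\<dots> \<le> 1 * 1"
  proof (rule sum_mult_le_sqrt)
    have np: "(norm (p b))\<^sup>2 = (\<Sum>i\<in>Fb b. (cmod (coord f i))\<^sup>2)" for b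
    proof -
      have "supported (Fb b) (p b)" unfolding supported_def p_def coord_ket_sum[OF fin(2)] by simp
      from norm_finite[OF fin(2) this] show ?thesis unfolding p_def coord_ket_sum[OF fin(2)] by simp
    qed
    have "(\<Sum>b\<in>B. (norm (p b))\<^sup>2) = (\<Sum>i\<in>F. (cmod (coord f i))\<^sup>2)"
      unfolding np B_def Fb_def by (rule sum.image_gen[OF F, symmetric])
    also have "\<dots> \<le> 1" using sum_coord_le_norm[OF F, of f] f by simp
    finally show "(\<Sum>b\<in>B. (norm (p b))\<^sup>2) \<le> 1\<^sup>2" by simp
    have nq: "(norm (q b))\<^sup>2 = (\<Sum>j\<in>F. (cmod (N (b, \<pi> j)))\<^sup>2 * (cmod (coord g j))\<^sup>2)" for b
    proof -
      have "supported F (q b)" unfolding supported_def q_def coord_ket_sum[OF F] by simp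
      from norm_finite[OF F this] show ?thesis
        unfolding q_def coord_ket_sum[OF F] by (simp add: norm_mult power_mult_distrib)
    qed
    have "(\<Sum>b\<in>B. (norm (q b))\<^sup>2) = (\<Sum>j\<in>F. (\<Sum>b\<in>B. (cmod (N (b, \<pi> j)))\<^sup>2) * (cmod (coord g j))\<^sup>2)"
      unfolding nq by (subst sum.swap) (simp add: sum_distrib_right)
    also have "\<dots> \<le> (\<Sum>j\<in>F. 1 * (cmod (coord g j))\<^sup>2)"
      by (intro sum_mono mult_right_mono N fin) auto
    also have "\<dots> \<le> 1" using sum_coord_le_norm[OF F, of g] g by simp
    finally show "(\<Sum>b\<in>B. (norm (q b))\<^sup>2) \<le> 1\<^sup>2" by simp
  qed auto
  finally show ?thesis by simp
qed

lemma cnj_schur_form: "cnj (schur_form M F u v f g) = schur_form (\<lambda>x. cnj (M x)) F f g u v"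
  by (simp add: schur_form_def mult_ac)

text \<open>At an end point one family of weights has exponent 0 and is at most 1, while the other
  sums to at most 1; it remains to bound, for each index of the latter, the sum over the
  former.\<close>

lemma fin_bound_columns:
  fixes N :: "'b \<times> 'b \<Rightarrow> complex" and \<pi> :: "'i \<Rightarrow> 'b"
  assumes N: "\<And>G j. finite G \<Longrightarrow> (\<Sum>i\<in>G. (cmod (N (i, j)))\<^sup>2) \<le> 1" and a: "a = 0 \<or> a = 1"
  shows "fin_bound (\<lambda>x. N (\<pi> (fst x), \<pi> (snd x))) a 1"
proof (rule fin_boundI)
  fix n m :: nat and F :: "'i set" and u v f g :: "nat \<Rightarrow> 'i ell2" and \<sigma> \<tau> :: "nat \<Rightarrow> real" and \<omega> \<zeta> :: "nat \<Rightarrow> complex"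
  assume F: "finite F" and u: "ons {..<n} u" and v: "ons {..<n} v" and f: "ons {..<m} f" and g: "ons {..<m} g"
    and \<sigma>: "subprob m \<sigma>" and \<tau>: "subprob n \<tau>" and \<omega>: "\<And>l. l < n \<Longrightarrow> cmod (\<omega> l) \<le> 1" and \<zeta>: "\<And>k. k < m \<Longrightarrow> cmod (\<zeta> k) \<le> 1"
  let ?M = "\<lambda>x. N (\<pi> (fst x), \<pi> (snd x))"
  let ?S = "\<lambda>l k. cmod (schur_form ?M F (u l) (v l) (f k) (g k))"
  have a01: "0 \<le> a" "0 \<le> 1 - a" using a by auto
  have sum_l: "(\<Sum>l<n. ?S l k) \<le> 1" if "k < m" for k
    using that ons_norm[OF f] ons_norm[OF g] by (intro sum_schur_form_le N F u v) auto
  \<comment> \<open>Conjugation exchanges \<open>(u, v)\<close> with \<open>(f, g)\<close> and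
    conjugates \<open>N\<close>, whose column norms do not change. This is the duality between the
    two end points.\<close>
  have sum_k: "(\<Sum>k<m. ?S l k) \<le> 1" if "l < n" for l
  proof -
    have "?S l k = cmod (schur_form (\<lambda>x. cnj (N (\<pi> (fst x), \<pi> (snd x)))) F (f k) (g k) (u l) (v l))" for k
      unfolding cnj_schur_form[symmetric] by simp
    moreover have "(\<Sum>k<m. cmod (schur_form (\<lambda>x. cnj (N (\<pi> (fst x), \<pi> (snd x)))) F (f k) (g k) (u l) (v l))) \<le> 1"
      using that ons_norm[OF u] ons_norm[OF v] N
      by (intro sum_schur_form_le[of "\<lambda>x. cnj (N x)"] F f g) auto
    ultimately show ?thesis by simp
  qed
  have "cmod (\<Sum>l<n. \<Sum>k<m. \<omega> l * of_real (\<tau> l powr (1 - a)) * (\<zeta> k * of_real (\<sigma> k powr a))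
      * schur_form ?M F (u l) (v l) (f k) (g k)) \<le> (\<Sum>l<n. \<Sum>k<m. \<tau> l powr (1 - a) * \<sigma> k powr a * ?S l k)"
  proof (intro order_trans[OF norm_sum] sum_mono)
    fix l k assume "l \<in> {..<n}" "k \<in> {..<m}"
    then have "cmod (\<omega> l) * cmod (\<zeta> k) * (\<tau> l powr (1 - a) * \<sigma> k powr a * ?S l k) \<le> 1 * 1 * (\<tau> l powr (1 - a) * \<sigma> k powr a * ?S l k)"
      using \<omega> \<zeta> by (intro mult_right_mono mult_mono) auto
    then show "cmod (\<omega> l * of_real (\<tau> l powr (1 - a)) * (\<zeta> k * of_real (\<sigma> k powr a))
      * schur_form ?M F (u l) (v l) (f k) (g k)) \<le> \<tau> l powr (1 - a) * \<sigma> k powr a * ?S l k"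
      by (simp add: norm_mult mult_ac)
  qed
  also have "\<dots> \<le> 1"
    using a
  proof
    assume a: "a = 0"
    have "(\<Sum>l<n. \<Sum>k<m. \<tau> l powr (1 - a) * \<sigma> k powr a * ?S l k) \<le> (\<Sum>l<n. \<Sum>k<m. \<tau> l * 1 * ?S l k)"
      using \<tau> subprob_powr_le[OF \<sigma> _ a01(1)]
      by (intro sum_mono mult_right_mono mult_mono) (auto simp: a subprob_def)
    also have "\<dots> = (\<Sum>l<n. \<tau> l * (\<Sum>k<m. ?S l k))" by (simp add: sum_distrib_left)
    also have "\<dots> \<le> (\<Sum>l<n. \<tau> l * 1)" using \<tau> sum_k by (intro sum_mono mult_left_mono) (auto simp: subprob_def)
    also have "\<dots> \<le> 1" using \<tau> by (simp add: subprob_def)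
    finally show ?thesis .
  next
    assume a: "a = 1"
    have "(\<Sum>l<n. \<Sum>k<m. \<tau> l powr (1 - a) * \<sigma> k powr a * ?S l k) \<le> (\<Sum>l<n. \<Sum>k<m. 1 * \<sigma> k * ?S l k)"
      using \<sigma> subprob_powr_le[OF \<tau> _ a01(2)]
      by (intro sum_mono mult_right_mono mult_mono) (auto simp: a subprob_def)
    also have "\<dots> = (\<Sum>k<m. \<sigma> k * (\<Sum>l<n. ?S l k))" by (subst sum.swap) (simp add: sum_distrib_left)
    also have "\<dots> \<le> (\<Sum>k<m. \<sigma> k * 1)" using \<sigma> sum_l by (intro sum_mono mult_left_mono) (auto simp: subprob_def)
    also have "\<dots> \<le> 1" using \<sigma> by (simp add: subprob_def)
    finally show ?thesis .
  qed
  finally show "cmod (\<Sum>l<n. \<Sum>k<m. \<omega> l * of_real (\<tau> l powr (1 - a)) * (\<zeta> k * of_real (\<sigma> k powr a))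
      * schur_form ?M F (u l) (v l) (f k) (g k)) \<le> 1" .
qed

section \<open>A lacunary block diagonal of Fourier matrices\<close>

text \<open>Block \<open>r\<close> starts at \<open>r^2\<close> and has length \<open>r\<close>,
  hence ends before \<open>(r + 1)^2\<close>: disjoint blocks of every size with an explicit
  position.\<close>

definition in_block :: "nat \<Rightarrow> int \<Rightarrow> bool" where
  "in_block r i \<longleftrightarrow> int (r * r) \<le> i \<and> i < int (r * r + r)"

text \<open>Unspecified between the blocks, which is why \<open>fourier_symbol\<close> also tests
  membership of \<open>j\<close>.\<close>

definition block_of :: "int \<Rightarrow> nat" where
  "block_of i = (THE r. in_block r i)"

lemma in_block_unique:
  assumes "in_block r i" "in_block r' i"
  shows "r = r'"
proof -
  have *: False if "r < r'" "in_block r i" "in_block r' i" for r r'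
  proof -
    have "(r + 1) * (r + 1) \<le> r' * r'" using that(1) by (intro mult_le_mono) auto
    moreover have "int (r' * r') < int (r * r + r)" using that(2,3) unfolding in_block_def by linarith
    ultimately show False by (simp add: algebra_simps)
  qed
  show ?thesis using *[of r r'] *[of r' r] assms by (meson linorder_neqE_nat)
qed

lemma block_of_eq: "in_block r i \<Longrightarrow> block_of i = r"
  unfolding block_of_def by (rule the_equality) (auto intro: in_block_unique)

lemma in_block_iff: "in_block r i \<longleftrightarrow> (\<exists>k<r. i = int (r * r + k))"
proof
  assume "in_block r i"
  then show "\<exists>k<r. i = int (r * r + k)"
    by (intro exI[of _ "nat (i - int (r * r))"]) (auto simp: in_block_def)
qed (auto simp: in_block_def)

section \<open>Fourier matrices\<close>

definition fourier_root :: "nat \<Rightarrow> nat \<Rightarrow> complex" where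
  "fourier_root r k = cis (2 * pi * real k / real r)"

lemma fourier_root_power:
  assumes "0 < r"
  shows "fourier_root r k ^ r = 1"
proof -
  have "fourier_root r k ^ r = cis (real r * (2 * pi * real k / real r))"
    unfolding fourier_root_def by (rule Complex.DeMoivre)
  also have "real r * (2 * pi * real k / real r) = 2 * pi * real k" using assms by simp
  also have "cis \<dots> = 1" by (rule cis_multiple_2pi) simp
  finally show ?thesis .
qed

lemma fourier_root_inj: "k < r \<Longrightarrow> l < r \<Longrightarrow> fourier_root r k = fourier_root r l \<longleftrightarrow> k = l"
  using Complex.bij_betw_roots_unity[of r] unfolding bij_betw_def inj_on_def fourier_root_def by auto

lemma norm_fourier_root [simp]: "cmod (fourier_root r k) = 1"
  by (simp add: fourier_root_def)

text \<open>For distinct indices the sum is geometric with a ratio different from 1 whose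
  \<open>r\<close>-th power is 1.\<close>

lemma fourier_orthogonal:
  assumes "k < r" "l < r"
  shows "(\<Sum>i<r. cnj (fourier_root r k ^ i) * fourier_root r l ^ i) = (if k = l then of_nat r else 0)"
proof -
  define q where "q = cnj (fourier_root r k) * fourier_root r l"
  have kk: "fourier_root r k * cnj (fourier_root r k) = 1"
    using complex_norm_square[of "fourier_root r k"] by simp
  have s: "(\<Sum>i<r. cnj (fourier_root r k ^ i) * fourier_root r l ^ i) = (\<Sum>i<r. q ^ i)"
    by (simp add: q_def power_mult_distrib)
  show ?thesis
  proof (cases "k = l")
    case True
    then have "q = 1" using kk by (simp add: q_def mult.commute)
    then show ?thesis using s True by simp
  next
    case False
    have "fourier_root r k * q = fourier_root r l"
      using kk by (simp add: q_def mult.assoc[symmetric])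
    then have "q \<noteq> 1" using fourier_root_inj[OF assms] False by auto
    moreover have "q ^ r = 1"
      using assms fourier_root_power[of r] by (simp add: q_def power_mult_distrib flip: complex_cnj_power)
    ultimately show ?thesis using s False by (simp add: geometric_sum)
  qed
qed

text \<open>The Fourier matrix of order \<open>r\<close> is placed in the \<open>r\<close>-th diagonal block and scaled by \<open>r\<^sup>-\<^sup>z\<^sup>/\<^sup>2\<close>:
  the symbol is bounded for \<open>Re z = 0\<close>, and has columns in the unit ball of \<open>\<ell>\<^sub>2\<close> for \<open>Re z = 1\<close>.\<close>

definition fourier_symbol :: "complex \<Rightarrow> int \<times> int \<Rightarrow> complex" where
  "fourier_symbol z = (\<lambda>(i, j). let r = block_of j in
     if in_block r i \<and> in_block r j
     then exp (- (z / 2) * of_real (ln (real r)))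
       * fourier_root r (nat (j - int (r * r))) ^ nat (i - int (r * r))
     else 0)"

lemma fourier_symbol_block:
  assumes "k < r" "l < r"
  shows "fourier_symbol z (int (r * r + k), int (r * r + l))
    = exp (- (z / 2) * of_real (ln (real r))) * fourier_root r l ^ k"
proof -
  have b: "in_block r (int (r * r + k))" "in_block r (int (r * r + l))"
    using assms unfolding in_block_iff by blast+
  show ?thesis unfolding fourier_symbol_def using block_of_eq[OF b(2)] b by (simp add: Let_def)
qed

lemma cmod_fourier_symbol:
  "cmod (fourier_symbol z (i, j)) = (if in_block (block_of j) i \<and> in_block (block_of j) j
    then exp (- (Re z / 2) * ln (real (block_of j))) else 0)"
  by (simp add: fourier_symbol_def Let_def norm_mult norm_power)

lemma in_block_pos: "in_block r i \<Longrightarrow> 1 \<le> r"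
  by (cases r) (auto simp: in_block_def)

lemma cmod_fourier_symbol_le: "0 \<le> Re z \<Longrightarrow> cmod (fourier_symbol z x) \<le> 1"
proof (cases x)
  case (Pair i j)
  assume z: "0 \<le> Re z"
  show ?thesis
  proof (cases "in_block (block_of j) i \<and> in_block (block_of j) j")
    case True
    then have "1 \<le> real (block_of j)" using in_block_pos[of "block_of j" j] by simp
    then have "0 \<le> ln (real (block_of j))" by (rule ln_ge_zero)
    then have "- (Re z / 2) * ln (real (block_of j)) \<le> 0" using z by (intro mult_nonpos_nonneg) auto
    then show ?thesis unfolding Pair cmod_fourier_symbol by simp
  next
    case False
    then show ?thesis unfolding Pair cmod_fourier_symbol by (simp only: if_False zero_le_one norm_zero)
  qed
qed

text \<open>A column meeting block \<open>r\<close> has at most \<open>r\<close> nonzero entries,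
  each with squared modulus \<open>1 / r\<close>.\<close>

lemma fourier_symbol_columns:
  assumes z: "Re z = 1" and G: "finite G"
  shows "(\<Sum>i\<in>G. (cmod (fourier_symbol z (i, j)))\<^sup>2) \<le> 1"
proof (cases "in_block (block_of j) j")
  case False
  then show ?thesis by (simp add: cmod_fourier_symbol)
next
  case True
  define r where "r = block_of j"
  have r: "1 \<le> r" using in_block_pos[OF True] by (simp add: r_def)
  have "(exp (- (ln (real r) / 2)))\<^sup>2 = exp (- ln (real r))"
    by (simp add: power2_eq_square flip: exp_add)
  then have sq: "(exp (- (ln (real r) / 2)))\<^sup>2 = 1 / real r"
    using r by (simp add: exp_minus inverse_eq_divide)
  have "(\<Sum>i\<in>G. (cmod (fourier_symbol z (i, j)))\<^sup>2) = (\<Sum>i\<in>G. if in_block r i then 1 / real r else 0)"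
    unfolding cmod_fourier_symbol z r_def[symmetric] using True by (intro sum.cong refl) (simp add: r_def[symmetric] sq)
  also have "\<dots> = (\<Sum>i\<in>{i \<in> G. in_block r i}. 1 / real r)" by (rule sum.inter_filter[OF G, symmetric])
  also have "\<dots> = real (card {i \<in> G. in_block r i}) / real r" by simp
  also have "card {i \<in> G. in_block r i} \<le> card ((\<lambda>k. int (r * r + k)) ` {..<r})"
    by (rule card_mono) (auto simp: in_block_iff)
  then have "card {i \<in> G. in_block r i} \<le> r" using card_image_le[of "{..<r}" "\<lambda>k. int (r * r + k)"] by simp
  then have "real (card {i \<in> G. in_block r i}) / real r \<le> 1" using r by (simp add: divide_le_eq)
  finally show ?thesis .
qed

text \<open>On the left line the symbol is bounded by 1, which settles \<open>a = 1/2\<close>; on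
  the right line its columns are, which settles the end point. The map \<open>\<pi>\<close> will be
  the identity for the multiplier and \<open>snd\<close> for its amplification.\<close>

lemma fin_bound_fourier:
  fixes \<pi> :: "'i \<Rightarrow> int"
  assumes "a1 = 0 \<or> a1 = 1" "0 \<le> \<theta>" "\<theta> \<le> 1"
  shows "fin_bound (\<lambda>x. fourier_symbol (of_real \<theta>) (\<pi> (fst x), \<pi> (snd x))) ((1 - \<theta>) * (1 / 2) + \<theta> * a1) 1"
proof (rule fin_bound_interpolate)
  show "(\<lambda>z. fourier_symbol z (\<pi> (fst x), \<pi> (snd x))) holomorphic_on UNIV" for x :: "'i \<times> 'i"
    unfolding fourier_symbol_def Let_def split
    by (cases "in_block (block_of (\<pi> (snd x))) (\<pi> (fst x)) \<and> in_block (block_of (\<pi> (snd x))) (\<pi> (snd x))")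
      (auto intro!: holomorphic_intros)
  show "strip_bounded (\<lambda>z. fourier_symbol z (\<pi> (fst x), \<pi> (snd x)))" for x :: "'i \<times> 'i"
    unfolding strip_bounded_def using cmod_fourier_symbol_le by blast
  show "fin_bound (\<lambda>x. fourier_symbol z (\<pi> (fst x), \<pi> (snd x))) (1 / 2) 1" if "Re z = 0" for z
    using that by (intro fin_bound_half cmod_fourier_symbol_le) simp
  show "fin_bound (\<lambda>x. fourier_symbol z (\<pi> (fst x), \<pi> (snd x))) a1 1" if "Re z = 1" for z
    by (rule fin_bound_columns[OF fourier_symbol_columns[OF that] assms(1)])
qed (use assms in auto)

section \<open>Test vectors and the lower bound\<close>

definition block_vec :: "nat \<Rightarrow> (nat \<Rightarrow> complex) \<Rightarrow> int ell2" where
  "block_vec r c = (\<Sum>k<r. cscale (c k) (ket (int (r * r + k))))"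

lemma cinner_block_vec: "cinner (block_vec r c) (block_vec r d) = (\<Sum>k<r. cnj (c k) * d k)"
proof -
  have o: "ons {..<r} (\<lambda>k. ket (int (r * r + k)) :: int ell2)"
    by (rule ons_reindex[OF ons_ket]) (auto simp: inj_on_def)
  show ?thesis unfolding block_vec_def
    by (subst cinner_sum_left, rule sum.cong[OF refl]) (simp only: cinner_cscale_left cinner_ons_sum[OF o finite_lessThan])
qed

definition block_set :: "nat \<Rightarrow> int set" where
  "block_set r = (\<lambda>k. int (r * r + k)) ` {..<r}"

lemma finite_block_set: "finite (block_set r)"
  by (simp add: block_set_def)

lemma sum_block_set: "(\<Sum>i\<in>block_set r. h i) = (\<Sum>k<r. h (int (r * r + k)))"
  unfolding block_set_def by (subst sum.reindex) (auto simp: inj_on_def)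

lemma coord_block_vec: "k < r \<Longrightarrow> coord (block_vec r c) (int (r * r + k)) = c k"
proof -
  assume k: "k < r"
  have "coord (block_vec r c) (int (r * r + k)) = (\<Sum>l<r. if k = l then c k else 0)"
    unfolding block_vec_def coord_sum by (rule sum.cong) auto
  then show ?thesis using k by simp
qed

lemma supported_block_vec: "supported (block_set r) (block_vec r c)"
  unfolding block_vec_def block_set_def by (intro supported_sum supported_cscale supported_ket) auto

text \<open>Its projection \<open>|flat_vec r><flat_vec r|\<close> is \<open>1 / r\<close> times the
  all-ones matrix of the block.\<close>

definition flat_vec :: "nat \<Rightarrow> int ell2" where
  "flat_vec r = block_vec r (\<lambda>_. of_real (1 / sqrt (real r)))"

definition unit_vec :: "nat \<Rightarrow> nat \<Rightarrow> int ell2" where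
  "unit_vec r l = block_vec r (\<lambda>k. if k = l then 1 else 0)"

definition fourier_vec :: "nat \<Rightarrow> nat \<Rightarrow> int ell2" where
  "fourier_vec r l = block_vec r (\<lambda>k. of_real (1 / sqrt (real r)) * fourier_root r l ^ k)"

text \<open>Paired with \<open>unit_vec r\<close>, these vectors give the conjugate Fourier matrix
  divided by the root of \<open>r\<close>, all of whose singular values are 1.\<close>

definition fourier_vec_cnj :: "nat \<Rightarrow> nat \<Rightarrow> int ell2" where
  "fourier_vec_cnj r l = block_vec r (\<lambda>k. of_real (1 / sqrt (real r)) * cnj (fourier_root r l ^ k))"

lemma inverse_sqrt_square: "0 < r \<Longrightarrow> complex_of_real (1 / sqrt (real r)) * of_real (1 / sqrt (real r)) = of_real (1 / real r)"
  by (simp flip: of_real_mult)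

lemma ons_flat_vec: "0 < r \<Longrightarrow> ons {..<1::nat} (\<lambda>_. flat_vec r)"
proof -
  assume r: "0 < r"
  then have "cinner (flat_vec r) (flat_vec r) = 1"
    unfolding flat_vec_def cinner_block_vec complex_cnj_complex_of_real inverse_sqrt_square[OF r] by simp
  then show ?thesis by (simp add: ons_def)
qed

lemma ons_unit_vec: "ons {..<r} (unit_vec r)"
  unfolding ons_def
proof (intro ballI)
  fix k l assume "k \<in> {..<r}" "l \<in> {..<r}"
  moreover have "cinner (unit_vec r k) (unit_vec r l) = (\<Sum>i<r. if i = k then (if k = l then 1 else 0) else 0)"
    unfolding unit_vec_def cinner_block_vec by (rule sum.cong) auto
  ultimately show "cinner (unit_vec r k) (unit_vec r l) = (if k = l then 1 else 0)" by simp
qed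

lemma ons_fourier_vec: "ons {..<r} (fourier_vec r)"
  unfolding ons_def
proof (intro ballI)
  fix k l assume kl: "k \<in> {..<r}" "l \<in> {..<r}"
  then have r: "0 < r" by auto
  have "cinner (fourier_vec r k) (fourier_vec r l)
      = of_real (1 / real r) * (\<Sum>i<r. cnj (fourier_root r k ^ i) * fourier_root r l ^ i)"
    unfolding fourier_vec_def cinner_block_vec sum_distrib_left inverse_sqrt_square[OF r, symmetric]
    by (intro sum.cong refl) (simp only: complex_cnj_mult complex_cnj_complex_of_real mult_ac)
  also have "\<dots> = (if k = l then 1 else 0)"
    unfolding fourier_orthogonal[OF kl[unfolded lessThan_iff]] using r by simp
  finally show "cinner (fourier_vec r k) (fourier_vec r l) = (if k = l then 1 else 0)" .
qed

lemma ons_fourier_vec_cnj: "ons {..<r} (fourier_vec_cnj r)"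
  unfolding ons_def
proof (intro ballI)
  fix k l assume kl: "k \<in> {..<r}" "l \<in> {..<r}"
  then have r: "0 < r" by auto
  have "cinner (fourier_vec_cnj r k) (fourier_vec_cnj r l)
      = of_real (1 / real r) * cnj (\<Sum>i<r. cnj (fourier_root r k ^ i) * fourier_root r l ^ i)"
    unfolding fourier_vec_cnj_def cinner_block_vec cnj_sum sum_distrib_left inverse_sqrt_square[OF r, symmetric]
    by (intro sum.cong refl) (simp only: complex_cnj_mult complex_cnj_complex_of_real complex_cnj_cnj mult_ac)
  also have "\<dots> = (if k = l then 1 else 0)"
    unfolding fourier_orthogonal[OF kl[unfolded lessThan_iff]] using r by simp
  finally show "cinner (fourier_vec_cnj r k) (fourier_vec_cnj r l) = (if k = l then 1 else 0)" .
qed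

lemma schur_form_block:
  assumes "\<And>k. k < r \<Longrightarrow> coord u (int (r * r + k)) = cu k" "\<And>k. k < r \<Longrightarrow> coord f (int (r * r + k)) = cf k"
  shows "schur_form (fourier_symbol z) (block_set r) u (block_vec r cv) f (block_vec r cg)
    = exp (- (z / 2) * of_real (ln (real r))) * (\<Sum>k<r. \<Sum>l<r. fourier_root r l ^ k * (cnj (cu k) * cf k * cnj (cg l) * cv l))"
  unfolding schur_form_def sum_block_set sum_distrib_left
  by (intro sum.cong refl) (simp add: fourier_symbol_block coord_block_vec assms mult.assoc del: of_nat_add of_nat_mult)

lemma unimodular_power: "cnj (fourier_root r l ^ k) * fourier_root r l ^ k = 1"
  using complex_norm_square[of "fourier_root r l ^ k"] by (simp add: norm_power mult.commute)

text \<open>Multiplying a conjugated Fourier column by the symbol cancels all phases, leaving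
  \<open>r\<close> equal terms. Three normalising factors and the scaling of the block give the
  exponent.\<close>

lemma schur_form_flat_left:
  assumes l: "l < r"
  shows "schur_form (fourier_symbol (of_real \<theta>)) (block_set r) (flat_vec r) (flat_vec r) (fourier_vec_cnj r l) (unit_vec r l)
    = of_real (real r powr (- \<theta> / 2 - 1 / 2))"
proof -
  have r: "0 < r" using l by simp
  let ?c = "complex_of_real (1 / sqrt (real r))"
  have "schur_form (fourier_symbol (of_real \<theta>)) (block_set r) (flat_vec r) (flat_vec r) (fourier_vec_cnj r l) (unit_vec r l)
    = exp (- (of_real \<theta> / 2) * of_real (ln (real r))) * (\<Sum>k<r. \<Sum>j<r. fourier_root r j ^ k *
      (cnj ?c * (?c * cnj (fourier_root r l ^ k)) * cnj (if j = l then 1 else 0) * ?c))"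
    unfolding flat_vec_def unit_vec_def fourier_vec_cnj_def
    by (rule schur_form_block) (simp_all only: coord_block_vec)
  also have "(\<Sum>k<r. \<Sum>j<r. fourier_root r j ^ k * (cnj ?c * (?c * cnj (fourier_root r l ^ k)) * cnj (if j = l then 1 else 0) * ?c))
      = (\<Sum>k<r. \<Sum>j<r. if j = l then ?c * ?c * ?c * (cnj (fourier_root r l ^ k) * fourier_root r l ^ k) else 0)"
    by (intro sum.cong refl) (auto simp: mult_ac)
  also have "\<dots> = of_nat r * (?c * ?c * ?c)" using l by (simp add: unimodular_power del: complex_cnj_power)
  also have "\<dots> = of_real (real r powr (- 1 / 2))"
    unfolding inverse_sqrt_square[OF r] using r by (simp add: powr_minus powr_half_sqrt divide_simps)
  also have "exp (- (complex_of_real \<theta> / 2) * of_real (ln (real r))) = of_real (real r powr (- \<theta> / 2))"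
    using r by (simp add: powr_def exp_of_real[symmetric])
  finally show ?thesis using r by (simp add: powr_add[symmetric] flip: of_real_mult)
qed

text \<open>The mirror image: the all-ones matrix becomes a multiple of the Fourier matrix, which is
  tested on its own singular vectors.\<close>

lemma schur_form_flat_right:
  assumes l: "l < r"
  shows "schur_form (fourier_symbol (of_real \<theta>)) (block_set r) (fourier_vec r l) (unit_vec r l) (flat_vec r) (flat_vec r)
    = of_real (real r powr (- \<theta> / 2 - 1 / 2))"
proof -
  have r: "0 < r" using l by simp
  let ?c = "complex_of_real (1 / sqrt (real r))"
  have "schur_form (fourier_symbol (of_real \<theta>)) (block_set r) (fourier_vec r l) (unit_vec r l) (flat_vec r) (flat_vec r)
    = exp (- (of_real \<theta> / 2) * of_real (ln (real r))) * (\<Sum>k<r. \<Sum>j<r. fourier_root r j ^ k *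
      (cnj (?c * fourier_root r l ^ k) * ?c * cnj ?c * (if j = l then 1 else 0)))"
    unfolding flat_vec_def unit_vec_def fourier_vec_def
    by (rule schur_form_block) (simp_all only: coord_block_vec)
  also have "(\<Sum>k<r. \<Sum>j<r. fourier_root r j ^ k * (cnj (?c * fourier_root r l ^ k) * ?c * cnj ?c * (if j = l then 1 else 0)))
      = (\<Sum>k<r. \<Sum>j<r. if j = l then ?c * ?c * ?c * (cnj (fourier_root r l ^ k) * fourier_root r l ^ k) else 0)"
    by (intro sum.cong refl) (auto simp: mult_ac)
  also have "\<dots> = of_nat r * (?c * ?c * ?c)" using l by (simp add: unimodular_power del: complex_cnj_power)
  also have "\<dots> = of_real (real r powr (- 1 / 2))"
    unfolding inverse_sqrt_square[OF r] using r by (simp add: powr_minus powr_half_sqrt divide_simps)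
  also have "exp (- (complex_of_real \<theta> / 2) * of_real (ln (real r))) = of_real (real r powr (- \<theta> / 2))"
    using r by (simp add: powr_def exp_of_real[symmetric])
  finally show ?thesis using r by (simp add: powr_add[symmetric] flip: of_real_mult)
qed

lemma subprob_uniform: "subprob r (\<lambda>_. 1 / real r)"
  by (cases "r = 0") (auto simp: subprob_def)

lemma inverse_powr: "0 < r \<Longrightarrow> (1 / real r) powr c = real r powr (- c)"
  by (simp add: powr_def ln_div)

lemma subprob_one: "subprob (Suc 0) (\<lambda>_. 1)"
  by (simp add: subprob_def)

text \<open>For \<open>a\<close> at most \<open>1/2\<close> the input has \<open>r\<close> equal
  singular values and the output is tested on one pair; otherwise the roles are exchanged. The
  \<open>r\<close> equal terms contribute the exponent 1, the uniform weights \<open>- a\<close> or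
  \<open>- (1 - a)\<close>.\<close>

lemma fin_bound_fourier_lower:
  assumes b: "fin_bound (fourier_symbol (of_real \<theta>)) a A" and r: "0 < r"
  shows "real r powr (\<bar>1 / 2 - a\<bar> - \<theta> / 2) \<le> A"
proof (cases "a \<le> 1 / 2")
  case True
  have "cmod (\<Sum>l<1::nat. \<Sum>k<r. (1 :: complex) * of_real ((1 :: real) powr (1 - a)) * (1 * of_real ((1 / real r) powr a))
      * schur_form (fourier_symbol (of_real \<theta>)) (block_set r) (flat_vec r) (flat_vec r) (fourier_vec_cnj r k) (unit_vec r k)) \<le> A"
    by (rule fin_boundD[OF b finite_block_set, where n = 1 and m = r and u = "\<lambda>_. flat_vec r" and v = "\<lambda>_. flat_vec r"
          and f = "fourier_vec_cnj r" and g = "unit_vec r" and \<sigma> = "\<lambda>_. 1 / real r" and \<tau> = "\<lambda>_. 1"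
          and \<omega> = "\<lambda>_. 1" and \<zeta> = "\<lambda>_. 1"])
      (use ons_flat_vec[OF r] ons_fourier_vec_cnj ons_unit_vec subprob_uniform in \<open>auto simp: fourier_vec_cnj_def unit_vec_def supported_block_vec subprob_one\<close>)
  moreover have "(\<Sum>l<1::nat. \<Sum>k<r. (1 :: complex) * of_real ((1 :: real) powr (1 - a)) * (1 * of_real ((1 / real r) powr a))
      * schur_form (fourier_symbol (of_real \<theta>)) (block_set r) (flat_vec r) (flat_vec r) (fourier_vec_cnj r k) (unit_vec r k))
      = of_real (real r powr (\<bar>1 / 2 - a\<bar> - \<theta> / 2))"
  proof -
    have "(\<Sum>k<r. of_real ((1 / real r) powr a) * schur_form (fourier_symbol (of_real \<theta>)) (block_set r) (flat_vec r) (flat_vec r)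
        (fourier_vec_cnj r k) (unit_vec r k)) = (\<Sum>k<r. complex_of_real (real r powr (- a) * real r powr (- \<theta> / 2 - 1 / 2)))"
      by (intro sum.cong refl) (simp only: schur_form_flat_left inverse_powr[OF r] of_real_mult lessThan_iff)
    also have "\<dots> = of_real (real r powr 1 * (real r powr (- a) * real r powr (- \<theta> / 2 - 1 / 2)))" using r by simp
    also have "real r powr 1 * (real r powr (- a) * real r powr (- \<theta> / 2 - 1 / 2)) = real r powr (\<bar>1 / 2 - a\<bar> - \<theta> / 2)"
      unfolding powr_add[symmetric] by (rule arg_cong[where f = "(powr) (real r)"]) (use True in linarith)
    finally show ?thesis by simp
  qed
  ultimately have "cmod (of_real (real r powr (\<bar>1 / 2 - a\<bar> - \<theta> / 2))) \<le> A" by (simp only:)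
  then show ?thesis by simp
next
  case False
  have "cmod (\<Sum>l<r. \<Sum>k<1::nat. (1 :: complex) * of_real ((1 / real r) powr (1 - a)) * (1 * of_real ((1 :: real) powr a))
      * schur_form (fourier_symbol (of_real \<theta>)) (block_set r) (fourier_vec r l) (unit_vec r l) (flat_vec r) (flat_vec r)) \<le> A"
    by (rule fin_boundD[OF b finite_block_set, where n = r and m = 1 and u = "fourier_vec r" and v = "unit_vec r"
          and f = "\<lambda>_. flat_vec r" and g = "\<lambda>_. flat_vec r" and \<sigma> = "\<lambda>_. 1" and \<tau> = "\<lambda>_. 1 / real r"
          and \<omega> = "\<lambda>_. 1" and \<zeta> = "\<lambda>_. 1"])
      (use ons_flat_vec[OF r] ons_fourier_vec ons_unit_vec subprob_uniform in \<open>auto simp: flat_vec_def supported_block_vec subprob_one\<close>)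
  moreover have "(\<Sum>l<r. \<Sum>k<1::nat. (1 :: complex) * of_real ((1 / real r) powr (1 - a)) * (1 * of_real ((1 :: real) powr a))
      * schur_form (fourier_symbol (of_real \<theta>)) (block_set r) (fourier_vec r l) (unit_vec r l) (flat_vec r) (flat_vec r))
      = of_real (real r powr (\<bar>1 / 2 - a\<bar> - \<theta> / 2))"
  proof -
    have "(\<Sum>l<r. of_real ((1 / real r) powr (1 - a)) * schur_form (fourier_symbol (of_real \<theta>)) (block_set r) (fourier_vec r l)
        (unit_vec r l) (flat_vec r) (flat_vec r)) = (\<Sum>l<r. complex_of_real (real r powr (- (1 - a)) * real r powr (- \<theta> / 2 - 1 / 2)))"
      by (intro sum.cong refl) (simp only: schur_form_flat_right inverse_powr[OF r] of_real_mult lessThan_iff)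
    also have "\<dots> = of_real (real r powr 1 * (real r powr (- (1 - a)) * real r powr (- \<theta> / 2 - 1 / 2)))" using r by simp
    also have "real r powr 1 * (real r powr (- (1 - a)) * real r powr (- \<theta> / 2 - 1 / 2)) = real r powr (\<bar>1 / 2 - a\<bar> - \<theta> / 2)"
      unfolding powr_add[symmetric] by (rule arg_cong[where f = "(powr) (real r)"]) (use False in linarith)
    finally show ?thesis by simp
  qed
  ultimately have "cmod (of_real (real r powr (\<bar>1 / 2 - a\<bar> - \<theta> / 2))) \<le> A" by (simp only:)
  then show ?thesis by simp
qed

lemma fin_bound_fourier_fails:
  assumes "\<theta> / 2 < \<bar>1 / 2 - a\<bar>"
  shows "\<not> fin_bound (fourier_symbol (of_real \<theta>)) a A"
proof
  assume b: "fin_bound (fourier_symbol (of_real \<theta>)) a A"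
  define d where "d = \<bar>1 / 2 - a\<bar> - \<theta> / 2"
  have d: "0 < d" using assms by (simp add: d_def)
  obtain r :: nat where r: "(\<bar>A\<bar> + 1) powr (1 / d) < real r" using reals_Archimedean2 by blast
  then have "0 < r" using powr_ge_zero[of "\<bar>A\<bar> + 1" "1 / d"] by (cases r) auto
  have "((\<bar>A\<bar> + 1) powr (1 / d)) powr d \<le> real r powr d" using r d by (intro powr_mono2) auto
  then have "\<bar>A\<bar> + 1 \<le> real r powr d" using d by (simp add: powr_powr)
  also have "\<dots> \<le> A" using fin_bound_fourier_lower[OF b \<open>0 < r\<close>] by (simp add: d_def)
  finally show False by simp
qed

text \<open>Tested on the matrix unit at \<open>(i, j)\<close>; supplies the bound at
  \<open>1/2\<close> for \<open>fin_bound_toward_half\<close>.\<close>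

lemma fin_bound_symbol_le:
  assumes b: "fin_bound M a A"
  shows "cmod (M (i, j)) \<le> A"
proof -
  have "ons {..<1::nat} (\<lambda>_. ket i)" "ons {..<1::nat} (\<lambda>_. ket j)" by (auto simp: ons_def)
  then have "cmod (\<Sum>l<1::nat. \<Sum>k<1::nat. 1 * of_real ((1 :: real) powr (1 - a)) * (1 * of_real ((1 :: real) powr a))
      * schur_form M {i, j} (ket i) (ket j) (ket i) (ket j)) \<le> A"
    by (intro fin_boundD[OF b, where n = 1 and m = 1 and u = "\<lambda>_. ket i" and v = "\<lambda>_. ket j" and f = "\<lambda>_. ket i"
          and g = "\<lambda>_. ket j" and \<sigma> = "\<lambda>_. 1" and \<tau> = "\<lambda>_. 1" and \<omega> = "\<lambda>_. 1" and \<zeta> = "\<lambda>_. 1"])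
      (auto simp: subprob_def supported_def)
  moreover have "schur_form M {i, j} (ket i) (ket j) (ket i) (ket j) = M (i, j)"
    by (cases "i = j") (auto simp: schur_form_def)
  ultimately show ?thesis by simp
qed

lemma fin_bound_toward_half:
  assumes b: "fin_bound M a A" and a: "0 \<le> a" "a \<le> 1" and \<theta>: "0 \<le> \<theta>" "\<theta> \<le> 1"
  shows "fin_bound M ((1 - \<theta>) * (1 / 2) + \<theta> * a) A"
proof (rule fin_bound_interpolate[where M = "\<lambda>_. M"])
  show "fin_bound M (1 / 2) A" by (rule fin_bound_half) (metis fin_bound_symbol_le[OF b] surj_pair)
qed (use assms in \<open>auto intro: strip_bounded_const\<close>)

section \<open>Assembling the strict inclusions\<close>

lemma enn2real_strict_mono: "p < q \<Longrightarrow> q \<noteq> \<infinity> \<Longrightarrow> enn2real p < enn2real q"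
  by (cases p; cases q) (auto simp: ennreal_less_iff)

lemma amp_symbol_eq: "amp_symbol m = (\<lambda>x. m (snd (fst x), snd (snd x)))"
  by (simp add: amp_symbol_def fun_eq_iff)

theorem corollary3p3:
  fixes p q :: ennreal
  assumes "1 \<le> p" "1 \<le> q"
    and "(2 \<le> p \<and> p < q \<and> q \<le> \<infinity>) \<or> (1 \<le> q \<and> q < p \<and> p \<le> 2)"
  shows "schur_multipliers q \<subset> schur_multipliers p \<and>
         cb_schur_multipliers q \<subset> cb_schur_multipliers p"
proof -
  define a where "a = 1 / enn2real p"
  define b where "b = 1 / enn2real q"
  have pinf: "p \<noteq> \<infinity>" using assms(3) by (auto simp: top_unique)
  have p1: "1 \<le> enn2real p" by (rule one_le_enn2real[OF assms(1) pinf])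
  have b01: "0 \<le> b" "b \<le> 1"
  proof -
    show "0 \<le> b" by (simp add: b_def)
    show "b \<le> 1" using one_le_enn2real[OF assms(2)] by (cases "q = \<infinity>") (auto simp: b_def)
  qed
  have a01: "0 \<le> a" "a \<le> 1" using p1 by (auto simp: a_def)
  \<comment> \<open>Both alternatives say that \<open>a\<close> is strictly nearer to
    \<open>1/2\<close> than \<open>b\<close>, on the same side.\<close>
  have order: "(b < a \<and> a \<le> 1 / 2) \<or> (1 / 2 \<le> a \<and> a < b)"
    using assms(3)
  proof
    assume h: "2 \<le> p \<and> p < q \<and> q \<le> \<infinity>"
    have p2: "2 \<le> enn2real p" using h pinf by (metis enn2real_mono enn2real_numeral infinity_ennreal_def top.not_eq_extremum)
    have "b < a"
    proof (cases "q = \<infinity>")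
      case True
      then show ?thesis using p1 by (simp add: a_def b_def)
    next
      case False
      then have "enn2real p < enn2real q" using h by (intro enn2real_strict_mono) auto
      then show ?thesis using p1 by (simp add: a_def b_def frac_less2)
    qed
    then show ?thesis using p2 by (simp add: a_def)
  next
    assume h: "1 \<le> q \<and> q < p \<and> p \<le> 2"
    then have qinf: "q \<noteq> \<infinity>" by auto
    have "enn2real p \<le> 2" using h by (metis enn2real_mono enn2real_numeral ennreal_numeral_less_top)
    moreover have "enn2real q < enn2real p" using h qinf pinf by (intro enn2real_strict_mono) auto
    moreover have "1 \<le> enn2real q" by (rule one_le_enn2real[OF assms(2) qinf])
    ultimately show ?thesis using p1 by (simp add: a_def b_def frac_less2 frac_le)
  qed
  \<comment> \<open>The ratio of the signed distances from \<open>1/2\<close>, well defined since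
    \<open>b\<close> differs from \<open>1/2\<close>.\<close>
  obtain \<theta> where \<theta>: "0 \<le> \<theta>" "\<theta> \<le> 1" "a = (1 - \<theta>) * (1 / 2) + \<theta> * b"
  proof
    let ?t = "(a - 1 / 2) / (b - 1 / 2)"
    show "0 \<le> ?t" "?t \<le> 1" using order by (auto simp: divide_simps)
    have "(1 - t) * (1 / 2) + t * b = 1 / 2 + t * (b - 1 / 2)" for t :: real by (simp add: field_simps)
    then have "(1 - ?t) * (1 / 2) + ?t * b = 1 / 2 + ?t * (b - 1 / 2)" .
    also have "?t * (b - 1 / 2) = a - 1 / 2" using order by auto
    finally show "a = (1 - ?t) * (1 / 2) + ?t * b" by simp
  qed
  \<comment> \<open>Polymorphic in the index type: used for \<open>m\<close> over \<open>int\<close>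
    and for \<open>amp_symbol m\<close> over \<open>nat \<times> int\<close>.\<close>
  have transfer: "fin_bound M b A \<Longrightarrow> fin_bound M (1 / enn2real p) A" for M :: "'i \<times> 'i \<Rightarrow> complex" and A
    using fin_bound_toward_half[OF _ b01 \<theta>(1,2)] unfolding \<theta>(3)[symmetric] a_def .
  have incl: "schur_multipliers q \<subseteq> schur_multipliers p"
  proof
    fix m assume "m \<in> schur_multipliers q"
    then obtain T where "schur_map q m T" by (auto simp: schur_multipliers_def)
    then obtain A where A: "0 \<le> A" "fin_bound m b A"
      using fin_bound_of_schur_map[OF assms(2)] unfolding b_def by blast
    then show "m \<in> schur_multipliers p"
      using schur_map_schur_op[OF assms(1) pinf transfer] by (auto simp: schur_multipliers_def)
  qed
  have incl_cb: "cb_schur_multipliers q \<subseteq> cb_schur_multipliers p"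
  proof
    fix m assume "m \<in> cb_schur_multipliers q"
    then obtain T where T: "schur_map q m T" "cb_norm q T < \<infinity>" by (auto simp: cb_schur_multipliers_def)
    obtain A where A: "0 \<le> A" "fin_bound m b A"
      using fin_bound_of_schur_map[OF assms(2) T(1)] unfolding b_def by blast
    obtain B where B: "0 \<le> B" "fin_bound (amp_symbol m) b B"
      using fin_bound_of_cb[OF assms(2) T] unfolding b_def by blast
    show "m \<in> cb_schur_multipliers p"
      unfolding cb_schur_multipliers_def
      using schur_map_schur_op[OF assms(1) pinf transfer[OF A(2)] A(1)]
        cb_norm_schur_op[OF assms(1) pinf transfer[OF A(2)] A(1) transfer[OF B(2)] B(1)] by blast
  qed
  \<comment> \<open>Twice the distance of \<open>a\<close> from \<open>1/2\<close>, so that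
    \<open>a\<close> is the point at parameter \<open>t\<close> between \<open>1/2\<close> and the
    nearer end point \<open>e\<close>, the latter standing for \<open>\<S>\<^sub>\<infinity>\<close>
    or \<open>\<S>\<^sub>1\<close>.\<close>
  define t where "t = \<bar>1 - 2 * a\<bar>"
  define e :: real where "e = (if a \<le> 1 / 2 then 0 else 1)"
  have t: "0 \<le> t" "t \<le> 1" "(1 - t) * (1 / 2) + t * e = 1 / enn2real p" "e = 0 \<or> e = 1"
    using a01 by (auto simp: t_def e_def a_def[symmetric] field_simps)
  define m where "m = fourier_symbol (of_real t)"
  have m1: "fin_bound m (1 / enn2real p) 1"
    using fin_bound_fourier[OF t(4,1,2), of "\<lambda>x. x"] unfolding m_def t(3) by simp
  have m2: "fin_bound (amp_symbol m) (1 / enn2real p) 1"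
    using fin_bound_fourier[OF t(4,1,2), of snd] unfolding m_def t(3) amp_symbol_eq .
  have mp: "m \<in> cb_schur_multipliers p"
    unfolding cb_schur_multipliers_def
    using schur_map_schur_op[OF assms(1) pinf m1] cb_norm_schur_op[OF assms(1) pinf m1 _ m2] by auto
  have "t / 2 < \<bar>1 / 2 - b\<bar>" using order by (auto simp: t_def)
  then have "\<not> fin_bound m b A" for A
    unfolding m_def by (rule fin_bound_fourier_fails)
  then have mq: "m \<notin> schur_multipliers q"
    using fin_bound_of_schur_map[OF assms(2)] unfolding b_def schur_multipliers_def by blast
  \<comment> \<open>One symbol settles both strict inclusions: it is completely bounded at
    \<open>p\<close> and not even bounded at \<open>q\<close>.\<close>
  have sub: "cb_schur_multipliers r \<subseteq> schur_multipliers r" for r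
    by (auto simp: cb_schur_multipliers_def schur_multipliers_def)
  show ?thesis using incl incl_cb mp mq sub by blast
qed

end
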